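(* Let $Z$ be an arbitrary distribution of points in $\mathbb{C}$, i.e. a function $Z\colon\mathbb{C}\to\{0,1,2,\dots\}\cup\{+\infty\}$. Let $S\subset\mathbb{C}$ be a bounded simply connected domain such that $0$ belongs to the closure of the convex hull $\operatorname{co}S$ of $S$. Let $\bar S=\{\bar z: z\in S\}$ be the complex conjugate of $S$. Suppose that $$\limsup_{1<a\to+\infty}\frac{1}{\ln a}\,\limsup_{0<r\to+\infty}\int_r^{ar}\frac{Z^{\mathrm{rad}}_{\bar S}(t)}{t^2}\,dt\ \ge\ \frac{1}{\pi}\operatorname{area}(\operatorname{co}S).$$ Then the exponential system $\operatorname{Exp}^Z$ is complete in the space $\operatorname{Hol}(S)$.
   Context: A distribution of points $Z$ on $\mathbb{C}$ (repetitions allowed) is identified with its multiplicity function $Z\colon\mathbb{C}\to\overline{\mathbb{N}}_0:=\{0,1,2,\dots\}\cup\{+\infty\}$; $Z(z)$ is the number of occurrences of $z$, and $z\in Z$ means $Z(z)>0$. No local finiteness is assumed. $Z$ is also regarded as the measure $Z(A)=\sum_{z\in A}Z(z)\in\overline{\mathbb{N}}_0$, $A\subset\mathbb{C}$. For a function $f\ge 0$ on $A$, the sum over points of $Z$ in $A$ counts multiplicity: $\sum_{z\in Z,\,z\in A}f(z):=\int_A f\,dZ=\sum_{z\in A}Z(z)f(z)\in[0,+\infty]$, with the convention $0\cdot(+\infty)=0$. Exponential system with exponents $Z$: $\operatorname{Exp}^Z:=\{\,w\mapsto w^p e^{zw} : z\in Z,\ p\in\{0,1,2,\dots\},\ p\le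 Z(z)-1\,\}$ (functions of $w\in\mathbb{C}$, restricted to $S$). Support function of a set $A\subset\mathbb{C}$: $\operatorname{spf}_A(\theta):=\sup_{s\in A}\operatorname{Re}(se^{-i\theta})$, $\theta\in\mathbb{R}$; it is $2\pi$-periodic, so $\operatorname{spf}_A(\arg z)$ is well defined for $z\ne0$. It is nonnegative if and only if $0$ belongs to the closure of $\operatorname{co}A$. Radial counting function of $Z$ by arguments relative to a bounded set $A\subset\mathbb{C}$ with $0\in\overline{\operatorname{co}A}$: $$Z^{\mathrm{rad}}_A(r):=Z(0)\,\sup_{\theta\in\mathbb{R}}|\operatorname{spf}_A(\theta)|+\sum_{z\in Z,\ 0<|z|\le r}\operatorname{spf}_A(\arg z)\in[0,+\infty],\qquad r\ge0 .$$ $\operatorname{area}$ denotes Euclidean area (planar Lebesgue measure). For open $S$, $\operatorname{Hol}(S)$ is the space of holomorphic functions $f\colon S\to\mathbb{C}$ with the topology of uniform convergence on all compact subsets of $S$. A system of vectors is complete in a topological vector space if the closure of its linear span is the whole space. *)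

theory Defs
  imports "HOL-Complex_Analysis.Complex_Analysis" "HOL-Library.Function_Algebras"
begin

text \<open>
  A distribution of points is its multiplicity function \<open>Z :: complex \<Rightarrow> enat\<close>.

  A function on \<open>S\<close> is encoded by its extension by zero to the whole plane. With the pointwise
  operations of \<open>Function_Algebras\<close> such functions form a complex vector space, so that the span
  below is the library's one. (An encoding by \<open>extensional\<close> would not be closed under sums.)
\<close>

definition zero_extend :: "complex set \<Rightarrow> (complex \<Rightarrow> complex) \<Rightarrow> complex \<Rightarrow> complex" where
  "zero_extend S f = (\<lambda>w. if w \<in> S then f w else 0)"

definition Hol :: "complex set \<Rightarrow> (complex \<Rightarrow> complex) set" where
  "Hol S = {f. f holomorphic_on S \<and> (\<forall>w. w \<notin> S \<longrightarrow> f w = 0)}"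

definition Hol_open :: "complex set \<Rightarrow> (complex \<Rightarrow> complex) set \<Rightarrow> bool" where
  "Hol_open S U \<longleftrightarrow> U \<subseteq> Hol S \<and>
     (\<forall>f\<in>U. \<exists>K e. compact K \<and> K \<subseteq> S \<and> e > 0 \<and>
        {g \<in> Hol S. \<forall>w\<in>K. cmod (g w - f w) < e} \<subseteq> U)"

definition Hol_topology :: "complex set \<Rightarrow> (complex \<Rightarrow> complex) topology" where
  "Hol_topology S = topology (Hol_open S)"

lemma istopology_Hol_open: "istopology (Hol_open S)"
  unfolding istopology_def
proof (intro conjI allI impI)
  fix U V assume U: "Hol_open S U" and V: "Hol_open S V"
  show "Hol_open S (U \<inter> V)"
    unfolding Hol_open_def
  proof (intro conjI ballI)
    show "U \<inter> V \<subseteq> Hol S" using U by (auto simp: Hol_open_def)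
    fix f assume f: "f \<in> U \<inter> V"
    obtain K e where K: "compact K" "K \<subseteq> S" "e > 0"
      "{g \<in> Hol S. \<forall>w\<in>K. cmod (g w - f w) < e} \<subseteq> U"
      using U f unfolding Hol_open_def by blast
    obtain L d where L: "compact L" "L \<subseteq> S" "d > 0"
      "{g \<in> Hol S. \<forall>w\<in>L. cmod (g w - f w) < d} \<subseteq> V"
      using V f unfolding Hol_open_def by blast
    have "{g \<in> Hol S. \<forall>w\<in>K \<union> L. cmod (g w - f w) < min e d} \<subseteq>
        {g \<in> Hol S. \<forall>w\<in>K. cmod (g w - f w) < e} \<inter>
        {g \<in> Hol S. \<forall>w\<in>L. cmod (g w - f w) < d}"
      by auto
    also have "\<dots> \<subseteq> U \<inter> V"
      using K(4) L(4) by (rule Int_mono)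
    finally have "{g \<in> Hol S. \<forall>w\<in>K \<union> L. cmod (g w - f w) < min e d} \<subseteq> U \<inter> V" .
    moreover have "compact (K \<union> L)" "K \<union> L \<subseteq> S" "min e d > 0"
      using K L by auto
    ultimately show "\<exists>K e. compact K \<and> K \<subseteq> S \<and> e > 0 \<and>
        {g \<in> Hol S. \<forall>w\<in>K. cmod (g w - f w) < e} \<subseteq> U \<inter> V"
      by blast
  qed
next
  fix \<U> assume *: "\<forall>U\<in>\<U>. Hol_open S U"
  show "Hol_open S (\<Union>\<U>)"
    unfolding Hol_open_def
  proof (intro conjI ballI)
    show "\<Union>\<U> \<subseteq> Hol S" using * by (auto simp: Hol_open_def)
    fix f assume "f \<in> \<Union>\<U>"
    then obtain U where U: "U \<in> \<U>" "f \<in> U" by blast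
    have "Hol_open S U" using * U(1) by (rule bspec)
    then have "\<exists>K e. compact K \<and> K \<subseteq> S \<and> e > 0 \<and>
        {g \<in> Hol S. \<forall>w\<in>K. cmod (g w - f w) < e} \<subseteq> U"
      using U(2) by (simp add: Hol_open_def)
    then show "\<exists>K e. compact K \<and> K \<subseteq> S \<and> e > 0 \<and>
        {g \<in> Hol S. \<forall>w\<in>K. cmod (g w - f w) < e} \<subseteq> \<Union>\<U>"
      by (meson Union_upper U(1) order_trans)
  qed
qed

lemma openin_Hol_topology: "openin (Hol_topology S) U \<longleftrightarrow> Hol_open S U"
  by (simp add: Hol_topology_def istopology_Hol_open)

lemma topspace_Hol_topology [simp]: "topspace (Hol_topology S) = Hol S"
proof
  show "topspace (Hol_topology S) \<subseteq> Hol S"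
    unfolding topspace_def openin_Hol_topology Hol_open_def by blast
  have "Hol_open S (Hol S)"
    unfolding Hol_open_def
  proof (intro conjI ballI)
    fix f assume "f \<in> Hol S"
    show "\<exists>K e. compact K \<and> K \<subseteq> S \<and> e > 0 \<and>
        {g \<in> Hol S. \<forall>w\<in>K. cmod (g w - f w) < e} \<subseteq> Hol S"
      by (rule exI[of _ "{}"], rule exI[of _ "1::real"]) simp
  qed simp
  then show "Hol S \<subseteq> topspace (Hol_topology S)"
    unfolding topspace_def openin_Hol_topology by blast
qed

definition fun_scale :: "complex \<Rightarrow> (complex \<Rightarrow> complex) \<Rightarrow> complex \<Rightarrow> complex" where
  "fun_scale c f = (\<lambda>w. c * f w)"

lemma vector_space_fun_scale: "vector_space fun_scale"
  by unfold_locales (simp_all add: fun_scale_def fun_eq_iff distrib_left distrib_right)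

definition complete_system ::
    "(complex \<Rightarrow> complex) topology \<Rightarrow> (complex \<Rightarrow> complex) set \<Rightarrow> bool" where
  "complete_system X E \<longleftrightarrow> X closure_of (module.span fun_scale E) = topspace X"

definition exp_system :: "complex set \<Rightarrow> (complex \<Rightarrow> enat) \<Rightarrow> (complex \<Rightarrow> complex) set" where
  "exp_system S Z =
     {zero_extend S (\<lambda>w. w ^ p * exp (z * w)) | z p. Z z > 0 \<and> enat p \<le> Z z - 1}"

lemma exp_system_subset_Hol: "exp_system S Z \<subseteq> Hol S"
proof -
  have "zero_extend S (\<lambda>w. w ^ p * exp (z * w)) holomorphic_on S" for p z
  proof (rule holomorphic_transform)
    show "(\<lambda>w. w ^ p * exp (z * w)) holomorphic_on S"
      by (intro holomorphic_intros)
  qed (simp add: zero_extend_def)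
  moreover have "zero_extend S f w = 0" if "w \<notin> S" for f w
    using that by (simp add: zero_extend_def)
  ultimately show ?thesis
    unfolding exp_system_def Hol_def by blast
qed

text \<open>The supremum is taken in the reals: meaningful for nonempty bounded \<open>A\<close> only.\<close>

definition spf :: "complex set \<Rightarrow> real \<Rightarrow> real" where
  "spf A \<theta> = (SUP s\<in>A. Re (s * exp (- (\<i> * of_real \<theta>))))"

text \<open>
  The coercion \<open>ennreal\<close> truncates negative reals, but \<open>spf A\<close> is nonnegative for the sets
  considered here, those with \<open>0\<close> in the closure of the convex hull. In \<open>ennreal\<close>, \<open>0 * \<infinity> = 0\<close>.
\<close>

definition radial_count :: "(complex \<Rightarrow> enat) \<Rightarrow> complex set \<Rightarrow> real \<Rightarrow> ennreal" where
  "radial_count Z A r =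
     ennreal_of_enat (Z 0) * (SUP \<theta>. ennreal \<bar>spf A \<theta>\<bar>) +
     (\<integral>\<^sup>+ z. ennreal_of_enat (Z z) * ennreal (spf A (Arg z))
        \<partial>count_space {z. 0 < cmod z \<and> cmod z \<le> r})"

lemma spf_nonneg:
  assumes "bounded A" and "0 \<in> closure (convex hull A)"
  shows "spf A \<theta> \<ge> 0"
proof -
  define u where "u = exp (- (\<i> * of_real \<theta>))"
  have un: "cmod u = 1" by (simp add: u_def)
  obtain B where B: "\<And>s. s \<in> A \<Longrightarrow> cmod s \<le> B" using assms(1) by (auto simp: bounded_iff)
  have "Re (s * u) \<le> B" if "s \<in> A" for s
    using complex_Re_le_cmod[of "s * u"] B[OF that] by (simp add: norm_mult un)
  then have bdd: "bdd_above ((\<lambda>s. Re (s * u)) ` A)"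
    by (rule bdd_aboveI2)
  let ?H = "{z. Re (z * u) \<le> spf A \<theta>}"
  have H: "?H = {z. cnj u \<bullet> z \<le> spf A \<theta>}"
    by (simp add: inner_complex_def mult.commute)
  have "A \<subseteq> ?H"
    using cSUP_upper[OF _ bdd] by (auto simp: spf_def u_def)
  then have "closure (convex hull A) \<subseteq> ?H"
    unfolding H by (intro closure_minimal hull_minimal convex_halfspace_le closed_halfspace_le)
  then show ?thesis using assms(2) by auto
qed

end

theory Submission
  imports Defs
begin

text \<open>
  If the system is not complete, minimal distance in an \<open>L\<^sup>2\<close> norm along the image of a circle under a
  Riemann map produces a functional \<open>\<Lambda>\<close> that kills the system, and \<open>F z = \<Lambda> (\<lambda>w. exp (z * w))\<close> is entire,
  vanishes on \<open>Z\<close>, and satisfies \<open>ln |F z| \<le> |z| (h (arg z) - \<epsilon>) + const\<close>, where \<open>h\<close> is the support function of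
  the conjugate of \<open>S\<close>; \<open>F\<close> is not zero, since \<open>\<Lambda>\<close> would otherwise kill all polynomials and, the complement of
  \<open>S\<close> being connected, everything.

  Choose a trigonometric polynomial \<open>T\<close> slightly above \<open>h\<close> with \<open>T + T'' \<ge> 0\<close>. Pairing the Riesz measure of
  \<open>ln |F|\<close> with \<open>T (arg z) / |z|\<close>, cut off smoothly in \<open>ln |z|\<close>, bounds the sum of \<open>T (arg z) / |z|\<close> over the zeros in
  \<open>r < |z| \<le> a r\<close> by \<open>ln a\<close> times the mean of \<open>(h - \<epsilon>) (T + T'')\<close>, up to \<open>O(1)\<close>. Up to small errors this mean is a
  mixed area of \<open>co S\<close> with a smaller body, divided by \<open>\<pi>\<close>, hence less than \<open>area (co S) / \<pi>\<close>.
\<close>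

section \<open>Functionals separating a point from a subspace\<close>

text \<open>The density condition admits equality, so a strict gain must be found. It comes from
  compactness: the curve that carries \<open>\<Lambda>\<close> keeps a distance of at least
  \<epsilon> from the complement of \<open>S\<close>, and \<epsilon> integrated against
  \<open>T + T''\<close> is \<epsilon> times a perimeter, a fixed positive amount. Every
  approximation error is then chosen smaller than this amount. The sign condition on
  \<open>T + T''\<close> is what allows the pointwise upper bound of \<open>ln |F|\<close> to be
  inserted under the integral. Trigonometric polynomials are used because they have finitely many
  Fourier modes: in the variable \<open>ln |z|\<close> each mode obeys an ordinary differential
  equation with constant coefficients, so the pairing with the Riesz measure becomes integration by
  parts. The weight \<open>1 / |z|\<close> is the integral of \<open>1 / t^2\<close> from
  \<open>|z|\<close> to infinity. Zeros with \<open>|z| \<le> r\<close> add only O(1), since their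
  number is O(r). The cutoff needs room proportional to \<open>ln a\<close> on both sides of the
  annulus; its derivatives are then so small that they cost O(1) in total, which disappears on
  division by \<open>ln a\<close>.\<close>

lemma quadratic_gap:
  fixes b :: complex and n N d :: real
  assumes gap: "\<And>c :: complex. d \<le> n + 2 * Re (c * b) + (cmod c)\<^sup>2 * N"
    and N: "0 \<le> N"
  shows "(cmod b)\<^sup>2 \<le> (N + 1) * (n - d)"
proof -
  \<comment> \<open>The minimizer \<open>- cnj b / N\<close> with \<open>N + 1\<close> in place of
    \<open>N\<close>, so that \<open>N = 0\<close> is covered as well.\<close>
  define c where "c = - (cnj b / of_real (N + 1))"
  have cb: "c * b = - of_real ((cmod b)\<^sup>2 / (N + 1))"
    unfolding c_def using complex_norm_square[of b] by (simp add: mult.commute)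
  have c2: "(cmod c)\<^sup>2 = (cmod b)\<^sup>2 / (N + 1)\<^sup>2"
    using N unfolding c_def by (simp add: norm_divide power_divide)
  have "d \<le> n - 2 * ((cmod b)\<^sup>2 / (N + 1)) + (cmod b)\<^sup>2 / (N + 1)\<^sup>2 * N"
    using gap[of c] unfolding cb c2 by simp
  moreover have "(cmod b)\<^sup>2 / (N + 1)\<^sup>2 * N \<le> (cmod b)\<^sup>2 / (N + 1)"
  proof -
    have "(cmod b)\<^sup>2 * N \<le> (cmod b)\<^sup>2 * (N + 1)" by (simp add: mult_left_mono)
    then show ?thesis using N by (simp add: divide_simps power2_eq_square)
  qed
  ultimately have "(cmod b)\<^sup>2 / (N + 1) \<le> n - d" by linarith
  then show ?thesis using N by (simp add: divide_simps mult.commute)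
qed

definition arc_form :: "(real \<Rightarrow> complex) \<Rightarrow> (complex \<Rightarrow> complex) \<Rightarrow> (complex \<Rightarrow> complex) \<Rightarrow> complex" where
  "arc_form \<gamma> f k = integral {0..2*pi} (\<lambda>t. f (\<gamma> t) * cnj (k (\<gamma> t)))"

definition arc_sqnorm :: "(real \<Rightarrow> complex) \<Rightarrow> (complex \<Rightarrow> complex) \<Rightarrow> real" where
  "arc_sqnorm \<gamma> f = integral {0..2*pi} (\<lambda>t. (cmod (f (\<gamma> t)))\<^sup>2)"

context
  fixes \<gamma> :: "real \<Rightarrow> complex" and P :: "complex set"
  assumes \<gamma>: "continuous_on {0..2*pi} \<gamma>" and P: "P = \<gamma> ` {0..2*pi}"
begin

lemma arc_comp_continuous: "continuous_on P f \<Longrightarrow> continuous_on {0..2*pi} (\<lambda>t. f (\<gamma> t))"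
  using continuous_on_compose[OF \<gamma>, of f] P by (simp add: o_def)

lemma arc_form_integrable:
  assumes "continuous_on P f" "continuous_on P k"
  shows "(\<lambda>t. f (\<gamma> t) * cnj (k (\<gamma> t))) integrable_on {0..2*pi}"
  by (intro integrable_continuous_real continuous_intros arc_comp_continuous assms)

lemma arc_sqnorm_integrable:
  assumes "continuous_on P f"
  shows "(\<lambda>t. (cmod (f (\<gamma> t)))\<^sup>2) integrable_on {0..2*pi}"
  by (intro integrable_continuous_real continuous_intros arc_comp_continuous assms)

lemma arc_sqnorm_nonneg:
  assumes "continuous_on P f"
  shows "0 \<le> arc_sqnorm \<gamma> f"
  unfolding arc_sqnorm_def
  by (intro integral_nonneg arc_sqnorm_integrable assms) auto

lemma arc_sqnorm_add:
  assumes f: "continuous_on P f" and v: "continuous_on P v"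
  shows "arc_sqnorm \<gamma> (\<lambda>z. f z + c * v z) =
    arc_sqnorm \<gamma> f + 2 * Re (c * arc_form \<gamma> v f) + (cmod c)\<^sup>2 * arc_sqnorm \<gamma> v"
proof -
  have pt: "(cmod (x + c * y))\<^sup>2 = (cmod x)\<^sup>2 + 2 * Re (c * (y * cnj x)) + (cmod c)\<^sup>2 * (cmod y)\<^sup>2"
    for x y
    by (simp only: cmod_power2 Re_complex_of_real plus_complex.simps times_complex.simps cnj.simps)
       (simp add: power2_eq_square algebra_simps)
  have 1: "((\<lambda>t. (cmod (f (\<gamma> t)))\<^sup>2) has_integral arc_sqnorm \<gamma> f) {0..2*pi}"
    unfolding arc_sqnorm_def by (intro integrable_integral arc_sqnorm_integrable f)
  have 2: "((\<lambda>t. (cmod (v (\<gamma> t)))\<^sup>2) has_integral arc_sqnorm \<gamma> v) {0..2*pi}"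
    unfolding arc_sqnorm_def by (intro integrable_integral arc_sqnorm_integrable v)
  have "((\<lambda>t. v (\<gamma> t) * cnj (f (\<gamma> t))) has_integral arc_form \<gamma> v f) {0..2*pi}"
    unfolding arc_form_def by (intro integrable_integral arc_form_integrable f v)
  then have "((\<lambda>t. Re (c * (v (\<gamma> t) * cnj (f (\<gamma> t))))) has_integral Re (c * arc_form \<gamma> v f)) {0..2*pi}"
    by (intro has_integral_Re has_integral_mult_right)
  from has_integral_add[OF has_integral_add[OF 1 has_integral_mult_right[OF this, of 2]]
        has_integral_mult_right[OF 2, of "(cmod c)\<^sup>2"]]
  show ?thesis
    unfolding arc_sqnorm_def[of \<gamma> "\<lambda>z. f z + c * v z"] pt by (rule integral_unique)
qed

lemma arc_form_add:
  assumes "continuous_on P f" "continuous_on P g" "continuous_on P k"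
  shows "arc_form \<gamma> (\<lambda>z. f z + g z) k = arc_form \<gamma> f k + arc_form \<gamma> g k"
  using integral_add[OF arc_form_integrable[OF assms(1,3)] arc_form_integrable[OF assms(2,3)]]
  by (simp add: arc_form_def algebra_simps)

lemma arc_form_scale: "arc_form \<gamma> (\<lambda>z. c * f z) k = c * arc_form \<gamma> f k"
  by (simp add: arc_form_def mult.assoc)

lemma arc_form_diff_right:
  assumes "continuous_on P f" "continuous_on P g" "continuous_on P k"
  shows "arc_form \<gamma> f (\<lambda>z. g z - k z) = arc_form \<gamma> f g - arc_form \<gamma> f k"
  using integral_diff[OF arc_form_integrable[OF assms(1,2)] arc_form_integrable[OF assms(1,3)]]
  by (simp add: arc_form_def algebra_simps)

lemma arc_form_self: "arc_form \<gamma> f f = of_real (arc_sqnorm \<gamma> f)"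
  if "continuous_on P f"
  using has_integral_linear[OF integrable_integral[OF arc_sqnorm_integrable[OF that]] bounded_linear_of_real]
  unfolding arc_form_def arc_sqnorm_def complex_norm_square[symmetric] o_def
  by (rule integral_unique)

lemma arc_form_bound:
  assumes "continuous_on P f" "continuous_on P k" "\<And>z. z \<in> P \<Longrightarrow> cmod (f z) \<le> B"
  shows "cmod (arc_form \<gamma> f k) \<le> (2 * pi + arc_sqnorm \<gamma> k) * B"
proof -
  have B: "0 \<le> B" using assms(3)[of "\<gamma> 0"] P by (force intro: order_trans[OF norm_ge_zero])
  \<comment> \<open>Takes the place of Cauchy-Schwarz: the L1 norm of \<open>k\<close> is bounded by
    an affine function of its squared L2 norm.\<close>
  have le: "x \<le> 1 + x\<^sup>2" for x :: real
    using sum_squares_bound[of x 1] zero_le_square[of x] unfolding power2_eq_square by linarith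
  have "cmod (arc_form \<gamma> f k) \<le> integral {0..2*pi} (\<lambda>t. B * (1 + (cmod (k (\<gamma> t)))\<^sup>2))"
    unfolding arc_form_def
  proof (rule integral_norm_bound_integral)
    show "(\<lambda>t. f (\<gamma> t) * cnj (k (\<gamma> t))) integrable_on {0..2*pi}"
      by (intro arc_form_integrable assms)
    show "(\<lambda>t. B * (1 + (cmod (k (\<gamma> t)))\<^sup>2)) integrable_on {0..2*pi}"
      by (intro integrable_continuous_real continuous_intros arc_comp_continuous assms)
    show "cmod (f (\<gamma> t) * cnj (k (\<gamma> t))) \<le> B * (1 + (cmod (k (\<gamma> t)))\<^sup>2)" if "t \<in> {0..2*pi}" for t
      using assms(3)[of "\<gamma> t"] that P le B by (auto simp: norm_mult intro!: mult_mono)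
  qed
  also have "\<dots> = (2 * pi + arc_sqnorm \<gamma> k) * B"
    using integral_add[OF integrable_const_ivl arc_sqnorm_integrable[OF assms(2)], of 1]
    by (simp add: arc_sqnorm_def mult.commute)
  finally show ?thesis .
qed

text \<open>Orthogonal projection without completeness. The residuals \<open>r n\<close> of a
  minimizing sequence stand for the component of \<open>f0\<close> orthogonal to \<open>V\<close>;
  as continuous functions are not complete in the L2 norm, the limit is taken of the functionals and
  not of the residuals. The \<open>r n\<close> stay in the conclusion because integrals are later
  interchanged at level \<open>n\<close>.\<close>

lemma separating_functional:
  fixes V :: "(complex \<Rightarrow> complex) set"
  assumes cont: "\<And>v. v \<in> V \<Longrightarrow> continuous_on P v"
    and zero: "(\<lambda>z. 0) \<in> V"
    and add: "\<And>v w. v \<in> V \<Longrightarrow> w \<in> V \<Longrightarrow> (\<lambda>z. v z + w z) \<in> V"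
    and scale: "\<And>c v. v \<in> V \<Longrightarrow> (\<lambda>z. c * v z) \<in> V"
    and f0: "continuous_on P f0"
    and d: "0 < d" "\<And>v. v \<in> V \<Longrightarrow> d \<le> arc_sqnorm \<gamma> (\<lambda>z. f0 z - v z)"
  obtains r :: "nat \<Rightarrow> complex \<Rightarrow> complex" and \<Lambda> M where
    "\<And>n. continuous_on P (r n)"
    "\<And>f. continuous_on P f \<Longrightarrow> (\<lambda>n. arc_form \<gamma> f (r n)) \<longlonglongrightarrow> \<Lambda> f"
    "0 < M"
    "\<And>f B n. continuous_on P f \<Longrightarrow> (\<And>z. z \<in> P \<Longrightarrow> cmod (f z) \<le> B) \<Longrightarrow>
       cmod (arc_form \<gamma> f (r n)) \<le> M * B"
    "\<And>v. v \<in> V \<Longrightarrow> \<Lambda> v = 0" "\<Lambda> f0 \<noteq> 0"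
proof -
  let ?N = "arc_sqnorm \<gamma>" and ?B = "arc_form \<gamma>"
  define D where "D = (INF v\<in>V. ?N (\<lambda>z. f0 z - v z))"
  have bdd: "bdd_below ((\<lambda>v. ?N (\<lambda>z. f0 z - v z)) ` V)"
    using d(2) by (auto intro!: bdd_belowI[of _ d])
  have D_le: "D \<le> ?N (\<lambda>z. f0 z - v z)" if "v \<in> V" for v
    unfolding D_def using bdd that by (rule cINF_lower)
  have "d \<le> D" unfolding D_def using zero d(2) by (intro cINF_greatest) auto
  then have D: "0 < D" using d(1) by simp
  have "\<exists>v\<in>V. ?N (\<lambda>z. f0 z - v z) < D + 1 / real (Suc n)" for n
    using cINF_less_iff[OF _ bdd, of "D + 1 / real (Suc n)"] zero by (auto simp: D_def)
  then obtain e where e: "\<And>n. e n \<in> V" and eN: "\<And>n. ?N (\<lambda>z. f0 z - e n z) < D + 1 / real (Suc n)"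
    by metis
  define r where "r n = (\<lambda>z. f0 z - e n z)" for n
  have rc: "continuous_on P (r n)" for n
    unfolding r_def by (intro continuous_intros f0 cont e)
  have rN: "D \<le> ?N (r n)" "?N (r n) < D + 1 / real (Suc n)" "?N (r n) \<le> D + 1" for n
  proof -
    show "D \<le> ?N (r n)" using D_le[OF e] by (simp add: r_def)
    show *: "?N (r n) < D + 1 / real (Suc n)" using eN by (simp add: r_def)
    have "1 / real (Suc n) \<le> 1" by simp
    then show "?N (r n) \<le> D + 1" using * by linarith
  qed
  \<comment> \<open>Moving \<open>e n\<close> along \<open>v\<close> stays in \<open>V\<close> and
    cannot bring the squared distance below \<open>D\<close>; as it is already within
    \<open>1 / Suc n\<close> of \<open>D\<close>, the linear term is small.\<close>
  have orth: "(cmod (?B v (r n)))\<^sup>2 \<le> (?N v + 1) * (1 / real (Suc n))" if v: "v \<in> V" for v n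
  proof -
    have "(cmod (?B v (r n)))\<^sup>2 \<le> (?N v + 1) * (?N (r n) - D)"
    proof (rule quadratic_gap)
      fix c
      have "D \<le> ?N (\<lambda>z. f0 z - (e n z + (- c) * v z))"
        by (intro D_le add scale e v)
      also have "(\<lambda>z. f0 z - (e n z + (- c) * v z)) = (\<lambda>z. r n z + c * v z)"
        by (simp add: r_def algebra_simps)
      finally show "D \<le> ?N (r n) + 2 * Re (c * ?B v (r n)) + (cmod c)\<^sup>2 * ?N v"
        using arc_sqnorm_add[OF rc cont[OF v]] by simp
    qed (intro arc_sqnorm_nonneg cont v)
    also have "\<dots> \<le> (?N v + 1) * (1 / real (Suc n))"
      using rN(2)[of n] arc_sqnorm_nonneg[OF cont[OF v]] by (intro mult_left_mono) auto
    finally show ?thesis .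
  qed
  \<comment> \<open>The same quadratic argument with lower bound 0: Cauchy-Schwarz up to a harmless
    \<open>+ 1\<close>.\<close>
  have CS: "(cmod (?B f k))\<^sup>2 \<le> (?N f + 1) * ?N k" if f: "continuous_on P f" and k: "continuous_on P k" for f k
  proof -
    have "(cmod (?B f k))\<^sup>2 \<le> (?N f + 1) * (?N k - 0)"
    proof (rule quadratic_gap)
      fix c
      have "0 \<le> ?N (\<lambda>z. k z + c * f z)"
        by (intro arc_sqnorm_nonneg continuous_intros f k)
      then show "0 \<le> ?N k + 2 * Re (c * ?B f k) + (cmod c)\<^sup>2 * ?N f"
        using arc_sqnorm_add[OF k f] by simp
    qed (intro arc_sqnorm_nonneg f)
    then show ?thesis by simp
  qed
  (* parallelogram law: the minimizing sequence r is Cauchy, although the space need not be complete *)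
  have par: "?N (\<lambda>z. r n z - r m z) \<le> 2 / real (Suc n) + 2 / real (Suc m)" for n m
  proof -
    have 1: "?N (\<lambda>z. r n z - r m z) + ?N (\<lambda>z. r n z + r m z) = 2 * ?N (r n) + 2 * ?N (r m)"
      using arc_sqnorm_add[OF rc rc, of n 1 m] arc_sqnorm_add[OF rc rc, of n "-1" m] by simp
    have "4 * D \<le> 4 * ?N (\<lambda>z. f0 z - ((1/2) * e n z + (1/2) * e m z))"
      using D_le[OF add[OF scale[OF e] scale[OF e]], of "1/2" n "1/2" m] by simp
    also have "\<dots> = ?N (\<lambda>z. r n z + r m z)"
    proof -
      have eq: "(\<lambda>z. r n z + r m z) = (\<lambda>z. 2 * (f0 z - ((1/2) * e n z + (1/2) * e m z)))"
        by (auto simp: r_def algebra_simps)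
      show ?thesis unfolding arc_sqnorm_def eq norm_mult power_mult_distrib by simp
    qed
    finally show ?thesis using 1 rN(2)[of n] rN(2)[of m] by simp
  qed
  have conv: "convergent (\<lambda>n. ?B f (r n))" if f: "continuous_on P f" for f
  proof (rule Cauchy_convergent, rule metric_CauchyI)
    fix \<epsilon> :: real assume \<epsilon>: "0 < \<epsilon>"
    have Nf: "0 \<le> ?N f" by (intro arc_sqnorm_nonneg f)
    obtain N :: nat where N: "(?N f + 1) * 4 / \<epsilon>\<^sup>2 < real N"
      using reals_Archimedean2 by blast
    show "\<exists>N. \<forall>m\<ge>N. \<forall>n\<ge>N. dist (?B f (r m)) (?B f (r n)) < \<epsilon>"
    proof (intro exI[of _ N] allI impI)
      fix m n assume mn: "N \<le> m" "N \<le> n"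
      have N0: "0 < real N" using N Nf \<epsilon> by (smt (verit) divide_nonneg_nonneg zero_le_power2)
      have inv: "2 / real (Suc k) \<le> 2 / real N" if "N \<le> k" for k
        using that N0 by (intro divide_left_mono) auto
      have "(cmod (?B f (r m) - ?B f (r n)))\<^sup>2 \<le> (?N f + 1) * ?N (\<lambda>z. r m z - r n z)"
        using CS[OF f, of "\<lambda>z. r m z - r n z"] arc_form_diff_right[OF f rc rc]
        by (simp add: rc continuous_on_diff)
      also have "\<dots> \<le> (?N f + 1) * (4 / real N)"
        using par[of m n] inv[OF mn(1)] inv[OF mn(2)] Nf by (intro mult_left_mono) auto
      also have "\<dots> < \<epsilon>\<^sup>2"
        using N N0 \<epsilon> by (simp add: field_simps)
      finally show "dist (?B f (r m)) (?B f (r n)) < \<epsilon>"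
        unfolding dist_norm using \<epsilon> power_less_imp_less_base[of _ 2 \<epsilon>] by auto
    qed
  qed
  define L where "L f = lim (\<lambda>n. ?B f (r n))" for f
  have L: "(\<lambda>n. ?B f (r n)) \<longlonglongrightarrow> L f" if "continuous_on P f" for f
    using conv[OF that] by (simp add: L_def convergent_LIMSEQ_iff)
  have small: "(\<lambda>n. C * (1 / real (Suc n))) \<longlonglongrightarrow> 0" for C
    by (intro tendsto_mult_right_zero LIMSEQ_inverse_real_of_nat[unfolded inverse_eq_divide])
  have null: "X \<longlonglongrightarrow> 0" if "\<And>n. (cmod (X n))\<^sup>2 \<le> C * (1 / real (Suc n))" for X C
  proof -
    have "(\<lambda>n. (cmod (X n))\<^sup>2) \<longlonglongrightarrow> 0"
      by (rule tendsto_sandwich[OF _ _ tendsto_const small[of C]]) (use that in auto)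
    then have "(\<lambda>n. sqrt ((cmod (X n))\<^sup>2)) \<longlonglongrightarrow> sqrt 0" by (rule tendsto_real_sqrt)
    then show ?thesis by (simp add: tendsto_norm_zero_iff)
  qed
  show thesis
  proof (rule that[of r L "2 * pi + (D + 1)"])
    show "L v = 0" if "v \<in> V" for v
      using null[OF orth[OF that]] L[OF cont[OF that]] LIMSEQ_unique by blast
    \<comment> \<open>As \<open>f0 = e n + r n\<close>, what remains is the squared norm of
      \<open>r n\<close>, so the limit functional takes the value \<open>D\<close> at
      \<open>f0\<close>. Here \<open>e n\<close> varies with \<open>n\<close>, and
      \<open>orth\<close> helps only with a uniform bound on its norm, which the parallelogram law
      for \<open>f0\<close> and \<open>r n\<close> supplies.\<close>
    have "(\<lambda>n. ?B (e n) (r n)) \<longlonglongrightarrow> 0"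
    proof (rule null)
      fix n
      have "?N (e n) + 1 \<le> 2 * ?N f0 + 2 * (D + 1) + 1"
      proof -
        have "?N (\<lambda>z. f0 z - r n z) + ?N (\<lambda>z. f0 z + r n z) = 2 * ?N f0 + 2 * ?N (r n)"
          using arc_sqnorm_add[OF f0 rc, of 1 n] arc_sqnorm_add[OF f0 rc, of "-1" n] by simp
        moreover have "0 \<le> ?N (\<lambda>z. f0 z + r n z)"
          by (intro arc_sqnorm_nonneg continuous_intros f0 rc)
        ultimately show ?thesis using rN(3)[of n] by (simp add: r_def)
      qed
      then show "(cmod (?B (e n) (r n)))\<^sup>2 \<le> (2 * ?N f0 + 2 * (D + 1) + 1) * (1 / real (Suc n))"
        by (intro order_trans[OF orth[OF e]] mult_right_mono) auto
    qed
    moreover have "(\<lambda>n. of_real (?N (r n))) \<longlonglongrightarrow> complex_of_real D"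
    proof (rule tendsto_of_real, rule tendsto_sandwich[of "\<lambda>_. D" _ _ "\<lambda>n. D + 1 / real (Suc n)"])
      show "(\<lambda>n. D + 1 / real (Suc n)) \<longlonglongrightarrow> D"
        using tendsto_add[OF tendsto_const small[of 1], of D] by simp
    qed (use rN in \<open>auto intro!: always_eventually less_imp_le\<close>)
    ultimately have "(\<lambda>n. ?B (e n) (r n) + of_real (?N (r n))) \<longlonglongrightarrow> 0 + complex_of_real D"
      by (rule tendsto_add)
    moreover have "?B (e n) (r n) + of_real (?N (r n)) = ?B f0 (r n)" for n
      using arc_form_add[OF cont[OF e] rc rc, of n n n]
      by (simp add: arc_form_self[OF rc, symmetric]) (simp add: r_def)
    ultimately have "L f0 = complex_of_real D"
      using L[OF f0] LIMSEQ_unique by auto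
    then show "L f0 \<noteq> 0" using D by simp
    show "cmod (?B f (r n)) \<le> (2 * pi + (D + 1)) * B"
      if f: "continuous_on P f" "\<And>z. z \<in> P \<Longrightarrow> cmod (f z) \<le> B" for f B n
    proof -
      have "0 \<le> B" using f(2)[of "\<gamma> 0"] P by (force intro: order_trans[OF norm_ge_zero])
      then show ?thesis
        using rN(3)[of n] by (intro order_trans[OF arc_form_bound[OF f(1) rc f(2)]] mult_right_mono) auto
    qed
  qed (use rc L D in \<open>auto intro: add_pos_pos\<close>)
qed

end

section \<open>Exponential and Cauchy transforms of the limit functional\<close>

locale arc_functional =
  fixes \<gamma> :: "real \<Rightarrow> complex" and P :: "complex set"
    and r :: "nat \<Rightarrow> complex \<Rightarrow> complex" and \<Lambda> :: "(complex \<Rightarrow> complex) \<Rightarrow> complex" and M :: real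
  assumes \<gamma>: "continuous_on {0..2*pi} \<gamma>" and P: "P = \<gamma> ` {0..2*pi}"
    and r: "\<And>n. continuous_on P (r n)"
    and lim: "\<And>f. continuous_on P f \<Longrightarrow> (\<lambda>n. arc_form \<gamma> f (r n)) \<longlonglongrightarrow> \<Lambda> f"
    and M: "0 < M"
    and form_bound: "\<And>f B n. continuous_on P f \<Longrightarrow> (\<And>z. z \<in> P \<Longrightarrow> cmod (f z) \<le> B) \<Longrightarrow>
       cmod (arc_form \<gamma> f (r n)) \<le> M * B"
begin

lemma compact_P: "compact P"
  unfolding P by (intro compact_continuous_image \<gamma> compact_Icc)

lemma functional_add:
  assumes "continuous_on P f" "continuous_on P g"
  shows "\<Lambda> (\<lambda>z. f z + g z) = \<Lambda> f + \<Lambda> g"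
proof (rule LIMSEQ_unique)
  show "(\<lambda>n. arc_form \<gamma> (\<lambda>z. f z + g z) (r n)) \<longlonglongrightarrow> \<Lambda> (\<lambda>z. f z + g z)"
    by (intro lim continuous_intros assms)
  show "(\<lambda>n. arc_form \<gamma> (\<lambda>z. f z + g z) (r n)) \<longlonglongrightarrow> \<Lambda> f + \<Lambda> g"
    using tendsto_add[OF lim lim, OF assms] by (simp add: arc_form_add[OF \<gamma> P] assms r)
qed

lemma functional_scale:
  assumes "continuous_on P f"
  shows "\<Lambda> (\<lambda>z. c * f z) = c * \<Lambda> f"
proof (rule LIMSEQ_unique)
  show "(\<lambda>n. arc_form \<gamma> (\<lambda>z. c * f z) (r n)) \<longlonglongrightarrow> \<Lambda> (\<lambda>z. c * f z)"
    by (intro lim continuous_intros assms)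
  show "(\<lambda>n. arc_form \<gamma> (\<lambda>z. c * f z) (r n)) \<longlonglongrightarrow> c * \<Lambda> f"
    using tendsto_mult[OF tendsto_const lim, OF assms, of c] by (simp add: arc_form_scale[OF \<gamma> P])
qed

lemma functional_diff:
  assumes "continuous_on P f" "continuous_on P g"
  shows "\<Lambda> (\<lambda>z. f z - g z) = \<Lambda> f - \<Lambda> g"
  using functional_add[of f "\<lambda>z. (-1) * g z"] functional_scale[of g "-1"] assms
  by (simp add: continuous_on_minus)

lemma functional_bound:
  assumes "continuous_on P f" "\<And>z. z \<in> P \<Longrightarrow> cmod (f z) \<le> B"
  shows "cmod (\<Lambda> f) \<le> M * B"
  by (rule Lim_norm_ubound[OF _ lim[OF assms(1)]]) (auto intro!: always_eventually form_bound assms)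

lemma functional_cong:
  assumes "continuous_on P f" "\<And>z. z \<in> P \<Longrightarrow> f z = g z"
  shows "\<Lambda> f = \<Lambda> g"
proof -
  have g: "continuous_on P g" using assms by (simp cong: continuous_on_cong)
  have "cmod (\<Lambda> (\<lambda>z. f z - g z)) \<le> M * 0"
    by (rule functional_bound) (auto intro!: continuous_intros g assms)
  then show ?thesis using functional_diff[OF assms(1) g] by simp
qed

lemma functional_sum:
  fixes n :: nat
  assumes "\<And>i. continuous_on P (f i)"
  shows "\<Lambda> (\<lambda>z. \<Sum>i<n. f i z) = (\<Sum>i<n. \<Lambda> (f i))"
proof (induction n)
  case 0
  show ?case using functional_scale[of "\<lambda>_. 0" 0] by simp
next
  case (Suc n)
  then show ?case using functional_add[of "\<lambda>z. \<Sum>i<n. f i z" "f n"] assms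
    by (simp add: continuous_on_sum)
qed

lemma functional_sums:
  assumes f: "\<And>i. continuous_on P (f i)" and g: "continuous_on P g"
    and m: "\<And>i z. z \<in> P \<Longrightarrow> cmod (f i z) \<le> m i" "summable m"
    and sums: "\<And>z. z \<in> P \<Longrightarrow> (\<lambda>i. f i z) sums g z"
  shows "(\<lambda>i. \<Lambda> (f i)) sums \<Lambda> g"
proof -
  have "uniform_limit P (\<lambda>n z. \<Sum>i<n. f i z) (\<lambda>z. \<Sum>i. f i z) sequentially"
    by (rule Weierstrass_m_test) (use m in auto)
  then have ul: "uniform_limit P (\<lambda>n z. \<Sum>i<n. f i z) g sequentially"
    by (rule uniform_limit_cong'[THEN iffD1, rotated -1]) (use sums in \<open>auto simp: sums_iff\<close>)
  show ?thesis
    unfolding sums_def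
  proof (rule metric_LIMSEQ_I)
    fix e :: real assume e: "0 < e"
    have "\<forall>\<^sub>F n in sequentially. \<forall>z\<in>P. dist (\<Sum>i<n. f i z) (g z) < e / (2 * M)"
      using uniform_limitD[OF ul, of "e / (2 * M)"] e M by simp
    then obtain N where N: "\<And>n z. n \<ge> N \<Longrightarrow> z \<in> P \<Longrightarrow> dist (\<Sum>i<n. f i z) (g z) < e / (2 * M)"
      by (auto simp: eventually_sequentially)
    have "dist (\<Sum>i<n. \<Lambda> (f i)) (\<Lambda> g) < e" if n: "n \<ge> N" for n
    proof -
      have "cmod (\<Lambda> (\<lambda>z. (\<Sum>i<n. f i z) - g z)) \<le> M * (e / (2 * M))"
        using N[OF n] by (intro functional_bound continuous_intros f g)
          (auto simp: dist_norm intro: less_imp_le)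
      also have "\<dots> < e" using e M by simp
      finally show ?thesis
        by (simp add: functional_diff functional_sum f g continuous_on_sum dist_norm)
    qed
    then show "\<exists>N. \<forall>n\<ge>N. dist (\<Sum>i<n. \<Lambda> (f i)) (\<Lambda> g) < e" by blast
  qed
qed

lemma P_bound: obtains R where "0 < R" "\<And>w. w \<in> P \<Longrightarrow> cmod w \<le> R"
  using compact_imp_bounded[OF compact_P] bounded_pos by metis

text \<open>The Taylor coefficients at \<open>a\<close> of the exponential transform are the values
  of \<open>\<Lambda>\<close> on \<open>w ^ n * exp (a * w)\<close> up to \<open>fact n\<close>, so
  killing these functions for \<open>n < k\<close> produces a zero of order
  \<open>k\<close>.\<close>

lemma exp_transform_sums:
  "(\<lambda>n. \<Lambda> (\<lambda>w. w ^ n * exp (a * w)) / fact n * \<zeta> ^ n) sums \<Lambda> (\<lambda>w. exp ((a + \<zeta>) * w))"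
proof -
  obtain R where R: "0 < R" "\<And>w. w \<in> P \<Longrightarrow> cmod w \<le> R" using P_bound by blast
  have "(\<lambda>n. \<Lambda> (\<lambda>w. (\<zeta> ^ n / fact n) * (w ^ n * exp (a * w)))) sums \<Lambda> (\<lambda>w. exp ((a + \<zeta>) * w))"
  proof (rule functional_sums)
    fix n w assume w: "w \<in> P"
    have "cmod (exp (a * w)) \<le> exp (cmod a * R)"
      using R(2)[OF w] by (intro order_trans[OF norm_exp]) (simp add: norm_mult mult_left_mono)
    then have "cmod (\<zeta> ^ n / fact n) * (cmod (w ^ n) * cmod (exp (a * w)))
        \<le> cmod (\<zeta> ^ n / fact n) * (R ^ n * exp (cmod a * R))"
      using R(2)[OF w] R(1)
      by (intro mult_left_mono mult_mono) (auto simp: norm_power power_mono)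
    then show "cmod ((\<zeta> ^ n / fact n) * (w ^ n * exp (a * w)))
        \<le> exp (cmod a * R) * ((cmod \<zeta> * R) ^ n /\<^sub>R fact n)"
      by (simp add: norm_mult norm_divide norm_power power_mult_distrib field_simps)
  next
    show "summable (\<lambda>n. exp (cmod a * R) * ((cmod \<zeta> * R) ^ n /\<^sub>R fact n))"
      by (intro summable_mult summable_exp_generic)
  next
    fix w
    have "(\<lambda>n. exp (a * w) * ((\<zeta> * w) ^ n /\<^sub>R fact n)) sums (exp (a * w) * exp (\<zeta> * w))"
      by (intro sums_mult exp_converges)
    then show "(\<lambda>n. (\<zeta> ^ n / fact n) * (w ^ n * exp (a * w))) sums exp ((a + \<zeta>) * w)"
      by (simp add: exp_add ring_distribs power_mult_distrib scaleR_conv_of_real field_simps)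
  qed (intro continuous_intros)+
  then show ?thesis
    using functional_scale[of "\<lambda>w. w ^ n * exp (a * w)" "\<zeta> ^ n / fact n" for n]
    by (simp add: continuous_intros mult.commute)
qed

text \<open>The moments are the coefficients of the expansion of the Cauchy transform at infinity
  (geometric series in \<open>w / \<zeta>\<close>).\<close>

lemma cauchy_transform_outside:
  assumes mom: "\<And>n. \<Lambda> (\<lambda>w. w ^ n) = 0" and R: "\<And>w. w \<in> P \<Longrightarrow> cmod w \<le> R" and \<zeta>: "R < cmod \<zeta>"
  shows "\<Lambda> (\<lambda>w. 1 / (\<zeta> - w)) = 0"
proof -
  obtain p where "p \<in> P" using P by fastforce
  then have R0: "0 \<le> R" using R order_trans[OF norm_ge_zero] by blast
  have nz: "\<zeta> \<noteq> 0" "cmod \<zeta> \<noteq> 0" using \<zeta> R0 by auto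
  have "(\<lambda>n. \<Lambda> (\<lambda>w. (1 / \<zeta> ^ Suc n) * w ^ n)) sums \<Lambda> (\<lambda>w. 1 / (\<zeta> - w))"
  proof (rule functional_sums)
    fix n w assume "w \<in> P"
    then have "cmod w ^ n \<le> R ^ n" using R by (simp add: power_mono)
    then show "cmod ((1 / \<zeta> ^ Suc n) * w ^ n) \<le> 1 / cmod \<zeta> * (R / cmod \<zeta>) ^ n"
      using nz \<zeta> R0 by (simp add: norm_mult norm_divide norm_power divide_simps)
  next
    show "summable (\<lambda>n. 1 / cmod \<zeta> * (R / cmod \<zeta>) ^ n)"
      using R0 \<zeta> using nz by (intro summable_mult summable_geometric) (simp add: divide_less_eq)
  next
    fix w assume "w \<in> P"
    then have *: "cmod (w / \<zeta>) < 1" using R \<zeta> nz by (force simp: norm_divide)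
    then have ne: "w \<noteq> \<zeta>" using nz by auto
    show "(\<lambda>n. (1 / \<zeta> ^ Suc n) * w ^ n) sums (1 / (\<zeta> - w))"
      using sums_mult[OF geometric_sums[OF *], of "1 / \<zeta>"] nz ne
      by (simp add: power_divide divide_simps)
  next
    show "continuous_on P (\<lambda>w. 1 / (\<zeta> - w))"
      using R[of \<zeta>] \<zeta> by (intro continuous_intros) auto
  qed (intro continuous_intros)
  moreover have "\<Lambda> (\<lambda>w. (1 / \<zeta> ^ Suc n) * w ^ n) = 0" for n
    using functional_scale[of "\<lambda>w. w ^ n"  "1 / \<zeta> ^ Suc n"] mom by (simp add: continuous_intros)
  ultimately show ?thesis using sums_unique2[OF sums_zero] by simp
qed

lemma cauchy_transform_holomorphic: "(\<lambda>\<zeta>. \<Lambda> (\<lambda>w. 1 / (\<zeta> - w))) holomorphic_on (- P)"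
proof -
  have "((\<lambda>\<zeta>. \<Lambda> (\<lambda>w. 1 / (\<zeta> - w))) has_field_derivative - \<Lambda> (\<lambda>w. 1 / (\<zeta> - w)\<^sup>2)) (at \<zeta>)"
    if \<zeta>: "\<zeta> \<in> - P" for \<zeta>
  proof -
    let ?\<Phi> = "\<lambda>\<zeta>. \<Lambda> (\<lambda>w. 1 / (\<zeta> - w))"
    obtain e where e: "0 < e" "ball \<zeta> e \<subseteq> - P"
      using \<zeta> compact_P by (meson compact_imp_closed open_Compl openE)
    have ew: "e \<le> cmod (\<zeta> - w)" if "w \<in> P" for w
      using e(2) that by (force simp: dist_norm)
    have quad: "cmod (?\<Phi> (\<zeta> + h) - ?\<Phi> \<zeta> + h * \<Lambda> (\<lambda>w. 1 / (\<zeta> - w)\<^sup>2)) \<le> M * (2 * (cmod h)\<^sup>2 / e ^ 3)"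
      if h: "cmod h \<le> e / 2" for h
    proof -
      have ne: "\<zeta> - w \<noteq> 0" "\<zeta> + h - w \<noteq> 0" "e / 2 \<le> cmod (\<zeta> + h - w)" if "w \<in> P" for w
      proof -
        show "\<zeta> - w \<noteq> 0" using ew[OF that] e(1) by auto
        have "cmod (\<zeta> - w) \<le> cmod (\<zeta> + h - w) + cmod h"
          by (metis add_diff_cancel_right' add_diff_eq diff_add_eq norm_triangle_sub add.commute norm_triangle_ineq4)
        then show "e / 2 \<le> cmod (\<zeta> + h - w)" using ew[OF that] h by simp
        then show "\<zeta> + h - w \<noteq> 0" using e(1) by auto
      qed
      have c1: "continuous_on P (\<lambda>w. 1 / (\<zeta> + h - w))"
        using ne by (intro continuous_intros) auto
      have c2: "continuous_on P (\<lambda>w. 1 / (\<zeta> - w))"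
        using ne by (intro continuous_intros) auto
      have c3: "continuous_on P (\<lambda>w. 1 / (\<zeta> - w)\<^sup>2)"
        using ne by (intro continuous_intros) auto
      have "?\<Phi> (\<zeta> + h) - ?\<Phi> \<zeta> + h * \<Lambda> (\<lambda>w. 1 / (\<zeta> - w)\<^sup>2) =
          \<Lambda> (\<lambda>w. (1 / (\<zeta> + h - w) - 1 / (\<zeta> - w)) + h * (1 / (\<zeta> - w)\<^sup>2))"
        using functional_add[OF continuous_on_diff[OF c1 c2] continuous_on_mult_left[OF c3, of h]]
          functional_diff[OF c1 c2] functional_scale[OF c3, of h] by simp
      also have "cmod \<dots> \<le> M * (2 * (cmod h)\<^sup>2 / e ^ 3)"
      proof (rule functional_bound)
        show "continuous_on P (\<lambda>w. (1 / (\<zeta> + h - w) - 1 / (\<zeta> - w)) + h * (1 / (\<zeta> - w)\<^sup>2))"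
          by (intro continuous_on_add continuous_on_diff continuous_on_mult_left c1 c2 c3)
        fix w assume w: "w \<in> P"
        have "(1 / (\<zeta> + h - w) - 1 / (\<zeta> - w)) + h * (1 / (\<zeta> - w)\<^sup>2) = h\<^sup>2 / ((\<zeta> + h - w) * (\<zeta> - w)\<^sup>2)"
          using ne[OF w] by (simp add: divide_simps) (simp add: power2_eq_square algebra_simps)
        also have "cmod \<dots> \<le> (cmod h)\<^sup>2 / (e / 2 * e\<^sup>2)"
          using ne[OF w] ew[OF w] e(1) unfolding norm_divide norm_mult norm_power
          by (intro divide_left_mono mult_mono power_mono mult_pos_pos) auto
        also have "\<dots> = 2 * (cmod h)\<^sup>2 / e ^ 3" by (simp add: power2_eq_square power3_eq_cube mult_ac)
        finally show "cmod ((1 / (\<zeta> + h - w) - 1 / (\<zeta> - w)) + h * (1 / (\<zeta> - w)\<^sup>2)) \<le> 2 * (cmod h)\<^sup>2 / e ^ 3" .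
      qed
      finally show ?thesis .
    qed
    show ?thesis
      unfolding DERIV_def
    proof (rule LIM_zero_cancel, rule Lim_null_comparison)
      show "\<forall>\<^sub>F h in at 0. norm ((?\<Phi> (\<zeta> + h) - ?\<Phi> \<zeta>) / h - (- \<Lambda> (\<lambda>w. 1 / (\<zeta> - w)\<^sup>2))) \<le> (2 * M / e ^ 3) * cmod h"
        unfolding eventually_at
      proof (intro exI[of _ "e / 2"] conjI ballI impI)
        fix h :: complex assume h: "h \<noteq> 0 \<and> dist h 0 < e / 2"
        have "(?\<Phi> (\<zeta> + h) - ?\<Phi> \<zeta>) / h - (- \<Lambda> (\<lambda>w. 1 / (\<zeta> - w)\<^sup>2)) =
            (?\<Phi> (\<zeta> + h) - ?\<Phi> \<zeta> + h * \<Lambda> (\<lambda>w. 1 / (\<zeta> - w)\<^sup>2)) / h"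
          using h by (simp add: field_simps)
        also have "cmod \<dots> \<le> M * (2 * (cmod h)\<^sup>2 / e ^ 3) / cmod h"
          unfolding norm_divide using quad h by (intro divide_right_mono) auto
        also have "\<dots> = (2 * M / e ^ 3) * cmod h"
          using h by (simp add: power2_eq_square)
        finally show "norm ((?\<Phi> (\<zeta> + h) - ?\<Phi> \<zeta>) / h - (- \<Lambda> (\<lambda>w. 1 / (\<zeta> - w)\<^sup>2))) \<le> (2 * M / e ^ 3) * cmod h" .
      qed (use e in simp)
      show "(\<lambda>h. (2 * M / e ^ 3) * cmod h) \<midarrow>0\<rightarrow> 0"
        by (intro tendsto_mult_right_zero tendsto_norm_zero tendsto_ident_at)
    qed
  qed
  then show ?thesis
    using compact_imp_closed[OF compact_P] by (auto simp: holomorphic_on_open open_Compl)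
qed

text \<open>\<open>\<Lambda>\<close> passes under the integral in two steps: Fubini for the explicit
  kernel \<open>r n\<close>, then dominated convergence in \<open>n\<close>, where
  \<open>form_bound\<close> gives the majorant.\<close>

lemma functional_cauchy_integral:
  fixes a b :: real
  assumes c: "continuous_on {a..b} c" and q: "continuous_on {a..b} q"
    and avoid: "c ` {a..b} \<inter> P = {}"
    and zero: "\<And>t. t \<in> {a..b} \<Longrightarrow> \<Lambda> (\<lambda>w. 1 / (c t - w)) = 0"
  shows "\<Lambda> (\<lambda>w. integral {a..b} (\<lambda>t. q t * (1 / (c t - w)))) = 0"
proof -
  let ?k = "\<lambda>t w. q t * (1 / (c t - w))"
  have ne: "c t - w \<noteq> 0" if "t \<in> {a..b}" "w \<in> P" for t w
  proof -
    have "c t \<notin> P" using avoid that(1) by blast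
    then show ?thesis using that(2) by auto
  qed
  have kcomp: "continuous_on A (\<lambda>x. ?k (f x) (g x))"
    if "continuous_on A f" "continuous_on A g" "f ` A \<subseteq> {a..b}" "g ` A \<subseteq> P"
    for A and f :: "'b::topological_space \<Rightarrow> real" and g
  proof -
    have "continuous_on A (\<lambda>x. q (f x))" "continuous_on A (\<lambda>x. c (f x))"
      using continuous_on_compose2[OF q that(1,3)] continuous_on_compose2[OF c that(1,3)] by auto
    moreover have "c (f x) - g x \<noteq> 0" if "x \<in> A" for x
      using ne \<open>f ` A \<subseteq> {a..b}\<close> \<open>g ` A \<subseteq> P\<close> that by blast
    ultimately show ?thesis by (intro continuous_intros that(2)) auto
  qed
  have kc: "continuous_on ({a..b} \<times> P) (\<lambda>(t,w). ?k t w)"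
    unfolding split_beta by (intro kcomp continuous_on_fst continuous_on_snd continuous_on_id) auto
  have kc1: "continuous_on P (?k t)" if "t \<in> {a..b}" for t
    using ne[OF that] by (intro continuous_intros) auto
  have "compact ((\<lambda>(t,w). ?k t w) ` ({a..b} \<times> P))"
    by (intro compact_continuous_image kc compact_Times compact_Icc compact_P)
  then have "bounded ((\<lambda>(t,w). ?k t w) ` ({a..b} \<times> P))" by (rule compact_imp_bounded)
  then obtain B where "\<forall>y\<in>(\<lambda>(t,w). ?k t w) ` ({a..b} \<times> P). cmod y \<le> B"
    unfolding bounded_iff by blast
  then have B: "cmod (?k t w) \<le> B" if "t \<in> {a..b}" "w \<in> P" for t w
    using that by force
  have ic: "continuous_on P (\<lambda>w. integral {a..b} (\<lambda>t. ?k t w))"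
  proof -
    have "continuous_on (P \<times> cbox a b) (\<lambda>(w,t). ?k t w)"
    proof -
      have "continuous_on (P \<times> {a..b}) (\<lambda>x. ?k (snd x) (fst x))"
        by (rule kcomp[OF continuous_on_snd[OF continuous_on_id] continuous_on_fst[OF continuous_on_id]]) auto
      then show ?thesis by (simp only: case_prod_unfold interval_cbox)
    qed
    from integral_continuous_on_param[OF this] show ?thesis by simp
  qed
  have kg: "continuous_on ({a..b} \<times> {0..2*pi}) (\<lambda>(t,s). ?k t (\<gamma> s) * cnj (r n (\<gamma> s)))" for n
  proof -
    have "continuous_on {0..2*pi} (\<lambda>s. cnj (r n (\<gamma> s)))"
      by (intro continuous_intros arc_comp_continuous[OF \<gamma> P] r)
    from continuous_on_compose2[OF this continuous_on_snd[OF continuous_on_id], of "{a..b} \<times> {0..2*pi}"]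
    have 1: "continuous_on ({a..b} \<times> {0..2*pi}) (\<lambda>x. cnj (r n (\<gamma> (snd x))))" by auto
    have 2: "continuous_on ({a..b} \<times> {0..2*pi}) (\<lambda>x. \<gamma> (snd x))"
      using continuous_on_compose2[OF \<gamma> continuous_on_snd[OF continuous_on_id], of "{a..b} \<times> {0..2*pi}"]
      by auto
    have 3: "continuous_on ({a..b} \<times> {0..2*pi}) (\<lambda>x. ?k (fst x) (\<gamma> (snd x)))"
      by (rule kcomp[OF continuous_on_fst[OF continuous_on_id] 2]) (auto simp: P)
    show ?thesis using continuous_on_mult[OF 3 1] by (simp add: split_beta)
  qed
  have swap: "arc_form \<gamma> (\<lambda>w. integral {a..b} (\<lambda>t. ?k t w)) (r n) =
      integral {a..b} (\<lambda>t. arc_form \<gamma> (?k t) (r n))" for n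
  proof -
    have cont: "continuous_on (cbox (0,a) (2*pi,b)) (\<lambda>(s,t). ?k t (\<gamma> s) * cnj (r n (\<gamma> s)))"
    proof -
      have "continuous_on ({0..2*pi} \<times> {a..b}) (\<lambda>x. (\<lambda>(t,s). ?k t (\<gamma> s) * cnj (r n (\<gamma> s))) (snd x, fst x))"
        by (rule continuous_on_compose2[OF kg[of n]
              continuous_on_Pair[OF continuous_on_snd[OF continuous_on_id] continuous_on_fst[OF continuous_on_id]]]) auto
      then show ?thesis by (simp only: case_prod_unfold interval_cbox cbox_Pair_eq fst_conv snd_conv)
    qed
    show ?thesis
      using integral_swap_continuous[OF cont]
      by (simp only: arc_form_def interval_cbox integral_mult_left[symmetric])
  qed
  have pt: "(\<lambda>n. arc_form \<gamma> (?k t) (r n)) \<longlonglongrightarrow> 0" if t: "t \<in> {a..b}" for t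
  proof -
    have "\<Lambda> (?k t) = q t * \<Lambda> (\<lambda>w. 1 / (c t - w))"
      using ne[OF t] by (intro functional_scale continuous_intros) auto
    then show ?thesis using lim[OF kc1[OF t]] zero[OF t] by simp
  qed
  have ki: "(\<lambda>t. arc_form \<gamma> (?k t) (r n)) integrable_on {a..b}" for n
  proof -
    have cont: "continuous_on ({a..b} \<times> cbox 0 (2*pi)) (\<lambda>(t,s). ?k t (\<gamma> s) * cnj (r n (\<gamma> s)))"
      using kg[of n] by simp
    from integral_continuous_on_param[OF this] show ?thesis
      unfolding arc_form_def by (intro integrable_continuous_real) simp
  qed
  have "(\<lambda>n. integral {a..b} (\<lambda>t. arc_form \<gamma> (?k t) (r n))) \<longlonglongrightarrow> integral {a..b} (\<lambda>t. 0)"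
  proof (rule dominated_convergence(2)[of _ _ "\<lambda>_. M * B"])
    show "norm (arc_form \<gamma> (?k t) (r n)) \<le> M * B" if "t \<in> {a..b}" for n t
      using that by (intro form_bound kc1 B)
  qed (rule ki integrable_const_ivl pt, assumption?)+
  then have "(\<lambda>n. arc_form \<gamma> (\<lambda>w. integral {a..b} (\<lambda>t. ?k t w)) (r n)) \<longlonglongrightarrow> 0"
    by (simp only: swap integral_0)
  then show ?thesis using lim[OF ic] LIMSEQ_unique by blast
qed

end

section \<open>Conformal coordinates on the domain\<close>

lemma circle_mean_bound:
  assumes u: "u holomorphic_on ball 0 1" and \<rho>: "0 \<le> \<rho>0" "\<rho>0 < \<rho>" "\<rho> < 1" and \<omega>: "cmod \<omega> \<le> \<rho>0"
    and e: "0 < e" "e \<le> cmod (u \<omega>)"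
  shows "2 * pi * (e * ((\<rho> - \<rho>0) / \<rho>))\<^sup>2 \<le> integral {0..2*pi} (\<lambda>t. (cmod (u (of_real \<rho> * cis t)))\<^sup>2)"
proof -
  let ?v = "\<lambda>t. u (of_real \<rho> * cis t)"
  \<comment> \<open>On the circle of radius \<rho> the Cauchy kernel has modulus at most
    \<open>1 / (\<rho> - \<rho>0)\<close>, and the length element is \<rho> times that of the
    angle.\<close>
  define \<kappa> where "\<kappa> = \<rho> / (\<rho> - \<rho>0)"
  have \<kappa>: "0 < \<kappa>" using \<rho> by (simp add: \<kappa>_def)
  have cont: "continuous_on {0..2*pi} ?v"
    using \<rho> by (intro continuous_on_compose2[OF holomorphic_on_imp_continuous_on[OF u]] continuous_intros)
      (auto simp: norm_mult)
  have "((\<lambda>\<xi>. u \<xi> / (\<xi> - \<omega>)) has_contour_integral (2 * of_real pi * \<i> * u \<omega>)) (circlepath 0 \<rho>)"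
    using \<rho> \<omega> by (intro Cauchy_integral_circlepath_simple holomorphic_on_subset[OF u]) auto
  then have "((\<lambda>t. ?v t / (of_real \<rho> * cis t - \<omega>) * of_real \<rho> * \<i> * cis t) has_integral
      (2 * of_real pi * \<i> * u \<omega>)) {0..2*pi}"
    by (simp add: circlepath_def has_contour_integral_part_circlepath_iff)
  note ci = this
  have int: "((\<lambda>t. \<kappa> * (e / \<kappa> / 2 + (cmod (?v t))\<^sup>2 / (2 * (e / \<kappa>)))) has_integral
      \<kappa> * (2 * pi * (e / \<kappa> / 2) + integral {0..2*pi} (\<lambda>t. (cmod (?v t))\<^sup>2) / (2 * (e / \<kappa>)))) {0..2*pi}"
  proof -
    have "((\<lambda>t. (cmod (?v t))\<^sup>2) has_integral integral {0..2*pi} (\<lambda>t. (cmod (?v t))\<^sup>2)) {0..2*pi}"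
      by (intro integrable_integral integrable_continuous_real continuous_intros cont)
    from has_integral_mult_right[OF has_integral_add[OF has_integral_const_real[of "e / \<kappa> / 2" 0 "2*pi"]
      has_integral_divide[OF this, of "2 * (e / \<kappa>)"]], of \<kappa>]
    show ?thesis by simp
  qed
  have "norm (2 * of_real pi * \<i> * u \<omega>) \<le>
      \<kappa> * (2 * pi * (e / \<kappa> / 2) + integral {0..2*pi} (\<lambda>t. (cmod (?v t))\<^sup>2) / (2 * (e / \<kappa>))) "
    unfolding integral_unique[OF ci, symmetric] integral_unique[OF int, symmetric]
  proof (rule integral_norm_bound_integral[OF has_integral_integrable[OF ci] has_integral_integrable[OF int]])
    fix t :: real
    have "\<rho> - \<rho>0 \<le> cmod (of_real \<rho> * cis t - \<omega>)"
      using norm_triangle_ineq2[of "of_real \<rho> * cis t" \<omega>] \<omega> \<rho> by (simp add: norm_mult)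
    then have "cmod (?v t / (of_real \<rho> * cis t - \<omega>) * of_real \<rho> * \<i> * cis t) \<le> cmod (?v t) * \<kappa>"
      using \<rho> by (simp add: norm_mult norm_divide \<kappa>_def) (intro divide_left_mono mult_pos_pos, auto)
    \<comment> \<open>Arithmetic-geometric mean inequality with parameter
      \<open>e / \<kappa>\<close>: the constant part integrates to \<open>pi * e\<close>, half of
      the lower bound \<open>2 * pi * e\<close>, and is absorbed there.\<close>
    also have "cmod (?v t) \<le> e / \<kappa> / 2 + (cmod (?v t))\<^sup>2 / (2 * (e / \<kappa>))"
    proof -
      define x c where "x = cmod (?v t)" and "c = e / \<kappa>"
      have c: "0 < c" using e \<kappa> by (simp add: c_def)
      have "2 * x * c \<le> c\<^sup>2 + x\<^sup>2" using sum_squares_bound[of x c] by simp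
      then have "x \<le> c / 2 + x\<^sup>2 / (2 * c)" using c by (simp add: field_simps power2_eq_square)
      then show ?thesis by (simp add: x_def c_def)
    qed
    finally show "cmod (?v t / (of_real \<rho> * cis t - \<omega>) * of_real \<rho> * \<i> * cis t) \<le>
        \<kappa> * (e / \<kappa> / 2 + (cmod (?v t))\<^sup>2 / (2 * (e / \<kappa>)))"
      using \<kappa> by (simp add: mult.commute)
  qed
  also have "\<dots> = pi * e + \<kappa>\<^sup>2 * integral {0..2*pi} (\<lambda>t. (cmod (?v t))\<^sup>2) / (2 * e)"
    using \<kappa> e by (simp add: field_simps power2_eq_square)
  finally have "2 * pi * e \<le> pi * e + \<kappa>\<^sup>2 * integral {0..2*pi} (\<lambda>t. (cmod (?v t))\<^sup>2) / (2 * e)"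
  proof -
    assume "cmod (2 * of_real pi * \<i> * u \<omega>) \<le> pi * e + \<kappa>\<^sup>2 * integral {0..2*pi} (\<lambda>t. (cmod (?v t))\<^sup>2) / (2 * e)"
    moreover have "2 * pi * e \<le> cmod (2 * of_real pi * \<i> * u \<omega>)"
      using e(2) by (simp add: norm_mult)
    ultimately show ?thesis by (rule order_trans[rotated])
  qed
  then have "2 * pi * e\<^sup>2 \<le> \<kappa>\<^sup>2 * integral {0..2*pi} (\<lambda>t. (cmod (?v t))\<^sup>2)"
    using e by (simp add: field_simps power2_eq_square)
  then have "2 * pi * (e\<^sup>2 / \<kappa>\<^sup>2) \<le> integral {0..2*pi} (\<lambda>t. (cmod (?v t))\<^sup>2)"
    using \<kappa> by (simp add: field_simps)
  moreover have eq: "e * ((\<rho> - \<rho>0) / \<rho>) = e / \<kappa>" by (simp add: \<kappa>_def)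
  ultimately show ?thesis unfolding eq power_divide by simp
qed

text \<open>Conjugating \<open>S\<close> turns the factor \<open>exp (- \<i> * \<theta>)\<close>
  into \<open>cis \<theta>\<close>; this is why the conjugate domain governs the modulus of
  \<open>exp (z * s)\<close> on the ray \<open>arg z = \<theta>\<close>.\<close>

lemma Re_le_spf:
  assumes "bounded S" "s \<in> S"
  shows "Re (s * cis \<theta>) \<le> spf (cnj ` S) \<theta>"
proof -
  obtain B where B: "\<And>s. s \<in> S \<Longrightarrow> cmod s \<le> B" using assms(1) by (auto simp: bounded_iff)
  have "bdd_above ((\<lambda>s. Re (s * exp (- (\<i> * of_real \<theta>)))) ` cnj ` S)"
  proof (rule bdd_aboveI2)
    fix s assume "s \<in> cnj ` S"
    then have "cmod (s * exp (- (\<i> * of_real \<theta>))) \<le> B"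
      using B by (auto simp: norm_mult)
    then show "Re (s * exp (- (\<i> * of_real \<theta>))) \<le> B"
      using complex_Re_le_cmod order_trans by blast
  qed
  from cSUP_upper[OF imageI[OF assms(2), of cnj] this]
  have "Re (cnj s * exp (- (\<i> * of_real \<theta>))) \<le> spf (cnj ` S) \<theta>" by (simp add: spf_def)
  also have "cnj s * exp (- (\<i> * of_real \<theta>)) = cnj (s * cis \<theta>)"
    using exp_cnj[of "\<i> * of_real \<theta>"] by (simp add: cis_conv_exp)
  finally show ?thesis by simp
qed

text \<open>The part of the complement inside \<open>S\<close> is the image of an annulus, hence
  connected. A frontier point of \<open>S\<close> lies off the compact image, so it is a limit of
  this part; it also belongs to \<open>- S\<close> and thereby links the two pieces.\<close>

lemma complement_image_cball_connected:
  assumes S: "open S" "S \<noteq> UNIV" "connected (- S)" "bounded S"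
    and g: "continuous_on (ball 0 1) g" "inj_on g (ball 0 1)" "g ` ball 0 1 = S"
    and \<rho>: "0 \<le> \<rho>" "\<rho> < (1::real)"
  shows "connected (- (g ` cball (0::complex) \<rho>) :: complex set)"
proof -
  let ?A = "{x::complex. \<rho> < norm (x - 0) \<and> norm (x - 0) < 1}"
  have sub: "cball 0 \<rho> \<subseteq> ball (0::complex) 1" using \<rho> by auto
  have "compact (g ` cball 0 \<rho>)"
    by (intro compact_continuous_image continuous_on_subset[OF g(1) sub] compact_cball)
  then have cl: "closed (g ` cball 0 \<rho>)" by (rule compact_imp_closed)
  have "ball 0 1 - cball 0 \<rho> = ?A" by auto
  then have gA: "S - g ` cball 0 \<rho> = g ` ?A"
    using inj_on_image_set_diff[OF g(2), of "ball 0 1" "cball 0 \<rho>"] sub g(3) by auto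
  have "?A \<subseteq> ball 0 1" by auto
  then have conA: "connected (S - g ` cball 0 \<rho>)"
    unfolding gA by (intro connected_continuous_image continuous_on_subset[OF g(1)] connected_annulus) auto
  have ne: "S \<noteq> {}" using g(3) by auto
  have "frontier S \<noteq> {}" using S ne by (metis frontier_eq_empty)
  then obtain p where p: "p \<in> frontier S" by blast
  have pS: "p \<notin> S" using p S(1) by (simp add: frontier_def interior_open)
  have gS: "g ` cball 0 \<rho> \<subseteq> S" using g(3) sub by blast
  have "p \<in> closure (S - g ` cball 0 \<rho>)"
  proof -
    have "p \<in> closure S \<inter> - (g ` cball 0 \<rho>)" using p pS gS by (auto simp: frontier_def)
    then have "p \<in> closure (S \<inter> - (g ` cball 0 \<rho>))"
      using open_Int_closure_subset[of "- (g ` cball 0 \<rho>)" S] cl by (auto simp: Int_commute open_Compl)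
    then show ?thesis by (simp add: Diff_eq)
  qed
  then have "connected (insert p (S - g ` cball 0 \<rho>))"
    by (intro connected_intermediate_closure[OF conA]) (auto intro: closure_subset[THEN subsetD])
  then have "connected (insert p (S - g ` cball 0 \<rho>) \<union> - S)"
    using pS by (intro connected_Un S(3)) auto
  also have "insert p (S - g ` cball 0 \<rho>) \<union> - S = - (g ` cball 0 \<rho>)" using pS gS by auto
  finally show ?thesis .
qed

text \<open>The substitution \<open>w = g \<xi>\<close> in Cauchy's formula. The factor
  \<open>(\<xi> - \<omega>) / (g \<xi> - g \<omega>)\<close> has the removable value
  \<open>1 / deriv g \<omega>\<close> at \<omega>, so the formula on the disc applies to
  \<open>k\<close> and no winding number of the image curve has to be computed.\<close>

lemma Cauchy_formula_conformal:
  assumes g: "g holomorphic_on ball 0 1" "inj_on g (ball 0 1)" and f: "f holomorphic_on S" "open S" "g ` ball 0 1 \<subseteq> S"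
    and \<rho>: "cmod \<omega> < \<rho>" "\<rho> < 1"
  shows "((\<lambda>t. f (g (of_real \<rho> * cis t)) * deriv g (of_real \<rho> * cis t) / (g (of_real \<rho> * cis t) - g \<omega>)
            * of_real \<rho> * \<i> * cis t) has_integral (2 * of_real pi * \<i> * f (g \<omega>))) {0..2*pi}"
proof -
  have \<omega>: "\<omega> \<in> ball 0 1" using \<rho> by auto
  have d0: "deriv g \<omega> \<noteq> 0"
    using g \<omega> by (intro holomorphic_injective_imp_regular) auto
  have fg: "(\<lambda>\<xi>. f (g \<xi>)) holomorphic_on ball 0 1"
    using holomorphic_on_compose_gen[OF g(1) f(1)] f(3) by (auto simp: o_def)
  have dg: "deriv g holomorphic_on ball 0 1" by (intro holomorphic_deriv g) auto
  have gne: "g \<xi> - g \<omega> \<noteq> 0" if "\<xi> \<in> ball 0 1 - {\<omega>}" for \<xi>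
    using g(2) \<omega> that by (auto simp: inj_on_def)
  define k where "k = (\<lambda>\<xi>. if \<xi> = \<omega> then f (g \<omega>) else f (g \<xi>) * deriv g \<xi> * ((\<xi> - \<omega>) / (g \<xi> - g \<omega>)))"
  have kh: "k holomorphic_on (ball 0 1 - {\<omega>})"
  proof -
    have "(\<lambda>\<xi>. f (g \<xi>) * deriv g \<xi> * ((\<xi> - \<omega>) / (g \<xi> - g \<omega>))) holomorphic_on (ball 0 1 - {\<omega>})"
      using gne by (intro holomorphic_intros holomorphic_on_subset[OF fg] holomorphic_on_subset[OF dg]
            holomorphic_on_subset[OF g(1)]) auto
    then show ?thesis by (rule holomorphic_transform) (auto simp: k_def)
  qed
  have kc: "k \<midarrow>\<omega>\<rightarrow> k \<omega>"
  proof -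
    have "(g has_field_derivative deriv g \<omega>) (at \<omega>)"
      using g(1) \<omega> by (intro holomorphic_derivI) auto
    then have "(\<lambda>\<xi>. (g \<xi> - g \<omega>) / (\<xi> - \<omega>)) \<midarrow>\<omega>\<rightarrow> deriv g \<omega>" by (simp add: has_field_derivative_iff)
    then have "(\<lambda>\<xi>. inverse ((g \<xi> - g \<omega>) / (\<xi> - \<omega>))) \<midarrow>\<omega>\<rightarrow> inverse (deriv g \<omega>)"
      using d0 by (rule tendsto_inverse)
    moreover have "(\<lambda>\<xi>. f (g \<xi>)) \<midarrow>\<omega>\<rightarrow> f (g \<omega>)" "deriv g \<midarrow>\<omega>\<rightarrow> deriv g \<omega>"
      using holomorphic_on_imp_continuous_on[OF fg] holomorphic_on_imp_continuous_on[OF dg] \<omega>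
      by (auto simp: continuous_on_eq_continuous_at isCont_def)
    ultimately have "(\<lambda>\<xi>. f (g \<xi>) * deriv g \<xi> * inverse ((g \<xi> - g \<omega>) / (\<xi> - \<omega>))) \<midarrow>\<omega>\<rightarrow>
        f (g \<omega>) * deriv g \<omega> * inverse (deriv g \<omega>)"
      by (intro tendsto_mult)
    also have "f (g \<omega>) * deriv g \<omega> * inverse (deriv g \<omega>) = f (g \<omega>)" using d0 by simp
    finally have "(\<lambda>\<xi>. f (g \<xi>) * deriv g \<xi> * inverse ((g \<xi> - g \<omega>) / (\<xi> - \<omega>))) \<midarrow>\<omega>\<rightarrow> f (g \<omega>)" .
    then have "(\<lambda>\<xi>. f (g \<xi>) * deriv g \<xi> * ((\<xi> - \<omega>) / (g \<xi> - g \<omega>))) \<midarrow>\<omega>\<rightarrow> f (g \<omega>)"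
      by simp
    then have "k \<midarrow>\<omega>\<rightarrow> f (g \<omega>)"
      by (rule Lim_transform_eventually) (auto simp: k_def eventually_at intro!: exI[of _ 1])
    then show ?thesis by (simp add: k_def)
  qed
  have "k holomorphic_on ball 0 1"
  proof (rule no_isolated_singularity[OF _ kh])
    show "continuous_on (ball 0 1) k"
    proof (subst continuous_on_eq_continuous_at, simp, intro ballI)
      fix x assume x: "x \<in> ball (0::complex) 1"
      show "isCont k x"
      proof (cases "x = \<omega>")
        case True then show ?thesis using kc by (simp add: isCont_def)
      next
        case False
        have "open (ball 0 1 - {\<omega>})" by auto
        then show ?thesis using holomorphic_on_imp_continuous_on[OF kh] x False
          by (metis Diff_iff continuous_on_eq_continuous_at insertE empty_iff)
      qed
    qed
  qed auto
  then have "((\<lambda>\<xi>. k \<xi> / (\<xi> - \<omega>)) has_contour_integral (2 * of_real pi * \<i> * k \<omega>)) (circlepath 0 \<rho>)"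
    using \<rho> by (intro Cauchy_integral_circlepath_simple) (auto intro: holomorphic_on_subset)
  then have "((\<lambda>t. k (of_real \<rho> * cis t) / (of_real \<rho> * cis t - \<omega>) * of_real \<rho> * \<i> * cis t) has_integral
      (2 * of_real pi * \<i> * k \<omega>)) {0..2*pi}"
    by (simp add: circlepath_def has_contour_integral_part_circlepath_iff)
  moreover have "k (of_real \<rho> * cis t) / (of_real \<rho> * cis t - \<omega>) =
      f (g (of_real \<rho> * cis t)) * deriv g (of_real \<rho> * cis t) / (g (of_real \<rho> * cis t) - g \<omega>)" for t
  proof -
    have "cmod (of_real \<rho> * cis t) = \<rho>" using \<rho> norm_ge_zero[of \<omega>] by (simp add: norm_mult del: norm_ge_zero)
    then have "of_real \<rho> * cis t \<noteq> \<omega>" using \<rho> by auto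
    then show ?thesis by (simp add: k_def divide_simps)
  qed
  moreover have "k \<omega> = f (g \<omega>)" by (simp add: k_def)
  ultimately show ?thesis by simp
qed


section \<open>From incompleteness to an entire function with prescribed zeros\<close>

lemma not_dense_witness:
  assumes "\<not> complete_system (Hol_topology S) E" "E \<subseteq> Hol S" 
  obtains f0 K e where "f0 \<in> Hol S" "compact K" "K \<subseteq> S" "0 < e"
    "\<And>v. v \<in> module.span fun_scale E \<Longrightarrow> v \<in> Hol S \<Longrightarrow> \<exists>w\<in>K. e \<le> cmod (v w - f0 w)"
proof -
  have "Hol_topology S closure_of (module.span fun_scale E) \<noteq> topspace (Hol_topology S)"
    using assms(1) by (simp add: complete_system_def)
  then obtain f0 where f0: "f0 \<in> topspace (Hol_topology S)"
    "f0 \<notin> Hol_topology S closure_of (module.span fun_scale E)"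
    using closure_of_subset_topspace[of "Hol_topology S" "module.span fun_scale E"] by blast
  from f0(2)[unfolded in_closure_of openin_Hol_topology] f0(1)
  obtain T where T: "f0 \<in> T" "Hol_open S T" "\<And>y. y \<in> module.span fun_scale E \<Longrightarrow> y \<notin> T"
    by blast
  have f0: "f0 \<in> Hol S" using f0(1) by simp
  from T(1,2) obtain K e where K: "compact K" "K \<subseteq> S" "0 < e" "{g \<in> Hol S. \<forall>w\<in>K. cmod (g w - f0 w) < e} \<subseteq> T"
    unfolding Hol_open_def by blast
  show thesis
  proof (rule that[OF f0 K(1-3)])
    fix v assume "v \<in> module.span fun_scale E" "v \<in> Hol S"
    then show "\<exists>w\<in>K. e \<le> cmod (v w - f0 w)" using T(3)[of v] K(4) by (force simp: not_less)
  qed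
qed

lemma powser_all_zero:
  fixes c :: "nat \<Rightarrow> complex"
  assumes "\<And>z. (\<lambda>n. c n * z ^ n) sums 0"
  shows "c n = 0"
proof -
  have "(\<lambda>_. 0) has_fps_expansion Abs_fps c"
    by (rule has_fps_expansionI) (use assms in auto)
  then have "Abs_fps c = 0" by (rule fps_expansion_unique_complex) simp
  then show ?thesis by (metis fps_nth_Abs_fps fps_zero_nth)
qed

text \<open>Division of the Taylor series at \<open>a\<close> by \<open>(z - a) ^ k\<close>. A
  cofactor continuous at \<open>a\<close> is the form in which orders of zeros are compared
  later.\<close>

lemma powser_factor:
  fixes c :: "nat \<Rightarrow> complex"
  assumes sums: "\<And>\<zeta>. (\<lambda>n. c n * \<zeta> ^ n) sums F (a + \<zeta>)" and zero: "\<And>n. n < k \<Longrightarrow> c n = 0"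
  obtains H where "isCont H a" "\<And>z. F z = (z - a) ^ k * H z"
proof -
  have shift: "(\<lambda>n. c (n + k) * \<zeta> ^ (n + k)) sums F (a + \<zeta>)" for \<zeta>
    using sums[of \<zeta>] zero by (subst sums_iff_shift) simp
  have summ: "summable (\<lambda>n. c (n + k) * \<zeta> ^ n)" for \<zeta>
  proof (cases "\<zeta> = 0")
    case True
    then show ?thesis using sums_summable[OF powser_sums_zero[of "\<lambda>n. c (n + k)"]] by simp
  next
    case False
    have "summable (\<lambda>n. (c (n + k) * \<zeta> ^ (n + k)) / \<zeta> ^ k)"
      by (intro summable_divide sums_summable[OF shift])
    then show ?thesis using False by (simp add: power_add)
  qed
  define H where "H z = (\<Sum>n. c (n + k) * (z - a) ^ n)" for z
  have "isCont (\<lambda>\<zeta>. \<Sum>n. c (n + k) * \<zeta> ^ n) 0"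
    by (rule isCont_powser_converges_everywhere[OF summ])
  then have "isCont H a"
    unfolding H_def using isCont_o2[of a "\<lambda>z. z - a" "\<lambda>\<zeta>. \<Sum>n. c (n + k) * \<zeta> ^ n"] by simp
  moreover have "F z = (z - a) ^ k * H z" for z
  proof -
    have "(\<lambda>n. (z - a) ^ k * (c (n + k) * (z - a) ^ n)) sums ((z - a) ^ k * H z)"
      unfolding H_def by (intro sums_mult summable_sums summ)
    then have "(\<lambda>n. c (n + k) * (z - a) ^ (n + k)) sums ((z - a) ^ k * H z)"
      by (simp add: power_add mult_ac)
    then show ?thesis using shift[of "z - a"] by (simp add: sums_iff)
  qed
  ultimately show thesis by (rule that)
qed

text \<open>Vanishing on \<open>Z\<close> is expressed for every finite \<open>k\<close> up to
  \<open>Z a\<close>, which treats \<open>Z a = \<infinity>\<close> together with the finite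
  multiplicities.\<close>

theorem incomplete_imp_annihilator:
  fixes Z :: "complex \<Rightarrow> enat"
  assumes S: "open S" "connected S" "S \<noteq> {}" "bounded S" "simply_connected S"
    and inc: "\<not> complete_system (Hol_topology S) (exp_system S Z)"
  obtains F M \<epsilon> where "F holomorphic_on UNIV" "\<exists>z. F z \<noteq> 0" "0 < M" "0 < \<epsilon>"
    "\<And>t \<theta>. 0 \<le> t \<Longrightarrow> cmod (F (of_real t * cis \<theta>)) \<le> M * exp (t * (spf (cnj ` S) \<theta> - \<epsilon>))"
    "\<And>a k. enat k \<le> Z a \<Longrightarrow> \<exists>H. isCont H a \<and> (\<forall>z. F z = (z - a) ^ k * H z)"
proof -
  interpret vs: vector_space fun_scale by (rule vector_space_fun_scale)
  let ?E = "exp_system S Z"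
  let ?V = "module.span fun_scale ?E"
  obtain f0 K e where f0: "f0 \<in> Hol S" and K: "compact K" "K \<subseteq> S" and e: "0 < e"
    and far: "\<And>v. v \<in> ?V \<Longrightarrow> v \<in> Hol S \<Longrightarrow> \<exists>w\<in>K. e \<le> cmod (v w - f0 w)"
    using not_dense_witness[OF inc exp_system_subset_Hol] by metis
  have "vs.subspace (Hol S)"
    by (auto simp: vs.subspace_def Hol_def fun_scale_def plus_fun_def zero_fun_def intro!: holomorphic_intros)
  then have VHol: "?V \<subseteq> Hol S"
    by (intro vs.span_minimal exp_system_subset_Hol)
  have "S \<noteq> UNIV" using S(4) not_bounded_UNIV by auto
  then obtain \<phi> g where \<phi>: "\<phi> holomorphic_on S" and g: "g holomorphic_on ball 0 1"
    and \<phi>g: "\<And>z. z \<in> S \<Longrightarrow> \<phi> z \<in> ball 0 1 \<and> g (\<phi> z) = z"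
    and g\<phi>: "\<And>z. z \<in> ball 0 1 \<Longrightarrow> g z \<in> S \<and> \<phi> (g z) = z"
    using Riemann_mapping_theorem[of S] S by blast
  have ginj: "inj_on g (ball 0 1)" using g\<phi> by (metis inj_on_def)
  have gS: "g ` ball 0 1 = S" using g\<phi> \<phi>g by (auto simp: image_iff) (metis mem_ball_0)
  have gc: "continuous_on (ball 0 1) g" by (rule holomorphic_on_imp_continuous_on[OF g])
  obtain \<rho>0 where \<rho>0: "0 \<le> \<rho>0" "\<rho>0 < 1" "\<And>z. z \<in> K \<Longrightarrow> cmod (\<phi> z) \<le> \<rho>0"
  proof -
    have "compact (\<phi> ` K)"
      by (intro compact_continuous_image K continuous_on_subset[OF holomorphic_on_imp_continuous_on[OF \<phi>]])
    moreover have "\<phi> ` K \<subseteq> ball 0 1" using \<phi>g K by blast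
    ultimately obtain d where d: "0 < d" "(\<Union>x\<in>\<phi> ` K. cball x d) \<subseteq> ball 0 1"
      using compact_subset_open_imp_cball_epsilon_subset[of "\<phi> ` K" "ball 0 1"] by auto
    show thesis
    proof (rule that[of "max 0 (1 - d)"])
      fix z assume z: "z \<in> K"
      show "cmod (\<phi> z) \<le> max 0 (1 - d)"
      proof (cases "\<phi> z = 0")
        case False
        \<comment> \<open>The point \<open>\<phi> z\<close> pushed outwards by \<open>d\<close>: it
          still lies in the unit disc, which bounds the modulus of \<open>\<phi> z\<close> by
          \<open>1 - d\<close>.\<close>
        let ?y = "\<phi> z + of_real d * sgn (\<phi> z)"
        have "?y \<in> cball (\<phi> z) d" using False d(1) by (simp add: dist_norm norm_mult norm_sgn)
        then have "cmod ?y < 1" using d(2) z by (force simp: dist_norm)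
        moreover have "?y = of_real (1 + d / cmod (\<phi> z)) * \<phi> z" by (simp add: sgn_eq algebra_simps)
        then have "cmod ?y = (1 + d / cmod (\<phi> z)) * cmod (\<phi> z)"
          using d(1) by (simp only: norm_mult norm_of_real abs_of_nonneg[of "1 + d / cmod (\<phi> z)"]
              add_nonneg_nonneg zero_le_one divide_nonneg_nonneg less_imp_le norm_ge_zero)
        then have "cmod ?y = cmod (\<phi> z) + d" using False by (simp add: distrib_right)
        ultimately show ?thesis by simp
      qed simp
    qed (use d in auto)
  qed
  \<comment> \<open>The circle of radius \<rho> carries \<open>\<Lambda>\<close>; the larger radius
    \<open>\<rho>'\<close> is for the Cauchy formula that reproduces \<open>f0\<close> on the first
    curve from kernels with poles outside it.\<close>
  define \<rho> where "\<rho> = (\<rho>0 + 1) / 2"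
  define \<rho>' where "\<rho>' = (\<rho> + 1) / 2"
  have \<rho>: "\<rho>0 < \<rho>" "\<rho> < \<rho>'" "\<rho>' < 1" "0 < \<rho>" "\<rho> < 1" using \<rho>0 by (auto simp: \<rho>_def \<rho>'_def)
  define \<gamma> where "\<gamma> t = g (of_real \<rho> * cis t)" for t
  define P where "P = \<gamma> ` {0..2*pi}"
  have \<gamma>c: "continuous_on {0..2*pi} \<gamma>"
    unfolding \<gamma>_def using \<rho>
    by (intro continuous_on_compose2[OF gc] continuous_intros) (auto simp: norm_mult)
  have \<gamma>S: "\<gamma> t \<in> S" for t
    using g\<phi>[of "of_real \<rho> * cis t"] \<rho> by (auto simp: \<gamma>_def norm_mult)
  have PS: "P \<subseteq> S" using \<gamma>S by (auto simp: P_def)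
  have Hc: "continuous_on P v" if "v \<in> Hol S" for v
    using that PS holomorphic_on_imp_continuous_on continuous_on_subset by (fastforce simp: Hol_def)
  define d where "d = 2 * pi * (e * ((\<rho> - \<rho>0) / \<rho>))\<^sup>2"
  \<comment> \<open>Uniform distance at least \<open>e\<close> on \<open>K\<close> becomes L2
    distance on the curve, because the preimage of \<open>K\<close> lies in the disc of radius
    \<open>\<rho>0\<close> inside the circle.\<close>
  have gap: "d \<le> arc_sqnorm \<gamma> (\<lambda>z. f0 z - v z)" if v: "v \<in> ?V" for v
  proof -
    have vH: "v \<in> Hol S" using v VHol by blast
    obtain w where w: "w \<in> K" "e \<le> cmod (v w - f0 w)" using far[OF v vH] by blast
    have "(\<lambda>z. f0 z - v z) holomorphic_on S" using f0 vH by (auto simp: Hol_def intro!: holomorphic_intros)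
    then have "(\<lambda>\<xi>. f0 (g \<xi>) - v (g \<xi>)) holomorphic_on ball 0 1"
      using holomorphic_on_compose_gen[OF g, of "\<lambda>z. f0 z - v z" S] gS by (auto simp: o_def)
    from circle_mean_bound[OF this \<rho>0(1) \<rho>(1,5) \<rho>0(3)[OF w(1)] e]
    show ?thesis using w \<phi>g K(2) by (auto simp: d_def arc_sqnorm_def \<gamma>_def norm_minus_commute)
  qed
  have dpos: "0 < d" using e \<rho> by (auto simp: d_def)
  have Vprops: "(\<lambda>z. 0) \<in> ?V" "\<And>v w. v \<in> ?V \<Longrightarrow> w \<in> ?V \<Longrightarrow> (\<lambda>z. v z + w z) \<in> ?V"
    "\<And>c v. v \<in> ?V \<Longrightarrow> (\<lambda>z. c * v z) \<in> ?V"
    using vs.span_zero vs.span_add vs.span_scale by (auto simp: zero_fun_def plus_fun_def fun_scale_def)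
  obtain r \<Lambda> M where r: "\<And>n. continuous_on P (r n)"
    and lim: "\<And>f. continuous_on P f \<Longrightarrow> (\<lambda>n. arc_form \<gamma> f (r n)) \<longlonglongrightarrow> \<Lambda> f"
    and M: "0 < M"
    and bound: "\<And>f B n. continuous_on P f \<Longrightarrow> (\<And>z. z \<in> P \<Longrightarrow> cmod (f z) \<le> B) \<Longrightarrow>
       cmod (arc_form \<gamma> f (r n)) \<le> M * B"
    and \<Lambda>V: "\<And>v. v \<in> ?V \<Longrightarrow> \<Lambda> v = 0" and \<Lambda>f0: "\<Lambda> f0 \<noteq> 0"
  proof -
    show ?thesis
      by (rule separating_functional[OF \<gamma>c P_def Hc[OF subsetD[OF VHol]] Vprops Hc[OF f0] dpos gap])
        (assumption | rule that | blast)+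
  qed
  interpret arc_functional \<gamma> P r \<Lambda> M
    by unfold_locales (use \<gamma>c P_def r lim M bound in auto)
  define F where "F z = \<Lambda> (\<lambda>w. exp (z * w))" for z
  have Fs: "(\<lambda>n. \<Lambda> (\<lambda>w. w ^ n * exp (a * w)) / fact n * \<zeta> ^ n) sums F (a + \<zeta>)" for a \<zeta>
    unfolding F_def by (rule exp_transform_sums)
  have Fhol: "F holomorphic_on UNIV"
  proof -
    have "F holomorphic_on ball 0 R" for R
      by (rule power_series_holomorphic[of 0 R "\<lambda>n. \<Lambda> (\<lambda>w. w ^ n * exp (0 * w)) / fact n"])
         (use Fs[of 0] in simp)
    then have "F field_differentiable (at z)" for z
      by (rule holomorphic_on_imp_differentiable_at[of _ "ball 0 (cmod z + 1)"]) auto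
    then show ?thesis by (simp add: holomorphic_on_def field_differentiable_at_within)
  qed
  obtain \<epsilon> where \<epsilon>: "0 < \<epsilon>" "(\<Union>x\<in>P. cball x \<epsilon>) \<subseteq> S"
    using compact_subset_open_imp_cball_epsilon_subset[OF compact_P S(1) PS] by blast
  have growth: "cmod (F (of_real t * cis \<theta>)) \<le> M * exp (t * (spf (cnj ` S) \<theta> - \<epsilon>))" if t: "0 \<le> t" for t \<theta>
    unfolding F_def
  proof (rule functional_bound)
    fix w assume w: "w \<in> P"
    \<comment> \<open>Shifting \<open>w\<close> by \<epsilon> in the direction
      \<open>cis (- \<theta>)\<close> stays in \<open>S\<close> and raises
      \<open>Re (w * cis \<theta>)\<close> by exactly \<epsilon>; this is where the \<epsilon> in
      the growth bound originates.\<close>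
    let ?s = "w + of_real \<epsilon> * cis (- \<theta>)"
    have "?s \<in> cball w \<epsilon>" using \<epsilon> by (simp add: dist_norm norm_mult)
    then have "?s \<in> S" using \<epsilon>(2) w by blast
    then have "Re (?s * cis \<theta>) \<le> spf (cnj ` S) \<theta>" by (rule Re_le_spf[OF S(4)])
    moreover have "?s * cis \<theta> = w * cis \<theta> + of_real \<epsilon>" by (simp add: algebra_simps cis_mult)
    ultimately have "Re (w * cis \<theta>) \<le> spf (cnj ` S) \<theta> - \<epsilon>" by simp
    then have "t * Re (w * cis \<theta>) \<le> t * (spf (cnj ` S) \<theta> - \<epsilon>)" using t by (rule mult_left_mono)
    moreover have "Re (of_real t * cis \<theta> * w) = t * Re (w * cis \<theta>)" by (simp add: algebra_simps)
    ultimately show "cmod (exp (of_real t * cis \<theta> * w)) \<le> exp (t * (spf (cnj ` S) \<theta> - \<epsilon>))"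
      by (simp only: norm_exp_eq_Re exp_le_cancel_iff)
  qed (intro continuous_intros)
  have factor: "\<exists>H. isCont H a \<and> (\<forall>z. F z = (z - a) ^ k * H z)" if k: "enat k \<le> Z a" for a k
  proof -
    have "\<Lambda> (\<lambda>w. w ^ n * exp (a * w)) / fact n = 0" if n: "n < k" for n
    proof -
      have "enat (Suc n) \<le> Z a" using n k by (meson Suc_leI enat_ord_simps(1) order_trans)
      then have "Z a > 0" "enat n \<le> Z a - 1" by (cases "Z a"; simp add: one_enat_def zero_enat_def)+
      then have "zero_extend S (\<lambda>w. w ^ n * exp (a * w)) \<in> ?V"
        by (intro vs.span_base) (auto simp: exp_system_def)
      from \<Lambda>V[OF this] have "\<Lambda> (zero_extend S (\<lambda>w. w ^ n * exp (a * w))) = 0" .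
      moreover have "\<Lambda> (\<lambda>w. w ^ n * exp (a * w)) = \<Lambda> (zero_extend S (\<lambda>w. w ^ n * exp (a * w)))"
      proof (rule functional_cong)
        show "continuous_on P (\<lambda>w. w ^ n * exp (a * w))" by (intro continuous_intros)
      qed (use PS in \<open>auto simp: zero_extend_def\<close>)
      ultimately have "\<Lambda> (\<lambda>w. w ^ n * exp (a * w)) = 0" by simp
      then show ?thesis by simp
    qed
    from powser_factor[OF Fs this] show ?thesis by metis
  qed
  have "\<exists>z. F z \<noteq> 0"
  proof (rule ccontr)
    assume "\<not> (\<exists>z. F z \<noteq> 0)"
    then have "\<Lambda> (\<lambda>w. w ^ n * exp (0 * w)) / fact n = 0" for n
      using Fs[of 0] by (intro powser_all_zero[of "\<lambda>n. \<Lambda> (\<lambda>w. w ^ n * exp (0 * w)) / fact n"]) simp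
    then have mom: "\<Lambda> (\<lambda>w. w ^ n) = 0" for n by simp
    obtain R where R: "0 < R" "\<And>w. w \<in> P \<Longrightarrow> cmod w \<le> R" using P_bound by blast
    let ?K' = "g ` cball 0 \<rho>"
    have conK: "connected (- ?K')"
      using complement_image_cball_connected[OF S(1) \<open>S \<noteq> UNIV\<close> _ S(4) gc ginj gS, of \<rho>] \<rho> S
      by (simp add: simply_connected_iff_simple)
    have cK: "compact ?K'"
      using \<rho> by (intro compact_continuous_image continuous_on_subset[OF gc]) auto
    have PK: "P \<subseteq> ?K'" using \<rho> by (auto simp: P_def \<gamma>_def norm_mult intro!: imageI)
    obtain R' where R': "\<And>z. z \<in> ?K' \<Longrightarrow> cmod z \<le> R'" using compact_imp_bounded[OF cK] by (auto simp: bounded_iff)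
    \<comment> \<open>A seed for analytic continuation: beyond both radii the expansion at infinity
      is valid and the compact image is avoided.\<close>
    define \<xi> where "\<xi> = complex_of_real (max R R' + 1)"
    have "cmod \<xi> = max R R' + 1" using R(1) unfolding \<xi>_def norm_of_real by simp
    then have \<xi>: "R < cmod \<xi>" "R' < cmod \<xi>" by auto
    define U where "U = {z. R < cmod z} \<inter> {z. R' < cmod z}"
    have Uo: "open U" unfolding U_def by (intro open_Int open_Collect_less continuous_intros)
    have \<Phi>0: "\<Lambda> (\<lambda>w. 1 / (\<zeta> - w)) = 0" if \<zeta>: "\<zeta> \<in> - ?K'" for \<zeta>
    proof (rule analytic_continuation[where S = "- ?K'" and U = U and \<xi> = \<xi> and f = "\<lambda>\<zeta>. \<Lambda> (\<lambda>w. 1 / (\<zeta> - w))"])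
      show "(\<lambda>\<zeta>. \<Lambda> (\<lambda>w. 1 / (\<zeta> - w))) holomorphic_on - ?K'"
        using PK by (intro holomorphic_on_subset[OF cauchy_transform_holomorphic]) auto
      show "open (- ?K')" using cK by (simp add: compact_imp_closed open_Compl)
      show "U \<subseteq> - ?K'" using R' by (force simp: U_def)
      show "\<xi> \<in> - ?K'" using R'[of \<xi>] \<xi> by force
      show "\<xi> islimpt U" 
        using interior_open[OF Uo] \<xi> by (intro interior_limit_point) (simp add: U_def)
      show "\<Lambda> (\<lambda>w. 1 / (z - w)) = 0" if "z \<in> U" for z
        using that R by (intro cauchy_transform_outside mom) (auto simp: U_def)
    qed (use conK \<zeta> in auto)
    \<comment> \<open>This curve lies off \<open>?K'\<close>, where the Cauchy transform vanishes.
      Writing \<open>f0\<close> on \<open>P\<close> as an integral of Cauchy kernels with poles on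
      it forces \<open>\<Lambda> f0 = 0\<close>.\<close>
    define c where "c t = g (of_real \<rho>' * cis t)" for t
    define q where "q t = f0 (c t) * deriv g (of_real \<rho>' * cis t) * of_real \<rho>' * \<i> * cis t / (2 * of_real pi * \<i>)" for t
    have inb: "of_real \<rho>' * cis t \<in> ball 0 1" for t using \<rho> by (simp add: norm_mult)
    have ccont: "continuous_on {0..2*pi} c"
      unfolding c_def by (intro continuous_on_compose2[OF gc] continuous_intros) (use inb in auto)
    have cS: "c t \<in> S" for t using g\<phi>[OF inb] by (simp add: c_def)
    have cK: "c t \<notin> ?K'" for t
    proof
      assume "c t \<in> ?K'"
      then obtain x where x: "cmod x \<le> \<rho>" "g (of_real \<rho>' * cis t) = g x" by (auto simp: c_def)
      have "x \<in> ball 0 1" using x(1) \<rho>(5) by simp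
      with x(2) inb have "of_real \<rho>' * cis t = x" by (rule inj_onD[OF ginj])
      then have "cmod x = \<rho>'" using \<rho> by (auto simp: norm_mult)
      then show False using x \<rho> by simp
    qed
    have f0h: "f0 holomorphic_on S" using f0 by (simp add: Hol_def)
    have qcont: "continuous_on {0..2*pi} q"
    proof -
      have "continuous_on {0..2*pi} (\<lambda>t. f0 (c t))"
        using cS by (intro continuous_on_compose2[OF holomorphic_on_imp_continuous_on[OF f0h] ccont]) auto
      moreover have "continuous_on {0..2*pi} (\<lambda>t. deriv g (of_real \<rho>' * cis t))"
        by (intro continuous_on_compose2[OF holomorphic_on_imp_continuous_on[OF holomorphic_deriv[OF g]]] continuous_intros)
           (use inb in auto)
      ultimately show ?thesis unfolding q_def by (intro continuous_intros) auto
    qed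
    have "\<Lambda> f0 = \<Lambda> (\<lambda>w. integral {0..2*pi} (\<lambda>t. q t * (1 / (c t - w))))"
    proof (rule functional_cong[OF Hc[OF f0]])
      fix w assume "w \<in> P"
      then obtain s where s: "w = g (of_real \<rho> * cis s)" by (auto simp: P_def \<gamma>_def)
      have "cmod (of_real \<rho> * cis s) < \<rho>'" using \<rho> by (simp add: norm_mult)
      from has_integral_divide[OF Cauchy_formula_conformal[OF g ginj f0h S(1) _ this \<rho>(3)], of "2 * of_real pi * \<i>"]
      have "((\<lambda>t. q t * (1 / (c t - w))) has_integral f0 w) {0..2*pi}"
        using gS by (simp add: q_def c_def s mult_ac)
      then show "f0 w = integral {0..2*pi} (\<lambda>t. q t * (1 / (c t - w)))" by (simp add: integral_unique)
    qed
    also have "\<dots> = 0"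
    proof (rule functional_cauchy_integral[OF ccont qcont])
      show "c ` {0..2*pi} \<inter> P = {}" using cK PK by blast
      show "\<Lambda> (\<lambda>w. 1 / (c t - w)) = 0" for t using cK by (intro \<Phi>0) auto
    qed
    finally show False using \<Lambda>f0 by simp
  qed
  then show thesis using that Fhol M \<epsilon>(1) growth factor by blast
qed

section \<open>Fourier coefficients of \<open>ln |F|\<close> on circles\<close>

text \<open>The two derivatives are carried along with the function, so that statements involving
  all three are proved by one induction. A complex \<tau> yields both cosine and sine, and
  \<open>n = 0\<close> the constants.\<close>

inductive trig_poly :: "(real \<Rightarrow> real) \<Rightarrow> (real \<Rightarrow> real) \<Rightarrow> (real \<Rightarrow> real) \<Rightarrow> bool" where
  monomial: "trig_poly (\<lambda>\<theta>. Re (\<tau> * cis (real n * \<theta>))) (\<lambda>\<theta>. Re (\<i> * of_nat n * \<tau> * cis (real n * \<theta>)))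
    (\<lambda>\<theta>. - (real n)\<^sup>2 * Re (\<tau> * cis (real n * \<theta>)))"
| add: "trig_poly T T1 T2 \<Longrightarrow> trig_poly U U1 U2 \<Longrightarrow>
    trig_poly (\<lambda>\<theta>. T \<theta> + U \<theta>) (\<lambda>\<theta>. T1 \<theta> + U1 \<theta>) (\<lambda>\<theta>. T2 \<theta> + U2 \<theta>)"

lemma trig_poly_deriv:
  assumes "trig_poly T T1 T2"
  shows "(T has_real_derivative T1 \<theta>) (at \<theta>)" "(T1 has_real_derivative T2 \<theta>) (at \<theta>)"
proof -
  have c: "((\<lambda>\<theta>. Re (\<tau> * cis (real n * \<theta>))) has_real_derivative Re (\<i> * of_nat n * \<tau> * cis (real n * \<theta>))) (at \<theta>)"
    for \<tau> n \<theta>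
    by (auto intro!: derivative_eq_intros simp: algebra_simps)
  have "(T has_real_derivative T1 \<theta>) (at \<theta>) \<and> (T1 has_real_derivative T2 \<theta>) (at \<theta>)"
    using assms
  proof induction
    case (monomial \<tau> n)
    show ?case
      using c[of \<tau> n \<theta>] c[of "\<i> * of_nat n * \<tau>" n \<theta>]
      by (simp add: algebra_simps power2_eq_square)
  next
    case (add T T1 T2 U U1 U2)
    then show ?case by (auto intro!: derivative_intros)
  qed
  then show "(T has_real_derivative T1 \<theta>) (at \<theta>)" "(T1 has_real_derivative T2 \<theta>) (at \<theta>)" by auto
qed

lemma trig_poly_continuous:
  assumes "trig_poly T T1 T2"
  shows "continuous_on A T" "continuous_on A T1" "continuous_on A T2"
proof -
  show "continuous_on A T" "continuous_on A T1"
    using trig_poly_deriv[OF assms]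
    by (auto intro!: continuous_at_imp_continuous_on DERIV_isCont)
  show "continuous_on A T2"
    using assms by induction (auto intro!: continuous_intros)
qed

lemma trig_poly_periodic:
  assumes "trig_poly T T1 T2"
  shows "T (\<theta> + 2 * pi) = T \<theta>" "T1 (\<theta> + 2 * pi) = T1 \<theta>" "T2 (\<theta> + 2 * pi) = T2 \<theta>"
proof -
  have c: "cis (real n * (\<theta> + 2 * pi)) = cis (real n * \<theta>)" for n
    using cis_multiple_2pi[of "real n"] by (simp add: distrib_left cis_mult[symmetric] mult.assoc mult.commute mult.left_commute)
  have "T (\<theta> + 2 * pi) = T \<theta> \<and> T1 (\<theta> + 2 * pi) = T1 \<theta> \<and> T2 (\<theta> + 2 * pi) = T2 \<theta>"
    using assms by induction (simp_all add: c)
  then show "T (\<theta> + 2 * pi) = T \<theta>" "T1 (\<theta> + 2 * pi) = T1 \<theta>" "T2 (\<theta> + 2 * pi) = T2 \<theta>" by auto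
qed

lemma trig_poly_sum:
  assumes "\<And>i. i \<in> I \<Longrightarrow> trig_poly (T i) (T1 i) (T2 i)"
  shows "trig_poly (\<lambda>\<theta>. \<Sum>i\<in>I. T i \<theta>) (\<lambda>\<theta>. \<Sum>i\<in>I. T1 i \<theta>) (\<lambda>\<theta>. \<Sum>i\<in>I. T2 i \<theta>)"
proof -
  have z: "trig_poly (\<lambda>\<theta>. 0) (\<lambda>\<theta>. 0) (\<lambda>\<theta>. 0)"
    using trig_poly.monomial[of 0 0] by simp
  show ?thesis
    using assms by (induction I rule: infinite_finite_induct) (auto intro: z trig_poly.add)
qed

text \<open>Write \<open>Re f\<close> as half the sum of \<open>f\<close> and its conjugate. Against
  \<open>cis (n * \<theta>)\<close> with \<open>n > 0\<close> the function \<open>f\<close>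
  integrates to 0 by Cauchy's theorem, and the conjugate yields the conjugated Taylor
  coefficient.\<close>

lemma circle_fourier_Re:
  assumes f: "f holomorphic_on ball 0 \<rho>" and t: "0 < t" "t < \<rho>"
  shows "((\<lambda>\<theta>. Re (f (of_real t * cis \<theta>))) has_integral 2 * pi * Re (f 0)) {0..2*pi}"
    and "0 < n \<Longrightarrow> ((\<lambda>\<theta>. of_real (Re (f (of_real t * cis \<theta>))) * cis (real n * \<theta>)) has_integral
      of_real pi * cnj ((deriv ^^ n) f 0 / fact n) * of_real t ^ n) {0..2*pi}"
proof -
  have hol: "f holomorphic_on cball 0 t" using t by (intro holomorphic_on_subset[OF f]) auto
  have hol2: "f holomorphic_on ball 0 t" using t by (intro holomorphic_on_subset[OF f]) auto
  have A: "((\<lambda>\<theta>. f (of_real t * cis \<theta>) * cis (- (real n * \<theta>))) has_integral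
      2 * of_real pi * ((deriv ^^ n) f 0 / fact n) * of_real t ^ n) {0..2*pi}" for n
  proof -
    have "((\<lambda>u. f u / (u - 0) ^ Suc n) has_contour_integral (2 * pi * \<i> / fact n * (deriv ^^ n) f 0)) (circlepath 0 t)"
      using t by (intro Cauchy_has_contour_integral_higher_derivative_circlepath hol2 holomorphic_on_imp_continuous_on[OF hol]) auto
    then have "((\<lambda>\<theta>. f (of_real t * cis \<theta>) / (of_real t * cis \<theta>) ^ Suc n * of_real t * \<i> * cis \<theta>) has_integral
        (2 * pi * \<i> / fact n * (deriv ^^ n) f 0)) {0..2*pi}"
      by (simp add: circlepath_def has_contour_integral_part_circlepath_iff)
    from has_integral_mult_right[OF this, of "of_real t ^ n / \<i>"]
    show ?thesis
    proof (rule has_integral_eq_rhs[OF has_integral_eq[rotated]])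
      fix \<theta> :: real
      have "(cis \<theta>) ^ n * cis (- (real n * \<theta>)) = 1" unfolding Complex.DeMoivre cis_mult by simp
      then have "1 / cis \<theta> ^ n = cis (- (real n * \<theta>))" by (simp add: divide_simps mult.commute)
      moreover have "of_real t ^ n / \<i> * (f (of_real t * cis \<theta>) / (of_real t * cis \<theta>) ^ Suc n * of_real t * \<i> * cis \<theta>)
          = f (of_real t * cis \<theta>) * (1 / cis \<theta> ^ n)"
        using t by (simp add: power_mult_distrib field_simps)
      ultimately show "of_real t ^ n / \<i> * (f (of_real t * cis \<theta>) / (of_real t * cis \<theta>) ^ Suc n * of_real t * \<i> * cis \<theta>)
          = f (of_real t * cis \<theta>) * cis (- (real n * \<theta>))" by simp
    qed (simp add: field_simps)
  qed
  have B: "((\<lambda>\<theta>. f (of_real t * cis \<theta>) * cis (real n * \<theta>)) has_integral 0) {0..2*pi}" if n: "0 < n" for n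
  proof -
    have "((\<lambda>u. f u * u ^ (n - 1)) has_contour_integral 0) (circlepath 0 t)"
      using t by (intro Cauchy_theorem_disc_simple[of _ 0 \<rho>] holomorphic_intros f) auto
    then have "((\<lambda>\<theta>. f (of_real t * cis \<theta>) * (of_real t * cis \<theta>) ^ (n - 1) * of_real t * \<i> * cis \<theta>) has_integral 0) {0..2*pi}"
      by (simp add: circlepath_def has_contour_integral_part_circlepath_iff)
    from has_integral_mult_right[OF this, of "1 / (of_real t ^ n * \<i>)"]
    show ?thesis
    proof (rule has_integral_eq_rhs[OF has_integral_eq[rotated]])
      fix \<theta> :: real
      have "(of_real t * cis \<theta>) ^ (n - 1) * of_real t * cis \<theta> = (of_real t * cis \<theta>) ^ n"
        using n by (simp add: power_eq_if mult_ac)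
      then have eq: "f (of_real t * cis \<theta>) * (of_real t * cis \<theta>) ^ (n - 1) * of_real t * \<i> * cis \<theta>
          = \<i> * of_real t ^ n * (f (of_real t * cis \<theta>) * cis \<theta> ^ n)"
        by (simp add: power_mult_distrib mult_ac)
      show "1 / (of_real t ^ n * \<i>) * (f (of_real t * cis \<theta>) * (of_real t * cis \<theta>) ^ (n - 1) * of_real t * \<i> * cis \<theta>)
          = f (of_real t * cis \<theta>) * cis (real n * \<theta>)"
        unfolding eq using t by (simp add: Complex.DeMoivre)
    qed simp
  qed
  show "((\<lambda>\<theta>. Re (f (of_real t * cis \<theta>))) has_integral 2 * pi * Re (f 0)) {0..2*pi}"
    using has_integral_Re[OF A[of 0]] by simp
  show "((\<lambda>\<theta>. of_real (Re (f (of_real t * cis \<theta>))) * cis (real n * \<theta>)) has_integral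
      of_real pi * cnj ((deriv ^^ n) f 0 / fact n) * of_real t ^ n) {0..2*pi}" if n: "0 < n"
  proof -
    have "((\<lambda>\<theta>. cnj (f (of_real t * cis \<theta>) * cis (- (real n * \<theta>)))) has_integral
        cnj (2 * of_real pi * ((deriv ^^ n) f 0 / fact n) * of_real t ^ n)) {0..2*pi}"
      using has_integral_linear[OF A[of n] bounded_linear_cnj] by (simp only: o_def)
    from has_integral_divide[OF has_integral_add[OF this B[OF n]], of 2]
    show ?thesis
    proof (rule has_integral_eq_rhs[OF has_integral_eq[rotated]])
      fix \<theta> :: real
      have re: "complex_of_real (Re w) = (w + cnj w) / 2" for w by (simp add: complex_add_cnj)
      show "(cnj (f (of_real t * cis \<theta>) * cis (- (real n * \<theta>))) + f (of_real t * cis \<theta>) * cis (real n * \<theta>)) / 2 =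
          of_real (Re (f (of_real t * cis \<theta>))) * cis (real n * \<theta>)"
        unfolding re complex_cnj_mult cis_cnj minus_minus by (simp add: field_simps)
    qed simp
  qed
qed

lemma powser_eq_deriv:
  assumes r: "0 < r" and f: "f holomorphic_on ball 0 r"
    and c: "\<And>z. z \<in> ball 0 r \<Longrightarrow> (\<lambda>n. c n * z ^ n) sums f z"
  shows "(deriv ^^ n) f 0 / fact n = c n"
proof -
  have ev: "\<forall>\<^sub>F z in nhds 0. z \<in> ball (0::complex) r" using r by (intro eventually_nhds_in_open) auto
  have "f has_fps_expansion Abs_fps c"
    by (rule has_fps_expansionI) (use eventually_mono[OF ev c] in simp)
  moreover have "f has_fps_expansion Abs_fps (\<lambda>n. (deriv ^^ n) f 0 / fact n)"
    by (rule has_fps_expansionI) (use eventually_mono[OF ev] holomorphic_power_series[OF f] in simp)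
  ultimately have "Abs_fps c = Abs_fps (\<lambda>n. (deriv ^^ n) f 0 / fact n)"
    by (rule fps_expansion_unique_complex)
  then show ?thesis by (metis fps_nth_Abs_fps)
qed

text \<open>
  The fundamental solution of \<open>k'' - n\<^sup>2 k = \<delta>\<close> that vanishes at \<open>-\<infinity>\<close>: in the variable \<open>ln |z|\<close>, the Laplace operator
  acts on the \<open>n\<close>-th Fourier mode as \<open>k \<mapsto> k'' - n\<^sup>2 k\<close>.
\<close>

definition log_green :: "nat \<Rightarrow> real \<Rightarrow> real" where
  "log_green n y = (if n = 0 then max y 0 else - (exp (- real n * \<bar>y\<bar>) / (2 * real n)))"

text \<open>For a zero outside the circle the logarithm of the factor is the real part of a power
  series. A zero inside is first reflected in the circle.\<close>

lemma circle_fourier_factor: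
  assumes a: "a \<noteq> 0" and t: "0 < t" "t \<noteq> cmod a"
  shows "((\<lambda>\<theta>. of_real (ln (cmod (1 - of_real t * cis \<theta> / a))) * cis (real n * \<theta>)) has_integral
    2 * of_real pi * sgn a ^ n * of_real (log_green n (ln t - ln (cmod a)))) {0..2*pi}"
proof -
  have inner: "((\<lambda>\<theta>. of_real (ln (cmod (1 - of_real t * cis \<theta> / b))) * cis (real n * \<theta>)) has_integral
    2 * of_real pi * sgn b ^ n * of_real (log_green n (ln t - ln (cmod b)))) {0..2*pi}"
    if b: "t < cmod b" for b
  proof -
    have b0: "b \<noteq> 0" "0 < cmod b" using b t by auto
    let ?f = "\<lambda>z. Ln (1 - z / b)"
    have slit: "1 - z / b \<notin> \<real>\<^sub>\<le>\<^sub>0" if "z \<in> ball 0 (cmod b)" for z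
    proof -
      have "cmod (z / b) < 1" using that b0 by (simp add: norm_divide)
      then have "Re (z / b) < 1" using complex_Re_le_cmod[of "z / b"] by simp
      then show ?thesis by (auto simp: complex_nonpos_Reals_iff)
    qed
    have hol: "?f holomorphic_on ball 0 (cmod b)"
      using slit b0 by (intro holomorphic_intros) auto
    have ReL: "Re (?f (of_real t * cis \<theta>)) = ln (cmod (1 - of_real t * cis \<theta> / b))" for \<theta>
    proof (rule Re_Ln)
      have "of_real t * cis \<theta> \<in> ball 0 (cmod b)" using b t by (simp add: norm_mult)
      then show "1 - of_real t * cis \<theta> / b \<noteq> 0" using slit by force
    qed
    show ?thesis
    proof (cases "n = 0")
      case True
      have "((\<lambda>\<theta>. Re (?f (of_real t * cis \<theta>))) has_integral 0) {0..2*pi}"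
        using circle_fourier_Re(1)[OF hol t(1) b] by simp
      from has_integral_linear[OF this bounded_linear_of_real[where 'a = complex]]
      have "((\<lambda>\<theta>. complex_of_real (ln (cmod (1 - of_real t * cis \<theta> / b)))) has_integral 0) {0..2*pi}"
        by (simp add: ReL o_def)
      moreover have "max (ln t - ln (cmod b)) 0 = 0" using b t b0 by (simp add: max_def)
      ultimately show ?thesis using True by (simp add: log_green_def)
    next
      case False
      have c: "(deriv ^^ n) ?f 0 / fact n = - (1 / (of_nat n * b ^ n))"
      proof (rule powser_eq_deriv[OF b0(2) hol])
        fix z :: complex assume "z \<in> ball 0 (cmod b)"
        then have "cmod (- (z / b)) < 1" using b0 by (simp add: norm_divide)
        from Ln_series[OF this]
        have "(\<lambda>n. (- 1) ^ Suc n / of_nat n * (- (z / b)) ^ n) sums ?f z" by simp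
        moreover have "(- 1) ^ Suc n / of_nat n * (- (z / b)) ^ n = - (1 / (of_nat n * b ^ n)) * z ^ n" for n
          by (simp add: power_minus[of "z / b"] power_divide)
        ultimately show "(\<lambda>n. - (1 / (of_nat n * b ^ n)) * z ^ n) sums ?f z" by simp
      qed
      have cb: "1 / cnj b = sgn b / of_real (cmod b)"
      proof -
        have "b * cnj b = of_real (cmod b) * of_real (cmod b)" using complex_norm_square[of b] by (simp add: power2_eq_square)
        then show ?thesis using b0 by (simp add: sgn_eq divide_simps)
      qed
      have e: "exp (- real n * \<bar>ln t - ln (cmod b)\<bar>) = (t / cmod b) ^ n"
      proof -
        have "ln t - ln (cmod b) < 0" using t b b0 by simp
        then have "- real n * \<bar>ln t - ln (cmod b)\<bar> = real n * ln (t / cmod b)"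
          using t b0 by (simp add: ln_div algebra_simps)
        then show ?thesis using t b0 by (simp add: exp_of_nat_mult)
      qed
      have "of_real pi * cnj (- (1 / (of_nat n * b ^ n))) * of_real t ^ n =
          - (of_real pi / of_nat n * (1 / cnj b) ^ n * of_real t ^ n)"
        by (simp add: power_divide)
      also have "\<dots> = 2 * of_real pi * sgn b ^ n * of_real (log_green n (ln t - ln (cmod b)))"
        unfolding cb log_green_def e using False by (simp add: power_divide mult_ac)
      finally show ?thesis
        using circle_fourier_Re(2)[OF hol t(1) b, of n] False unfolding c ReL by simp
    qed
  qed
  show ?thesis
  proof (cases "t < cmod a")
    case True then show ?thesis by (rule inner)
  next
    case False
    then have ta: "cmod a < t" using t by simp
    have na: "0 < cmod a" using a by simp
    \<comment> \<open>The reflection of \<open>a\<close> in the circle of radius \<open>t\<close>.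
      On this circle the two factors differ in modulus by the constant \<open>t / cmod a\<close>,
      which contributes to mode 0 only.\<close>
    define b where "b = of_real (t\<^sup>2) / cnj a"
    have nb: "cmod b = t\<^sup>2 / cmod a" by (simp add: b_def norm_divide norm_power)
    have tb: "t < cmod b" using ta na t unfolding nb by (simp add: power2_eq_square pos_less_divide_eq)
    have aa: "a * cnj a = of_real (cmod a) * of_real (cmod a)" using complex_norm_square[of a] by (simp add: power2_eq_square)
    have sb: "sgn b = sgn a"
      unfolding sgn_eq nb using na t aa by (simp add: b_def divide_simps)
    have lb: "ln t - ln (cmod b) = - (ln t - ln (cmod a))"
      unfolding nb using t na by (simp add: ln_div ln_mult power2_eq_square)
    have split: "ln (cmod (1 - of_real t * cis \<theta> / a)) = (ln t - ln (cmod a)) + ln (cmod (1 - of_real t * cis \<theta> / b))" for \<theta>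
    proof -
      have n1: "cmod (of_real t * cis \<theta>) = t" using t by (simp add: norm_mult)
      have "1 - of_real t * cis \<theta> / b = 1 - cis \<theta> * cnj a / of_real t"
        using t a by (simp add: b_def power2_eq_square)
      also have "\<dots> = cnj (1 - cis (- \<theta>) * a / of_real t)" by (simp add: cis_cnj)
      finally have "cmod (1 - of_real t * cis \<theta> / b) = cmod (1 - cis (- \<theta>) * a / of_real t)"
        by (simp only: complex_mod_cnj)
      moreover have "1 - of_real t * cis \<theta> / a = - (of_real t * cis \<theta> / a) * (1 - cis (- \<theta>) * a / of_real t)"
        using t a by (simp add: algebra_simps cis_mult)
      then have "cmod (1 - of_real t * cis \<theta> / a) = t / cmod a * cmod (1 - cis (- \<theta>) * a / of_real t)"
        using n1 by (simp only: norm_mult norm_minus_cancel norm_divide)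
      moreover have "1 - of_real t * cis \<theta> / a \<noteq> 0"
      proof
        assume "1 - of_real t * cis \<theta> / a = 0"
        then have "of_real t * cis \<theta> = a" using a by (simp add: field_simps)
        then show False using n1 t by simp
      qed
      ultimately show ?thesis using t na by (auto simp: ln_mult ln_div)
    qed
    have cis0: "((\<lambda>\<theta>. of_real (ln t - ln (cmod a)) * cis (real n * \<theta>)) has_integral
        (if n = 0 then 2 * of_real pi * of_real (ln t - ln (cmod a)) else 0)) {0..2*pi}"
    proof (cases "n = 0")
      case True
      then show ?thesis using has_integral_const_real[of "complex_of_real (ln t - ln (cmod a))" 0 "2*pi"]
        by (simp add: scaleR_conv_of_real)
    next
      case False
      have "((\<lambda>\<theta>. cis (real n * \<theta>)) has_integral (cis (real n * (2*pi)) / (\<i> * of_nat n) - cis (real n * 0) / (\<i> * of_nat n))) {0..2*pi}"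
      proof (rule fundamental_theorem_of_calculus)
        fix x
        have "((\<lambda>z. exp (\<i> * of_nat n * z) / (\<i> * of_nat n)) has_field_derivative exp (\<i> * of_nat n * of_real x)) (at (of_real x))"
          using False by (auto intro!: derivative_eq_intros)
        from has_vector_derivative_real_field[OF this]
        show "((\<lambda>\<theta>. cis (real n * \<theta>) / (\<i> * of_nat n)) has_vector_derivative cis (real n * x)) (at x within {0..2*pi})"
          by (simp add: cis_conv_exp mult.assoc)
      qed simp
      moreover have "cis (real n * (2*pi)) = 1" using cis_multiple_2pi[of "real n"] by (simp add: mult_ac)
      ultimately have "((\<lambda>\<theta>. cis (real n * \<theta>)) has_integral 0) {0..2*pi}" by simp
      from has_integral_mult_right[OF this] show ?thesis using False by simp
    qed
    have "((\<lambda>\<theta>. of_real (ln (cmod (1 - of_real t * cis \<theta> / a))) * cis (real n * \<theta>)) has_integral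
      (if n = 0 then 2 * of_real pi * of_real (ln t - ln (cmod a)) else 0) +
      2 * of_real pi * sgn a ^ n * of_real (log_green n (- (ln t - ln (cmod a))))) {0..2*pi}"
      using has_integral_add[OF cis0 inner[OF tb]] unfolding sb lb split by (simp add: distrib_right)
    moreover have "0 < ln t - ln (cmod a)" using ta na t by simp
    ultimately show ?thesis by (auto simp: log_green_def split: if_splits)
  qed
qed

text \<open>Green's identity in one variable. All boundary terms at \<alpha> and \<beta> vanish;
  only the jump of the derivative of \<open>log_green\<close> at \<open>b\<close> contributes. The
  second claim removes the unknown harmonic part of each Fourier coefficient.\<close>

lemma log_green_integral:
  assumes \<psi>: "\<And>x. (\<psi> has_real_derivative \<psi>1 x) (at x)" "\<And>x. (\<psi>1 has_real_derivative \<psi>2 x) (at x)"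
    and ends: "\<psi> \<alpha> = 0" "\<psi> \<beta> = 0" "\<psi>1 \<alpha> = 0" "\<psi>1 \<beta> = 0" and ab: "\<alpha> \<le> \<beta>"
  shows "((\<lambda>x. log_green n (x - b) * (\<psi>2 x - (real n)\<^sup>2 * \<psi> x)) has_integral
    (if b \<in> {\<alpha>..\<beta>} then \<psi> b else 0)) {\<alpha>..\<beta>}"
    and "((\<lambda>x. exp (real n * x) * (\<psi>2 x - (real n)\<^sup>2 * \<psi> x)) has_integral 0) {\<alpha>..\<beta>}"
proof -
  have W: "((\<lambda>x. k x * (\<psi>2 x - (real n)\<^sup>2 * \<psi> x)) has_integral
      (k q * \<psi>1 q - k1 q * \<psi> q) - (k p * \<psi>1 p - k1 p * \<psi> p)) {p..q}"
    if pq: "p \<le> q" and k: "\<And>x. (k has_real_derivative k1 x) (at x)"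
      "\<And>x. (k1 has_real_derivative (real n)\<^sup>2 * k x) (at x)" for p q and k k1 :: "real \<Rightarrow> real"
  proof (rule fundamental_theorem_of_calculus[OF pq])
    fix x
    have "((\<lambda>x. k x * \<psi>1 x - k1 x * \<psi> x) has_real_derivative k x * (\<psi>2 x - (real n)\<^sup>2 * \<psi> x)) (at x)"
      by (rule derivative_eq_intros k \<psi> refl)+ (simp add: algebra_simps)
    then show "((\<lambda>x. k x * \<psi>1 x - k1 x * \<psi> x) has_vector_derivative k x * (\<psi>2 x - (real n)\<^sup>2 * \<psi> x)) (at x within {p..q})"
      by (simp add: has_real_derivative_iff_has_vector_derivative has_vector_derivative_at_within)
  qed
  show "((\<lambda>x. exp (real n * x) * (\<psi>2 x - (real n)\<^sup>2 * \<psi> x)) has_integral 0) {\<alpha>..\<beta>}"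
  proof -
    have "((\<lambda>x. exp (real n * x)) has_real_derivative real n * exp (real n * x)) (at x)"
      "((\<lambda>x. real n * exp (real n * x)) has_real_derivative (real n)\<^sup>2 * exp (real n * x)) (at x)" for x
      by (auto intro!: derivative_eq_intros simp: power2_eq_square)
    from W[OF ab this] show ?thesis using ends by simp
  qed
  \<comment> \<open>\<open>kp\<close> and \<open>km\<close> continue the right and left branches
    smoothly across \<open>b\<close>. Their values at \<open>b\<close> agree and their derivatives
    there differ by 1, which leaves \<open>\<psi> b\<close>.\<close>
  define kp kp1 where "kp = (\<lambda>x. if n = 0 then x - b else - (exp (- real n * (x - b)) / (2 * real n)))"
    and "kp1 = (\<lambda>x. if n = 0 then 1 else exp (- real n * (x - b)) / 2)"
  define km km1 where "km = (\<lambda>x. if n = 0 then 0 else - (exp (real n * (x - b)) / (2 * real n)))"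
    and "km1 = (\<lambda>x. if n = 0 then 0 else - exp (real n * (x - b)) / 2)"
  have dp: "(kp has_real_derivative kp1 x) (at x)" "(kp1 has_real_derivative (real n)\<^sup>2 * kp x) (at x)" for x
    unfolding kp_def kp1_def by (cases "n = 0"; auto intro!: derivative_eq_intros simp: power2_eq_square)+
  have dm: "(km has_real_derivative km1 x) (at x)" "(km1 has_real_derivative (real n)\<^sup>2 * km x) (at x)" for x
    unfolding km_def km1_def by (cases "n = 0"; auto intro!: derivative_eq_intros simp: power2_eq_square)+
  have gp: "log_green n (x - b) = kp x" if "b \<le> x" for x using that by (simp add: log_green_def kp_def)
  have gm: "log_green n (x - b) = km x" if "x \<le> b" for x
    using that by (simp add: log_green_def km_def algebra_simps)
  let ?G = "\<lambda>x. log_green n (x - b) * (\<psi>2 x - (real n)\<^sup>2 * \<psi> x)"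
  consider "b < \<alpha>" | "\<beta> < b" | "\<alpha> \<le> b" "b \<le> \<beta>" by linarith
  then show "(?G has_integral (if b \<in> {\<alpha>..\<beta>} then \<psi> b else 0)) {\<alpha>..\<beta>}"
  proof cases
    case 1
    show ?thesis
      by (rule has_integral_eq_rhs[OF has_integral_eq[OF _ W[OF ab dp]]]) (use 1 ends gp in auto)
  next
    case 2
    show ?thesis
      by (rule has_integral_eq_rhs[OF has_integral_eq[OF _ W[OF ab dm]]]) (use 2 ends gm in auto)
  next
    case 3
    have "(?G has_integral (km b * \<psi>1 b - km1 b * \<psi> b)) {\<alpha>..b}"
      by (rule has_integral_eq_rhs[OF has_integral_eq[OF _ W[OF 3(1) dm]]]) (use ends gm in auto)
    moreover have "(?G has_integral - (kp b * \<psi>1 b - kp1 b * \<psi> b)) {b..\<beta>}"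
      by (rule has_integral_eq_rhs[OF has_integral_eq[OF _ W[OF 3(2) dp]]]) (use ends gp in auto)
    ultimately have "(?G has_integral (km b * \<psi>1 b - km1 b * \<psi> b) + - (kp b * \<psi>1 b - kp1 b * \<psi> b)) {\<alpha>..\<beta>}"
      by (rule has_integral_combine[OF 3])
    then show ?thesis by (rule has_integral_eq_rhs) (use 3 in \<open>auto simp: kp_def kp1_def km_def km1_def algebra_simps\<close>)
  qed
qed

section \<open>Zeros of an entire function\<close>

text \<open>A substitute on one disc for the canonical product. Factors \<open>1 - z / a\<close> and
  the normalization \<open>g 0 = 0\<close> put \<open>F 0\<close> in front, so that mode 0 is
  Jensen's formula with constant \<open>ln (cmod (F 0))\<close>.\<close>

definition factored :: "(complex \<Rightarrow> complex) \<Rightarrow> real \<Rightarrow> complex set \<Rightarrow> (complex \<Rightarrow> nat) \<Rightarrow> bool" where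
  "factored F \<rho> A m \<longleftrightarrow> finite A \<and> 0 \<notin> A \<and>
     (\<exists>g. g holomorphic_on ball 0 \<rho> \<and> g 0 = 0 \<and>
        (\<forall>z\<in>ball 0 \<rho>. F z = F 0 * (\<Prod>a\<in>A. (1 - z / a) ^ m a) * exp (g z)))"

lemma entire_factor_out:
  assumes F: "F holomorphic_on UNIV" and nz: "\<exists>z. F z \<noteq> (0::complex)"
  obtains k G where "G holomorphic_on UNIV" "G a \<noteq> 0" "\<And>z. F z = (z - a) ^ k * G z"
proof (cases "F a = 0")
  case False
  then show thesis using that[of F 0] F by auto
next
  case True
  obtain w where w: "F w \<noteq> 0" using nz by blast
  then have "\<not> F constant_on UNIV" using True by (metis UNIV_I constant_on_def)
  from holomorphic_factor_zero_nonconstant[OF F open_UNIV connected_UNIV UNIV_I True this]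
  obtain g r n where g: "0 < n" "0 < r" "g holomorphic_on ball a r"
    "\<And>w. w \<in> ball a r \<Longrightarrow> F w = (w - a) ^ n * g w" "\<And>w. w \<in> ball a r \<Longrightarrow> g w \<noteq> 0"
    by metis
  define G where "G z = (if z = a then g a else F z / (z - a) ^ n)" for z
  have Gg: "G z = g z" if "z \<in> ball a r" for z using g(4)[OF that] by (auto simp: G_def)
  have 1: "G holomorphic_on ball a r" by (rule holomorphic_transform[OF g(3)]) (simp add: Gg)
  have "(\<lambda>z. F z / (z - a) ^ n) holomorphic_on (- {a})"
    by (intro holomorphic_intros holomorphic_on_subset[OF F]) auto
  then have 2: "G holomorphic_on (- {a})" by (rule holomorphic_transform) (auto simp: G_def)
  have "ball a r \<union> - {a} = UNIV" using g(2) by auto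
  then have "G holomorphic_on UNIV"
    using holomorphic_on_Un[OF 1 2] by (simp add: open_Compl)
  moreover have "G a \<noteq> 0" using g by (simp add: G_def)
  moreover have "F z = (z - a) ^ n * G z" for z using True g(1) by (auto simp: G_def)
  ultimately show thesis by (rule that)
qed

lemma entire_factor_out_finite:
  assumes "finite A" and F: "F holomorphic_on UNIV" and nz: "\<exists>z. F z \<noteq> (0::complex)"
  shows "\<exists>m G. G holomorphic_on UNIV \<and> (\<forall>a\<in>A. G a \<noteq> 0) \<and> (\<forall>z. F z = (\<Prod>a\<in>A. (z - a) ^ m a) * G z)"
  using assms(1)
proof induction
  case empty
  then show ?case using F by auto
next
  case (insert b A)
  then obtain m G where G: "G holomorphic_on UNIV" "\<forall>a\<in>A. G a \<noteq> 0" "\<forall>z. F z = (\<Prod>a\<in>A. (z - a) ^ m a) * G z"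
    by blast
  have "\<exists>z. G z \<noteq> 0" using nz G(3) by (metis mult_zero_right)
  from entire_factor_out[OF G(1) this, of b] obtain k H where
    H: "H holomorphic_on UNIV" "H b \<noteq> 0" "\<And>z. G z = (z - b) ^ k * H z" by metis
  have "\<forall>a\<in>insert b A. H a \<noteq> 0" using H G(2) by auto
  moreover have "F z = (\<Prod>a\<in>insert b A. (z - a) ^ (m(b := k)) a) * H z" for z
  proof -
    have "(\<Prod>a\<in>A. (z - a) ^ (m(b := k)) a) = (\<Prod>a\<in>A. (z - a) ^ m a)"
      using insert(2) by (intro prod.cong) auto
    then show ?thesis using insert(1,2) G(3) H(3) by simp
  qed
  ultimately show ?case using H(1) by blast
qed

text \<open>Only finitely many zeros lie in the closed disc; after their removal the quotient has no
  zero in the open disc and therefore has a holomorphic logarithm \<open>h\<close>, normalized by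
  subtracting \<open>h 0\<close>.\<close>

lemma factored_exists:
  assumes F: "F holomorphic_on UNIV" and F0: "F 0 \<noteq> (0::complex)" and \<rho>: "0 < \<rho>"
  shows "\<exists>A m. factored F \<rho> A m"
proof -
  define A where "A = {z \<in> cball 0 \<rho>. F z = 0}"
  have fA: "finite A"
  proof (cases "A = {}")
    case False
    then obtain z where "F z = 0" by (auto simp: A_def)
    then have "\<not> F constant_on UNIV" using F0 by (metis UNIV_I constant_on_def)
    then show ?thesis
      unfolding A_def by (intro holomorphic_compact_finite_zeros[OF F]) auto
  qed simp
  obtain m G where G: "G holomorphic_on UNIV" "\<And>a. a \<in> A \<Longrightarrow> G a \<noteq> 0" "\<And>z. F z = (\<Prod>a\<in>A. (z - a) ^ m a) * G z"
    using entire_factor_out_finite[OF fA F] F0 by blast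
  have A0: "0 \<notin> A" using F0 by (simp add: A_def)
  have Gnz: "G z \<noteq> 0" if "z \<in> ball 0 \<rho>" for z
  proof (cases "z \<in> A")
    case False
    then have "F z \<noteq> 0" using that by (auto simp: A_def)
    then show ?thesis using G(3)[of z] by auto
  qed (use G in auto)
  obtain h where h: "h holomorphic_on ball 0 \<rho>" "\<And>z. z \<in> ball 0 \<rho> \<Longrightarrow> G z = exp (h z)"
    using contractible_imp_holomorphic_log[OF holomorphic_on_subset[OF G(1)] _ Gnz, of "ball 0 \<rho>"]
    by (metis subset_UNIV convex_imp_contractible convex_ball)
  show ?thesis
  proof (intro exI[of _ A] exI[of _ m], unfold factored_def, intro conjI exI[of _ "\<lambda>z. h z - h 0"] ballI fA A0)
    fix z :: complex assume z: "z \<in> ball 0 \<rho>"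
    have "(\<Prod>a\<in>A. (z - a) ^ m a) = (\<Prod>a\<in>A. (0 - a) ^ m a) * (\<Prod>a\<in>A. (1 - z / a) ^ m a)"
      unfolding prod.distrib[symmetric]
    proof (intro prod.cong refl)
      fix a assume "a \<in> A"
      then have "z - a = (0 - a) * (1 - z / a)" using A0 by (auto simp: field_simps)
      then show "(z - a) ^ m a = (0 - a) ^ m a * (1 - z / a) ^ m a" by (simp only: power_mult_distrib)
    qed
    then show "F z = F 0 * (\<Prod>a\<in>A. (1 - z / a) ^ m a) * exp (h z - h 0)"
      using G(3)[of z] G(3)[of 0] h(2)[OF z] h(2)[of 0] \<rho> by (simp add: exp_diff)
  qed (auto intro!: holomorphic_intros h)
qed

text \<open>Near \<open>a\<close> the function is \<open>(z - a) ^ m a\<close> times a continuous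
  \<open>R\<close> with \<open>R a \<noteq> 0\<close>. If \<open>k\<close> exceeded
  \<open>m a\<close>, then \<open>R\<close> would keep a factor \<open>z - a\<close> and tend to 0.
  This transfers multiplicities of \<open>Z\<close> to the finite factorization.\<close>

lemma factored_multiplicity:
  assumes fac: "factored F \<rho> A m" and F0: "F 0 \<noteq> 0" and a: "a \<in> ball 0 \<rho>"
    and H: "isCont H a" "\<And>z. F z = (z - a) ^ k * H z" and k: "0 < k"
  shows "a \<in> A \<and> k \<le> m a"
proof -
  obtain g where A: "finite A" "0 \<notin> A" and g: "g holomorphic_on ball 0 \<rho>"
    "\<And>z. z \<in> ball 0 \<rho> \<Longrightarrow> F z = F 0 * (\<Prod>a\<in>A. (1 - z / a) ^ m a) * exp (g z)"
    using fac by (auto simp: factored_def)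
  have "F a = 0" using H(2)[of a] k by simp
  then have "(\<Prod>b\<in>A. (1 - a / b) ^ m b) = 0" using g(2)[OF a] F0 by simp
  then obtain b where "b \<in> A" "(1 - a / b) ^ m b = 0" using A(1) by auto
  then have aA: "a \<in> A" using A(2) by (auto simp: divide_simps split: if_splits)
  have a0: "a \<noteq> 0" using aA A(2) by auto
  define R where "R z = F 0 * (- 1 / a) ^ m a * (\<Prod>b\<in>A - {a}. (1 - z / b) ^ m b) * exp (g z)" for z
  have FR: "F z = (z - a) ^ m a * R z" if "z \<in> ball 0 \<rho>" for z
  proof -
    have "1 - z / a = (- 1 / a) * (z - a)" using a0 by (simp add: field_simps)
    then have "(1 - z / a) ^ m a = (- 1 / a) ^ m a * (z - a) ^ m a" by (simp only: power_mult_distrib)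
    then show ?thesis
      unfolding g(2)[OF that] R_def using prod.remove[OF A(1) aA, of "\<lambda>b. (1 - z / b) ^ m b"] by simp
  qed
  have gc: "isCont g a" using holomorphic_on_imp_continuous_on[OF g(1)] a by (simp add: continuous_on_eq_continuous_at)
  have Rc: "isCont R a" unfolding R_def using A by (intro continuous_intros gc) auto
  have Ra: "R a \<noteq> 0"
  proof -
    have "1 - a / b \<noteq> 0" if "b \<in> A - {a}" for b using that A(2) by (auto simp: divide_simps split: if_splits)
    then show ?thesis using F0 a0 A(1) by (auto simp: R_def)
  qed
  have "k \<le> m a"
  proof (rule ccontr)
    assume "\<not> k \<le> m a"
    then obtain j where j: "k = m a + Suc j" using less_imp_Suc_add by (metis not_le add_Suc_right)
    have "\<forall>\<^sub>F z in at a. z \<in> ball 0 \<rho>" using a by (intro eventually_at_in_open') auto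
    then have "\<forall>\<^sub>F z in at a. R z = (z - a) ^ Suc j * H z"
    proof (rule eventually_elim2[OF _ eventually_neq_at_within])
      fix z :: complex assume z: "z \<in> ball 0 \<rho>" "z \<noteq> a"
      have "(z - a) ^ m a * R z = (z - a) ^ m a * ((z - a) ^ Suc j * H z)"
        using FR[OF z(1)] H(2)[of z] unfolding j power_add by (simp only: mult.assoc)
      then show "R z = (z - a) ^ Suc j * H z"
        using z(2) by (simp only: mult_cancel_left power_eq_0_iff) simp
    qed
    moreover have "((\<lambda>z. (z - a) ^ Suc j * H z) \<longlongrightarrow> (a - a) ^ Suc j * H a) (at a)"
      using H(1) by (intro tendsto_intros) (simp add: isCont_def)
    ultimately have "(R \<longlongrightarrow> 0) (at a)"
      using tendsto_cong[of R "\<lambda>z. (z - a) ^ Suc j * H z" "at a" 0] by simp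
    then show False using Rc Ra tendsto_unique[of "at a" R "R a" 0] by (simp add: isCont_def)
  qed
  with aA show ?thesis by simp
qed

definition log_mod :: "(complex \<Rightarrow> complex) \<Rightarrow> real \<Rightarrow> real \<Rightarrow> real" where
  "log_mod F x \<theta> = ln (cmod (F (of_real (exp x) * cis \<theta>)))"

text \<open>Each zero contributes \<open>log_green\<close> in mode \<open>n\<close>; the factor
  without zeros has a harmonic logarithm and contributes a multiple of \<open>exp (n * x)\<close>.
  The coefficients \<open>c n\<close> with \<open>n > 0\<close> remain unspecified because they
  cancel against the test functions used later.\<close>

lemma factored_fourier:
  assumes fac: "factored F \<rho> A m" and F0: "F 0 \<noteq> 0"
  obtains c :: "nat \<Rightarrow> complex" where "c 0 = of_real (ln (cmod (F 0)))"
    "\<And>n x. exp x < \<rho> \<Longrightarrow> exp x \<notin> cmod ` A \<Longrightarrow>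
      ((\<lambda>\<theta>. of_real (log_mod F x \<theta>) * cis (real n * \<theta>)) has_integral
        2 * of_real pi * ((\<Sum>a\<in>A. of_nat (m a) * sgn a ^ n * of_real (log_green n (x - ln (cmod a))))
          + c n * of_real (exp (real n * x)))) {0..2*pi}"
proof -
  obtain g where A: "finite A" "0 \<notin> A" and g: "g holomorphic_on ball 0 \<rho>" "g 0 = 0"
    "\<And>z. z \<in> ball 0 \<rho> \<Longrightarrow> F z = F 0 * (\<Prod>a\<in>A. (1 - z / a) ^ m a) * exp (g z)"
    using fac by (auto simp: factored_def)
  define f where "f z = Ln (F 0) + g z" for z
  have f: "f holomorphic_on ball 0 \<rho>" unfolding f_def by (intro holomorphic_intros g)
  \<comment> \<open>The half reflects that a real part has Fourier integral with factor
    \<open>pi\<close> for \<open>n > 0\<close> but \<open>2 * pi\<close> for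
    \<open>n = 0\<close>.\<close>
  define c where "c n = (if n = 0 then of_real (ln (cmod (F 0))) else cnj ((deriv ^^ n) f 0 / fact n) / 2)" for n
  show thesis
  proof (rule that[of c])
    show "c 0 = of_real (ln (cmod (F 0)))" by (simp add: c_def)
    fix n x assume x: "exp x < \<rho>" "exp x \<notin> cmod ` A"
    have tf: "((\<lambda>\<theta>. of_real (Re (f (of_real (exp x) * cis \<theta>))) * cis (real n * \<theta>)) has_integral
        2 * of_real pi * (c n * of_real (exp (real n * x)))) {0..2*pi}"
    proof (cases "n = 0")
      case True
      have "((\<lambda>\<theta>. Re (f (of_real (exp x) * cis \<theta>))) has_integral 2 * pi * ln (cmod (F 0))) {0..2*pi}"
        using circle_fourier_Re(1)[OF f exp_gt_zero x(1)] g(2) F0 by (simp add: f_def)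
      from has_integral_linear[OF this bounded_linear_of_real[where 'a = complex]]
      show ?thesis using True by (simp add: o_def c_def)
    next
      case False
      then have "0 < n" by simp
      have e: "complex_of_real (exp x) ^ n = of_real (exp (real n * x))"
        by (simp only: of_real_power[symmetric] exp_of_nat_mult)
      have "of_real pi * cnj ((deriv ^^ n) f 0 / fact n) * complex_of_real (exp x) ^ n =
          2 * of_real pi * (c n * of_real (exp (real n * x)))"
        unfolding e using False by (simp add: c_def)
      then show ?thesis using circle_fourier_Re(2)[OF f exp_gt_zero x(1) \<open>0 < n\<close>] by (simp only:)
    qed
    have ta: "((\<lambda>\<theta>. of_nat (m a) * (of_real (ln (cmod (1 - of_real (exp x) * cis \<theta> / a))) * cis (real n * \<theta>))) has_integral
        of_nat (m a) * (2 * of_real pi * sgn a ^ n * of_real (log_green n (x - ln (cmod a))))) {0..2*pi}"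
      if "a \<in> A" for a
      using circle_fourier_factor[of a "exp x" n] that x A(2) by (intro has_integral_mult_right) (auto simp: image_iff)
    have dec: "log_mod F x \<theta> = (\<Sum>a\<in>A. real (m a) * ln (cmod (1 - of_real (exp x) * cis \<theta> / a))) +
        Re (f (of_real (exp x) * cis \<theta>))" for \<theta>
    proof -
      let ?z = "of_real (exp x) * cis \<theta>"
      have cz: "cmod ?z = exp x" by (simp add: norm_mult)
      then have z: "?z \<in> ball 0 \<rho>" using x(1) by simp
      have nz: "cmod (1 - ?z / a) \<noteq> 0" if "a \<in> A" for a
      proof
        assume "cmod (1 - ?z / a) = 0"
        then have "?z = a" using that A(2) by (auto simp: divide_simps split: if_splits)
        then show False using x(2) that cz by (metis imageI)
      qed
      have pz: "0 < cmod (1 - ?z / a)" if "a \<in> A" for a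
        using nz[OF that] norm_ge_zero[of "1 - ?z / a"] by linarith
      have "cmod (F ?z) = cmod (F 0) * (\<Prod>a\<in>A. cmod (1 - ?z / a) ^ m a) * exp (Re (g ?z))"
        unfolding g(3)[OF z] by (simp add: norm_mult norm_power prod_norm[symmetric])
      moreover have "0 < (\<Prod>a\<in>A. cmod (1 - ?z / a) ^ m a)"
        by (intro prod_pos zero_less_power pz)
      ultimately have "ln (cmod (F ?z)) = ln (cmod (F 0)) + ln (\<Prod>a\<in>A. cmod (1 - ?z / a) ^ m a) + Re (g ?z)"
        using F0 by (simp add: ln_mult_pos)
      moreover have "ln (\<Prod>a\<in>A. cmod (1 - ?z / a) ^ m a) = (\<Sum>a\<in>A. real (m a) * ln (cmod (1 - ?z / a)))"
      proof -
        have "ln (\<Prod>a\<in>A. cmod (1 - ?z / a) ^ m a) = (\<Sum>a\<in>A. ln (cmod (1 - ?z / a) ^ m a))"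
          using A(1) pz by (intro ln_prod) (auto intro!: zero_less_power)
        also have "\<dots> = (\<Sum>a\<in>A. real (m a) * ln (cmod (1 - ?z / a)))"
          by (intro sum.cong refl ln_realpow pz)
        finally show ?thesis .
      qed
      ultimately show ?thesis using F0 by (simp add: log_mod_def f_def)
    qed
    have "((\<lambda>\<theta>. (\<Sum>a\<in>A. of_nat (m a) * (of_real (ln (cmod (1 - of_real (exp x) * cis \<theta> / a))) * cis (real n * \<theta>))) +
        of_real (Re (f (of_real (exp x) * cis \<theta>))) * cis (real n * \<theta>)) has_integral
        (\<Sum>a\<in>A. of_nat (m a) * (2 * of_real pi * sgn a ^ n * of_real (log_green n (x - ln (cmod a))))) +
        2 * of_real pi * (c n * of_real (exp (real n * x)))) {0..2*pi}"
      by (intro has_integral_add has_integral_sum A(1) ta tf)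
    moreover have "(\<Sum>a\<in>A. of_nat (m a) * (2 * of_real pi * sgn a ^ n * of_real (log_green n (x - ln (cmod a))))) =
      2 * of_real pi * (\<Sum>a\<in>A. of_nat (m a) * sgn a ^ n * of_real (log_green n (x - ln (cmod a))))"
      by (simp add: sum_distrib_left mult_ac)
    ultimately show "((\<lambda>\<theta>. of_real (log_mod F x \<theta>) * cis (real n * \<theta>)) has_integral
        2 * of_real pi * ((\<Sum>a\<in>A. of_nat (m a) * sgn a ^ n * of_real (log_green n (x - ln (cmod a))))
          + c n * of_real (exp (real n * x)))) {0..2*pi}"
      unfolding dec by (simp add: distrib_left distrib_right sum_distrib_right mult.assoc)
  qed
qed

lemma jensen_formula:
  assumes fac: "factored F \<rho> A m" and F0: "F 0 \<noteq> 0" and x: "exp x < \<rho>" "exp x \<notin> cmod ` A"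
  shows "(log_mod F x has_integral 2 * pi * (ln (cmod (F 0)) + (\<Sum>a\<in>A. real (m a) * max (x - ln (cmod a)) 0))) {0..2*pi}"
proof -
  obtain c :: "nat \<Rightarrow> complex" where c: "c 0 = of_real (ln (cmod (F 0)))"
    "\<And>n x. exp x < \<rho> \<Longrightarrow> exp x \<notin> cmod ` A \<Longrightarrow>
      ((\<lambda>\<theta>. of_real (log_mod F x \<theta>) * cis (real n * \<theta>)) has_integral
        2 * of_real pi * ((\<Sum>a\<in>A. of_nat (m a) * sgn a ^ n * of_real (log_green n (x - ln (cmod a))))
          + c n * of_real (exp (real n * x)))) {0..2*pi}"
    by (rule factored_fourier[OF fac F0]) (rule that)
  from has_integral_Re[OF c(2)[OF x, of 0]] c(1)
  show ?thesis by (simp add: log_green_def add.commute)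
qed

text \<open>\<open>K\<close> and \<open>L\<close> are the means of \<open>ln |F|\<close> against
  \<open>T\<close> and \<open>T2\<close>. In logarithmic polar coordinates the Laplace operator
  turns into \<open>K'' + L\<close>, which is the measure of the zeros weighted by \<open>T\<close>;
  both derivatives are moved to the test function \<psi>. On a single mode
  \<open>L = - n^2 * K\<close>.\<close>

lemma trig_weighted_jensen:
  assumes fac: "factored F \<rho> A m" and F0: "F 0 \<noteq> 0" and T: "trig_poly T T1 T2"
  obtains K L where
    "\<And>x. exp x < \<rho> \<Longrightarrow> exp x \<notin> cmod ` A \<Longrightarrow> ((\<lambda>\<theta>. log_mod F x \<theta> * T \<theta>) has_integral 2 * pi * K x) {0..2*pi}"
    "\<And>x. exp x < \<rho> \<Longrightarrow> exp x \<notin> cmod ` A \<Longrightarrow> ((\<lambda>\<theta>. log_mod F x \<theta> * T2 \<theta>) has_integral 2 * pi * L x) {0..2*pi}"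
    "\<And>\<alpha> \<beta> \<psi> \<psi>1 \<psi>2. \<lbrakk>\<And>x. (\<psi> has_real_derivative \<psi>1 x) (at x); \<And>x. (\<psi>1 has_real_derivative \<psi>2 x) (at x);
       \<psi> \<alpha> = 0; \<psi> \<beta> = 0; \<psi>1 \<alpha> = 0; \<psi>1 \<beta> = 0; \<alpha> \<le> \<beta>\<rbrakk> \<Longrightarrow>
       ((\<lambda>x. K x * \<psi>2 x + L x * \<psi> x) has_integral
         (\<Sum>a\<in>A. real (m a) * T (Arg a) * (if ln (cmod a) \<in> {\<alpha>..\<beta>} then \<psi> (ln (cmod a)) else 0))) {\<alpha>..\<beta>}"
proof -
  obtain c :: "nat \<Rightarrow> complex" where c: "c 0 = of_real (ln (cmod (F 0)))"
    "\<And>n x. exp x < \<rho> \<Longrightarrow> exp x \<notin> cmod ` A \<Longrightarrow>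
      ((\<lambda>\<theta>. of_real (log_mod F x \<theta>) * cis (real n * \<theta>)) has_integral
        2 * of_real pi * ((\<Sum>a\<in>A. of_nat (m a) * sgn a ^ n * of_real (log_green n (x - ln (cmod a))))
          + c n * of_real (exp (real n * x)))) {0..2*pi}"
    by (rule factored_fourier[OF fac F0]) (rule that)
  have A: "finite A" "0 \<notin> A" using fac by (auto simp: factored_def)
  have "\<exists>K L. (\<forall>x. exp x < \<rho> \<longrightarrow> exp x \<notin> cmod ` A \<longrightarrow>
       ((\<lambda>\<theta>. log_mod F x \<theta> * T \<theta>) has_integral 2 * pi * K x) {0..2*pi} \<and>
       ((\<lambda>\<theta>. log_mod F x \<theta> * T2 \<theta>) has_integral 2 * pi * L x) {0..2*pi}) \<and>
     (\<forall>\<alpha> \<beta> \<psi> \<psi>1 \<psi>2. (\<forall>x. (\<psi> has_real_derivative \<psi>1 x) (at x)) \<longrightarrow> (\<forall>x. (\<psi>1 has_real_derivative \<psi>2 x) (at x)) \<longrightarrow>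
       \<psi> \<alpha> = 0 \<longrightarrow> \<psi> \<beta> = 0 \<longrightarrow> \<psi>1 \<alpha> = 0 \<longrightarrow> \<psi>1 \<beta> = 0 \<longrightarrow> \<alpha> \<le> \<beta> \<longrightarrow>
       ((\<lambda>x. K x * \<psi>2 x + L x * \<psi> x) has_integral
         (\<Sum>a\<in>A. real (m a) * T (Arg a) * (if ln (cmod a) \<in> {\<alpha>..\<beta>} then \<psi> (ln (cmod a)) else 0))) {\<alpha>..\<beta>})"
    (is "\<exists>K L. ?P T T2 K L")
    using T
  proof induction
    case (monomial \<tau> n)
    define w where "w a = Re (\<tau> * cis (real n * Arg a))" for a
    \<comment> \<open>Given by a formula for all \<open>x\<close>; it is identified with a mean only
      on circles that avoid the finitely many zeros.\<close>
    define K where "K x = (\<Sum>a\<in>A. real (m a) * w a * log_green n (x - ln (cmod a))) + Re (\<tau> * c n) * exp (real n * x)" for x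
    have 1: "((\<lambda>\<theta>. log_mod F x \<theta> * Re (\<tau> * cis (real n * \<theta>))) has_integral 2 * pi * K x) {0..2*pi}"
      if x: "exp x < \<rho>" "exp x \<notin> cmod ` A" for x
    proof -
      let ?R = "(\<Sum>a\<in>A. of_nat (m a) * sgn a ^ n * of_real (log_green n (x - ln (cmod a)))) + c n * of_real (exp (real n * x))"
      have "((\<lambda>\<theta>. Re (\<tau> * (of_real (log_mod F x \<theta>) * cis (real n * \<theta>)))) has_integral
          Re (\<tau> * (2 * of_real pi * ?R))) {0..2*pi}"
        by (intro has_integral_Re has_integral_mult_right c(2)[OF x])
      moreover have "Re (\<tau> * (of_real u * v)) = u * Re (\<tau> * v)" for u v by (simp add: algebra_simps)
      moreover have "Re (\<tau> * (2 * of_real pi * ?R)) = 2 * pi * K x"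
      proof -
        have sg: "sgn a ^ n = cis (real n * Arg a)" if "a \<in> A" for a
          using that A(2) cis_Arg[of a] by (metis Complex.DeMoivre)
        have 1: "\<tau> * (2 * of_real pi * ?R) = of_real (2 * pi) * ((\<Sum>a\<in>A. of_real (real (m a) * log_green n (x - ln (cmod a))) * (\<tau> * cis (real n * Arg a)))
            + of_real (exp (real n * x)) * (\<tau> * c n))"
          by (simp add: sg sum_distrib_left distrib_left mult_ac cong: sum.cong)
        have rr: "Re (of_real u * v) = u * Re v" for u v by simp
        show ?thesis unfolding 1 rr plus_complex.sel Re_sum K_def w_def by (simp add: mult_ac)
      qed
      ultimately show ?thesis by (simp only:)
    qed
    have 2: "((\<lambda>\<theta>. log_mod F x \<theta> * (- (real n)\<^sup>2 * Re (\<tau> * cis (real n * \<theta>)))) has_integral 2 * pi * (- (real n)\<^sup>2 * K x)) {0..2*pi}"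
      if x: "exp x < \<rho>" "exp x \<notin> cmod ` A" for x
      using has_integral_mult_right[OF 1[OF x], of "- (real n)\<^sup>2"] by (simp only: mult_ac)
    have 3: "((\<lambda>x. K x * \<psi>2 x + - (real n)\<^sup>2 * K x * \<psi> x) has_integral
         (\<Sum>a\<in>A. real (m a) * w a * (if ln (cmod a) \<in> {\<alpha>..\<beta>} then \<psi> (ln (cmod a)) else 0))) {\<alpha>..\<beta>}"
      if \<psi>: "\<And>x. (\<psi> has_real_derivative \<psi>1 x) (at x)" "\<And>x. (\<psi>1 has_real_derivative \<psi>2 x) (at x)"
        "\<psi> \<alpha> = 0" "\<psi> \<beta> = 0" "\<psi>1 \<alpha> = 0" "\<psi>1 \<beta> = 0" "\<alpha> \<le> \<beta>" for \<alpha> \<beta> \<psi> \<psi>1 \<psi>2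
    proof -
      have "((\<lambda>x. (\<Sum>a\<in>A. real (m a) * w a * (log_green n (x - ln (cmod a)) * (\<psi>2 x - (real n)\<^sup>2 * \<psi> x))) +
          Re (\<tau> * c n) * (exp (real n * x) * (\<psi>2 x - (real n)\<^sup>2 * \<psi> x))) has_integral
         (\<Sum>a\<in>A. real (m a) * w a * (if ln (cmod a) \<in> {\<alpha>..\<beta>} then \<psi> (ln (cmod a)) else 0)) + Re (\<tau> * c n) * 0) {\<alpha>..\<beta>}"
        by (intro has_integral_add has_integral_sum has_integral_mult_right A(1) log_green_integral[OF \<psi>])
      moreover have "(\<Sum>a\<in>A. real (m a) * w a * (log_green n (x - ln (cmod a)) * y)) + Re (\<tau> * c n) * (exp (real n * x) * y) = K x * y"
        for x y by (simp add: K_def distrib_right sum_distrib_right mult.assoc)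
      moreover have "K x * (\<psi>2 x - (real n)\<^sup>2 * \<psi> x) = K x * \<psi>2 x + - (real n)\<^sup>2 * K x * \<psi> x" for x
        by (simp add: algebra_simps)
      ultimately show ?thesis by (simp only: mult_zero_right add_0_right)
    qed
    show ?case
    proof (rule exI[of _ K], rule exI[of _ "\<lambda>x. - (real n)\<^sup>2 * K x"], intro conjI allI impI)
      fix \<alpha> \<beta> \<psi> \<psi>1 \<psi>2
      assume \<psi>: "\<forall>x. (\<psi> has_real_derivative \<psi>1 x) (at x)" "\<forall>x. (\<psi>1 has_real_derivative \<psi>2 x) (at x)"
        "\<psi> \<alpha> = 0" "\<psi> \<beta> = 0" "\<psi>1 \<alpha> = 0" "\<psi>1 \<beta> = 0" "\<alpha> \<le> \<beta>"
      show "((\<lambda>x. K x * \<psi>2 x + - (real n)\<^sup>2 * K x * \<psi> x) has_integral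
         (\<Sum>a\<in>A. real (m a) * Re (\<tau> * cis (real n * Arg a)) *
           (if ln (cmod a) \<in> {\<alpha>..\<beta>} then \<psi> (ln (cmod a)) else 0))) {\<alpha>..\<beta>}"
        by (rule 3[unfolded w_def, OF spec[OF \<psi>(1)] spec[OF \<psi>(2)] \<psi>(3-7)])
    qed (rule 1 2, assumption+)+
  next
    case (add T T1 T2 U U1 U2)
    from add.IH(1) obtain K L where KL: "?P T T2 K L" by (elim exE)
    from add.IH(2) obtain K' L' where KL': "?P U U2 K' L'" by (elim exE)
    note k1 = KL[THEN conjunct1, rule_format] and k2 = KL[THEN conjunct2, rule_format]
    note l1 = KL'[THEN conjunct1, rule_format] and l2 = KL'[THEN conjunct2, rule_format]
    have "?P (\<lambda>\<theta>. T \<theta> + U \<theta>) (\<lambda>\<theta>. T2 \<theta> + U2 \<theta>) (\<lambda>x. K x + K' x) (\<lambda>x. L x + L' x)"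
    proof (intro conjI allI impI)
      fix x assume x: "exp x < \<rho>" "exp x \<notin> cmod ` A"
      show "((\<lambda>\<theta>. log_mod F x \<theta> * (T \<theta> + U \<theta>)) has_integral 2 * pi * (K x + K' x)) {0..2*pi}"
        unfolding distrib_left by (rule has_integral_add[OF k1[OF x, THEN conjunct1] l1[OF x, THEN conjunct1]])
      show "((\<lambda>\<theta>. log_mod F x \<theta> * (T2 \<theta> + U2 \<theta>)) has_integral 2 * pi * (L x + L' x)) {0..2*pi}"
        unfolding distrib_left by (rule has_integral_add[OF k1[OF x, THEN conjunct2] l1[OF x, THEN conjunct2]])
    next
      fix \<alpha> \<beta> \<psi> \<psi>1 \<psi>2
      assume \<psi>: "\<forall>x. (\<psi> has_real_derivative \<psi>1 x) (at x)" "\<forall>x. (\<psi>1 has_real_derivative \<psi>2 x) (at x)"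
        "\<psi> \<alpha> = 0" "\<psi> \<beta> = 0" "\<psi>1 \<alpha> = 0" "\<psi>1 \<beta> = 0" "\<alpha> \<le> \<beta>"
      let ?w = "\<lambda>a. if ln (cmod a) \<in> {\<alpha>..\<beta>} then \<psi> (ln (cmod a)) else 0"
      have "((\<lambda>x. (K x * \<psi>2 x + L x * \<psi> x) + (K' x * \<psi>2 x + L' x * \<psi> x)) has_integral
          (\<Sum>a\<in>A. real (m a) * T (Arg a) * ?w a) + (\<Sum>a\<in>A. real (m a) * U (Arg a) * ?w a)) {\<alpha>..\<beta>}"
        by (intro has_integral_add k2[OF spec[OF \<psi>(1)] spec[OF \<psi>(2)] \<psi>(3-7)] l2[OF spec[OF \<psi>(1)] spec[OF \<psi>(2)] \<psi>(3-7)])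
      moreover have "(\<Sum>a\<in>A. real (m a) * (T (Arg a) + U (Arg a)) * ?w a) =
          (\<Sum>a\<in>A. real (m a) * T (Arg a) * ?w a) + (\<Sum>a\<in>A. real (m a) * U (Arg a) * ?w a)"
        unfolding sum.distrib[symmetric] by (intro sum.cong refl) (simp only: distrib_left distrib_right)
      moreover have "(K x * \<psi>2 x + L x * \<psi> x) + (K' x * \<psi>2 x + L' x * \<psi> x) = (K x + K' x) * \<psi>2 x + (L x + L' x) * \<psi> x" for x
        by (simp add: algebra_simps)
      ultimately show "((\<lambda>x. (K x + K' x) * \<psi>2 x + (L x + L' x) * \<psi> x) has_integral
         (\<Sum>a\<in>A. real (m a) * (T (Arg a) + U (Arg a)) * ?w a)) {\<alpha>..\<beta>}" by (simp only:)
    qed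
    then show ?case by (intro exI)
  qed
  then obtain K L where KL: "?P T T2 K L" by (elim exE)
  note k1 = KL[THEN conjunct1, rule_format] and k2 = KL[THEN conjunct2, rule_format]
  show thesis
    by (rule that[OF k1[THEN conjunct1] k1[THEN conjunct2] k2])
qed

section \<open>Cutoff in the logarithmic variable and bounds for the zeros\<close>

lemma cutoff_profile:
  assumes \<delta>: "0 < \<delta>" and \<eta>: "0 < \<eta>" "\<eta> < 1 / 2"
  obtains q q1 q2 :: "real \<Rightarrow> real" and Q where
    "\<And>y. (q has_real_derivative q1 y) (at y)" "\<And>y. (q1 has_real_derivative q2 y) (at y)"
    "q 0 = 0" "q 1 = 0" "q1 0 = 0" "q1 1 = 0"
    "\<And>y. y \<in> {0..1} \<Longrightarrow> 0 \<le> q y \<and> q y \<le> 1 + \<delta> \<and> \<bar>q1 y\<bar> \<le> Q \<and> \<bar>q2 y\<bar> \<le> Q"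
    "\<And>y. y \<in> {\<eta>..1 - \<eta>} \<Longrightarrow> 1 \<le> q y" "0 \<le> Q"
proof -
  define s where "s = (1 - 2 * \<eta>)\<^sup>2"
  have s: "0 \<le> s" "s < 1"
    using \<eta> by (auto simp: s_def power_less_one_iff abs_square_less_1)
  have "(\<lambda>k. (1 + \<delta>) * (1 - s ^ k)\<^sup>2) \<longlonglongrightarrow> (1 + \<delta>) * (1 - 0)\<^sup>2"
    by (intro tendsto_intros LIMSEQ_power_zero) (use s in auto)
  then have "\<forall>\<^sub>F k in sequentially. 1 < (1 + \<delta>) * (1 - s ^ k)\<^sup>2"
    using \<delta> by (intro order_tendstoD(1)) auto
  then obtain k0 where kk: "\<And>k. k \<ge> k0 \<Longrightarrow> 1 < (1 + \<delta>) * (1 - s ^ k)\<^sup>2"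
    by (auto simp: eventually_sequentially)
  have k: "1 < (1 + \<delta>) * (1 - s ^ Suc k0)\<^sup>2" by (rule kk) simp
  \<comment> \<open>An even power of \<open>1 - 2 y\<close> equals 1 at both ends and is tiny in
    between. Hence \<open>v\<close> vanishes at the ends, its square has double zeros there (the
    four boundary conditions), and the factor \<open>1 + \<delta>\<close> lifts the square above 1
    on the middle part.\<close>
  define v :: "real poly" where "v = 1 - [:1, -2:] ^ (2 * Suc k0)"
  define p where "p = smult (1 + \<delta>) (v\<^sup>2)"
  have v: "poly v y = 1 - ((1 - 2 * y)\<^sup>2) ^ Suc k0" for y :: real
  proof -
    have "poly [:1, -2:] y = 1 - 2 * y" by simp
    then show ?thesis unfolding v_def poly_diff poly_power poly_1 by (simp only: power_mult)
  qed
  have p: "poly p y = (1 + \<delta>) * (poly v y)\<^sup>2" for y by (simp add: p_def)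
  have p1: "poly (pderiv p) y = (1 + \<delta>) * (2 * poly v y * poly (pderiv v) y)" for y
    by (simp add: p_def pderiv_smult power2_eq_square pderiv_mult)
  have v01: "poly v 0 = 0" "poly v 1 = 0" by (simp_all add: v)
  have "bounded (poly (pderiv p) ` {0..1} \<union> poly (pderiv (pderiv p)) ` {0..1})"
    by (intro compact_imp_bounded compact_Un compact_continuous_image continuous_intros compact_Icc)
  then obtain Q where Q: "\<forall>x\<in>poly (pderiv p) ` {0..1} \<union> poly (pderiv (pderiv p)) ` {0..1}. \<bar>x\<bar> \<le> Q"
    by (auto simp: bounded_iff)
  show thesis
  proof (rule that[of "poly p" "poly (pderiv p)" "poly (pderiv (pderiv p))" Q])
    fix y :: real assume y: "y \<in> {0..1}"
    have "(1 - 2 * y)\<^sup>2 \<le> 1" using y by (auto simp: abs_square_le_1)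
    from power_le_one[OF zero_le_power2 this, of "Suc k0"] zero_le_power[OF zero_le_power2, of "1 - 2 * y" "Suc k0"]
    have "0 \<le> poly v y" "poly v y \<le> 1" unfolding v by linarith+
    then have "(poly v y)\<^sup>2 \<le> 1" by (simp add: power_le_one)
    then have "(1 + \<delta>) * (poly v y)\<^sup>2 \<le> (1 + \<delta>) * 1" using \<delta> by (intro mult_left_mono) auto
    then show "0 \<le> poly p y \<and> poly p y \<le> 1 + \<delta> \<and> \<bar>poly (pderiv p) y\<bar> \<le> Q \<and> \<bar>poly (pderiv (pderiv p)) y\<bar> \<le> Q"
      using Q y \<delta> unfolding p by auto
  next
    fix y assume y: "y \<in> {\<eta>..1 - \<eta>}"
    then have "\<bar>1 - 2 * y\<bar> \<le> 1 - 2 * \<eta>" by auto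
    then have "(1 - 2 * y)\<^sup>2 \<le> s" unfolding s_def by (metis abs_ge_zero power2_abs power_mono)
    then have "((1 - 2 * y)\<^sup>2) ^ Suc k0 \<le> s ^ Suc k0" by (rule power_mono) (rule zero_le_power2)
    moreover have "s ^ Suc k0 \<le> 1" by (rule power_le_one[OF s(1) less_imp_le[OF s(2)]])
    ultimately have "(1 - s ^ Suc k0)\<^sup>2 \<le> (poly v y)\<^sup>2" unfolding v by (intro power_mono) auto
    then have "(1 + \<delta>) * (1 - s ^ Suc k0)\<^sup>2 \<le> poly p y" unfolding p using \<delta> by (intro mult_left_mono) auto
    then show "1 \<le> poly p y" using k by linarith
  next
    have "\<bar>poly (pderiv p) 0\<bar> \<le> Q" using Q by auto
    then show "0 \<le> Q" by linarith
  qed (rule poly_DERIV | simp add: p p1 v01)+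
qed

lemma factored_nonzero:
  assumes fac: "factored F \<rho> A m" and F0: "F 0 \<noteq> 0" and x: "exp x < \<rho>" "exp x \<notin> cmod ` A"
  shows "F (of_real (exp x) * cis \<theta>) \<noteq> 0"
proof -
  obtain g where A: "finite A" "0 \<notin> A" and
    g: "\<And>z. z \<in> ball 0 \<rho> \<Longrightarrow> F z = F 0 * (\<Prod>a\<in>A. (1 - z / a) ^ m a) * exp (g z)"
    using fac unfolding factored_def by blast
  let ?z = "of_real (exp x) * cis \<theta>"
  have cz: "cmod ?z = exp x" by (simp add: norm_mult)
  have "1 - ?z / a \<noteq> 0" if "a \<in> A" for a
  proof
    assume "1 - ?z / a = 0"
    then have "?z = a" using that A(2) by (auto simp: divide_simps split: if_splits)
    then show False using x(2) that cz by (metis imageI)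
  qed
  then have "(1 - ?z / a) ^ m a \<noteq> 0" if "a \<in> A" for a using that by (metis power_not_zero)
  then have "(\<Prod>a\<in>A. (1 - ?z / a) ^ m a) \<noteq> 0"
    using prod_zero_iff[OF A(1), of "\<lambda>a. (1 - ?z / a) ^ m a"] by blast
  then show ?thesis using g[of ?z] cz x(1) F0 by simp
qed

text \<open>\<open>w\<close> is the growth indicator with the gain already subtracted, and
  \<open>C0\<close> is a crude bound for rough estimates. Growth is required from radius 1 on,
  because that is where dividing an entire function by a power of \<open>z\<close> does not spoil
  the bound.\<close>

locale exponential_growth =
  fixes F :: "complex \<Rightarrow> complex" and w :: "real \<Rightarrow> real" and M0 C0 :: real
  assumes F0: "F 0 \<noteq> 0"
    and growth: "\<And>t \<theta>. 1 \<le> t \<Longrightarrow> cmod (F (of_real t * cis \<theta>)) \<le> exp (t * w \<theta> + M0)"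
    and w: "continuous_on {0..2*pi} w" and w_le: "\<And>\<theta>. w \<theta> \<le> C0"
    and nonneg: "0 \<le> C0" "0 \<le> M0"
begin

lemma log_mod_le:
  assumes fac: "factored F \<rho> A m" and x: "exp x < \<rho>" "exp x \<notin> cmod ` A" "0 \<le> x"
  shows "log_mod F x \<theta> \<le> exp x * w \<theta> + M0" "log_mod F x \<theta> \<le> C0 * exp x + M0"
proof -
  have "0 < cmod (F (of_real (exp x) * cis \<theta>))"
    using factored_nonzero[OF fac F0 x(1,2)] by simp
  moreover have "cmod (F (of_real (exp x) * cis \<theta>)) \<le> exp (exp x * w \<theta> + M0)"
    using x(3) by (intro growth) simp
  ultimately show 1: "log_mod F x \<theta> \<le> exp x * w \<theta> + M0"
    unfolding log_mod_def by (metis exp_gt_zero ln_exp ln_le_cancel_iff)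
  have "exp x * w \<theta> \<le> C0 * exp x" using w_le[of \<theta>] by (simp add: mult.commute)
  then show "log_mod F x \<theta> \<le> C0 * exp x + M0" using 1 by linarith
qed

text \<open>Jensen's formula on a circle of radius between \<open>exp 1 * r\<close> and
  \<open>exp 2 * r\<close>, chosen to avoid all zeros: every zero with \<open>cmod a \<le> r\<close>
  then counts at least once its multiplicity. The constant is the same for all
  factorizations.\<close>

lemma zero_count_bound:
  obtains C where "\<And>r \<rho> A m. 1 \<le> r \<Longrightarrow> factored F \<rho> A m \<Longrightarrow> exp 2 * r < \<rho> \<Longrightarrow>
    (\<Sum>a | a \<in> A \<and> cmod a \<le> r. real (m a)) \<le> C * r" "0 \<le> C"
proof (rule that[of "C0 * exp 2 + M0 + \<bar>ln (cmod (F 0))\<bar>"])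
  show "0 \<le> C0 * exp 2 + M0 + \<bar>ln (cmod (F 0))\<bar>" using nonneg by simp
  fix r \<rho> :: real and A m assume r: "1 \<le> r" and fac: "factored F \<rho> A m" and \<rho>: "exp 2 * r < \<rho>"
  have A: "finite A" "0 \<notin> A" using fac by (auto simp: factored_def)
  have "infinite {ln r + 1<..<ln r + 2}" by (simp add: infinite_Ioo)
  moreover have "finite ((\<lambda>a. ln (cmod a)) ` A)" using A(1) by simp
  ultimately obtain x where x: "x \<in> {ln r + 1<..<ln r + 2}" "x \<notin> (\<lambda>a. ln (cmod a)) ` A"
    by (meson finite_subset subsetI)
  have xA: "exp x \<notin> cmod ` A"
    using x(2) A(2) by (auto simp: image_iff) (metis ln_exp)
  have ex: "exp x \<le> exp 2 * r"
  proof -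
    have "exp x \<le> exp (2 + ln r)" using x(1) by simp
    then show ?thesis using r by (simp add: exp_add)
  qed
  have x0: "0 \<le> x" using x(1) ln_ge_zero[OF r] by simp
  have xr: "exp x < \<rho>" using ex \<rho> by simp
  have J: "(log_mod F x has_integral 2 * pi * (ln (cmod (F 0)) + (\<Sum>a\<in>A. real (m a) * max (x - ln (cmod a)) 0))) {0..2*pi}"
    by (rule jensen_formula[OF fac F0 xr xA])
  have "2 * pi * (ln (cmod (F 0)) + (\<Sum>a\<in>A. real (m a) * max (x - ln (cmod a)) 0)) \<le> 2 * pi * (C0 * exp x + M0)"
    using has_integral_le[OF J, of "\<lambda>_. C0 * exp x + M0"] has_integral_const_real[of "C0 * exp x + M0" 0 "2*pi"]
      log_mod_le(2)[OF fac xr xA x0] by simp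
  then have "(\<Sum>a\<in>A. real (m a) * max (x - ln (cmod a)) 0) \<le> C0 * exp x + M0 - ln (cmod (F 0))"
    by simp
  also have "\<dots> \<le> C0 * (exp 2 * r) + M0 + \<bar>ln (cmod (F 0))\<bar>"
    using mult_left_mono[OF ex nonneg(1)] by linarith
  also have "\<dots> \<le> (C0 * exp 2 + M0 + \<bar>ln (cmod (F 0))\<bar>) * r"
  proof -
    have "M0 \<le> M0 * r" "\<bar>ln (cmod (F 0))\<bar> \<le> \<bar>ln (cmod (F 0))\<bar> * r"
      using r nonneg mult_left_mono[OF r] by (metis mult.right_neutral, metis abs_ge_zero mult.right_neutral mult_left_mono)
    then show ?thesis by (simp add: algebra_simps)
  qed
  finally have 1: "(\<Sum>a\<in>A. real (m a) * max (x - ln (cmod a)) 0) \<le> (C0 * exp 2 + M0 + \<bar>ln (cmod (F 0))\<bar>) * r" .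
  have "(\<Sum>a | a \<in> A \<and> cmod a \<le> r. real (m a)) \<le> (\<Sum>a | a \<in> A \<and> cmod a \<le> r. real (m a) * max (x - ln (cmod a)) 0)"
  proof (rule sum_mono)
    fix a assume a: "a \<in> {a. a \<in> A \<and> cmod a \<le> r}"
    then have "0 < cmod a" using A(2) by auto
    then have "ln (cmod a) \<le> ln r" using a r by (subst ln_le_cancel_iff) auto
    then have "1 \<le> max (x - ln (cmod a)) 0" using x(1) by simp
    then show "real (m a) \<le> real (m a) * max (x - ln (cmod a)) 0"
      using mult_left_mono[of 1 _ "real (m a)"] by simp
  qed
  also have "\<dots> \<le> (\<Sum>a\<in>A. real (m a) * max (x - ln (cmod a)) 0)"
    using A(1) by (intro sum_mono2) auto
  finally show "(\<Sum>a | a \<in> A \<and> cmod a \<le> r. real (m a)) \<le> (C0 * exp 2 + M0 + \<bar>ln (cmod (F 0))\<bar>) * r"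
    using 1 by linarith
qed

text \<open>The essential point is that \<open>C\<close> depends on neither \<sigma> nor
  \<open>L\<close>. The cutoff varies over a length proportional to \<open>L\<close>, so its
  derivatives are O(1/L), and integrated over a range of length O(L) they cost O(1).\<close>

lemma annulus_bound:
  assumes T: "trig_poly T T1 T2" and Tn: "\<And>\<theta>. 0 \<le> T \<theta>" "\<And>\<theta>. 0 \<le> T \<theta> + T2 \<theta>"
    and J: "integral {0..2*pi} (\<lambda>\<theta>. w \<theta> * (T \<theta> + T2 \<theta>)) \<le> 2 * pi * J" "0 \<le> J" and \<delta>: "0 < \<delta>"
  obtains C where "\<And>\<sigma> L \<rho> A m. 1 \<le> L \<Longrightarrow> \<delta> * L \<le> \<sigma> \<Longrightarrow> factored F \<rho> A m \<Longrightarrow> exp (\<sigma> + (1 + \<delta>) * L) < \<rho> \<Longrightarrow>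
    (\<Sum>a | a \<in> A \<and> ln (cmod a) \<in> {\<sigma>..\<sigma> + L}. real (m a) * T (Arg a) / cmod a) \<le> (1 + \<delta>) * (1 + 2 * \<delta>) * L * J + C"
proof -
  \<comment> \<open>The fraction of the widened range, of length
    \<open>(1 + 2 * \<delta>) * L\<close>, that one margin of length \<open>\<delta> * L\<close>
    occupies.\<close>
  define \<eta> where "\<eta> = \<delta> / (1 + 2 * \<delta>)"
  have \<eta>: "0 < \<eta>" "\<eta> < 1 / 2" using \<delta> by (auto simp: \<eta>_def field_simps)
  obtain q q1 q2 Q where q: "\<And>y. (q has_real_derivative q1 y) (at y)" "\<And>y. (q1 has_real_derivative q2 y) (at y)"
    "q 0 = 0" "q 1 = 0" "q1 0 = 0" "q1 1 = 0"
    and qb: "\<And>y. y \<in> {0..1} \<Longrightarrow> 0 \<le> q y \<and> q y \<le> 1 + \<delta> \<and> \<bar>q1 y\<bar> \<le> Q \<and> \<bar>q2 y\<bar> \<le> Q"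
    and q1: "\<And>y. y \<in> {\<eta>..1 - \<eta>} \<Longrightarrow> 1 \<le> q y" and Q: "0 \<le> Q"
    by (rule cutoff_profile[OF \<delta> \<eta>]) (rule that)
  have Tc: "continuous_on {0..2*pi} T" "continuous_on {0..2*pi} T2"
    using trig_poly_continuous[OF T] by auto
  obtain Tm where Tm: "\<And>\<theta>. \<theta> \<in> {0..2*pi} \<Longrightarrow> T \<theta> \<le> Tm"
  proof -
    have "bounded (T ` {0..2*pi})" by (intro compact_imp_bounded compact_continuous_image Tc) auto
    then show thesis using that unfolding bounded_iff by (metis abs_le_D1 imageI real_norm_def)
  qed
  have Tm0: "0 \<le> Tm" using Tm[of 0] Tn(1)[of 0] by simp
  define S where "S = integral {0..2*pi} (\<lambda>\<theta>. T \<theta> + T2 \<theta>)"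
  have Si: "((\<lambda>\<theta>. T \<theta> + T2 \<theta>) has_integral S) {0..2*pi}"
    unfolding S_def by (intro integrable_integral integrable_continuous_real continuous_intros Tc)
  have S0: "0 \<le> S" by (rule has_integral_nonneg[OF Si]) (use Tn in auto)
  define I where "I = integral {0..2*pi} (\<lambda>\<theta>. w \<theta> * (T \<theta> + T2 \<theta>))"
  have Ii: "((\<lambda>\<theta>. w \<theta> * (T \<theta> + T2 \<theta>)) has_integral I) {0..2*pi}"
    unfolding I_def by (intro integrable_integral integrable_continuous_real continuous_intros Tc w)
  \<comment> \<open>The additive constant \<open>M0\<close> of the growth bound, averaged against
    the nonnegative weight \<open>T + T2\<close>.\<close>
  define M1 where "M1 = M0 * S / (2 * pi)"
  have M1: "0 \<le> M1" using nonneg S0 by (simp add: M1_def)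
  define l0 where "l0 = \<bar>ln (cmod (F 0))\<bar>"
  define C1 where "C1 = Tm * (2 * C0 + 2 * M0 + l0)"
  have C1: "0 \<le> C1" using Tm0 nonneg by (simp add: C1_def l0_def)
  show thesis
  proof (rule that[of "(1 + \<delta>) * M1 + 3 * Q * C1"])
    fix \<sigma> L \<rho> :: real and A m
    assume L: "1 \<le> L" and \<sigma>: "\<delta> * L \<le> \<sigma>" and fac: "factored F \<rho> A m" and \<rho>: "exp (\<sigma> + (1 + \<delta>) * L) < \<rho>"
    have A: "finite A" "0 \<notin> A" using fac by (auto simp: factored_def)
    \<comment> \<open>Widening by \<open>\<delta> * L\<close> on each side; the assumption on
      \<sigma> keeps \<open>\<alpha> \<ge> 0\<close>, that is, radii at least 1, where the growth
      bound holds.\<close>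
    define \<alpha> \<beta> len where "\<alpha> = \<sigma> - \<delta> * L" and "\<beta> = \<sigma> + (1 + \<delta>) * L" and "len = (1 + 2 * \<delta>) * L"
    have len: "\<beta> = \<alpha> + len" "1 \<le> len" "0 \<le> \<alpha>"
    proof -
      show "\<beta> = \<alpha> + len" by (simp add: \<alpha>_def \<beta>_def len_def algebra_simps)
      have "0 \<le> 2 * \<delta> * L" using \<delta> L by simp
      then show "1 \<le> len" using L unfolding len_def distrib_right by linarith
      show "0 \<le> \<alpha>" using \<sigma> by (simp add: \<alpha>_def)
    qed
    define y where "y x = (x - \<alpha>) / len" for x
    have y01: "y x \<in> {0..1}" if "x \<in> {\<alpha>..\<beta>}" for x
      using that len by (auto simp: y_def divide_simps)
    define cut cut1 cut2 where "cut x = q (y x)" and "cut1 x = q1 (y x) / len" and "cut2 x = q2 (y x) / len\<^sup>2" for x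
    have dy: "(y has_real_derivative 1 / len) (at x)" for x
      unfolding y_def using len(2) by (auto intro!: derivative_eq_intros)
    have dcut: "(cut has_real_derivative cut1 x) (at x)" "(cut1 has_real_derivative cut2 x) (at x)" for x
    proof -
      show "(cut has_real_derivative cut1 x) (at x)"
        using DERIV_chain2[OF q(1) dy, of x] by (simp add: cut_def[abs_def] cut1_def)
      show "(cut1 has_real_derivative cut2 x) (at x)"
        using DERIV_cdivide[OF DERIV_chain2[OF q(2) dy, of x], of len]
        by (simp add: cut1_def[abs_def] cut2_def power2_eq_square)
    qed
    (* with the factor exp (- x), the combination T \<psi>2 + T2 \<psi> is exp (- x) (T + T2) up to derivatives of the cutoff *)
    define \<psi> \<psi>1 \<psi>2 where "\<psi> x = exp (- x) * cut x" and "\<psi>1 x = exp (- x) * (cut1 x - cut x)"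
      and "\<psi>2 x = exp (- x) * (cut x - 2 * cut1 x + cut2 x)" for x
    have d\<psi>: "(\<psi> has_real_derivative \<psi>1 x) (at x)" "(\<psi>1 has_real_derivative \<psi>2 x) (at x)" for x
    proof -
      show "(\<psi> has_real_derivative \<psi>1 x) (at x)"
        unfolding \<psi>_def[abs_def] \<psi>1_def by (rule derivative_eq_intros dcut refl)+ (simp add: algebra_simps)
      show "(\<psi>1 has_real_derivative \<psi>2 x) (at x)"
        unfolding \<psi>1_def[abs_def] \<psi>2_def by (rule derivative_eq_intros dcut refl)+ (simp add: algebra_simps)
    qed
    have ends: "\<psi> \<alpha> = 0" "\<psi> \<beta> = 0" "\<psi>1 \<alpha> = 0" "\<psi>1 \<beta> = 0" "\<alpha> \<le> \<beta>"
      using q len by (auto simp: \<psi>_def \<psi>1_def cut_def cut1_def y_def)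
    let ?D = "\<Sum>a\<in>A. real (m a) * T (Arg a) * (if ln (cmod a) \<in> {\<alpha>..\<beta>} then \<psi> (ln (cmod a)) else 0)"
    obtain K N where
      K: "\<And>x. exp x < \<rho> \<Longrightarrow> exp x \<notin> cmod ` A \<Longrightarrow> ((\<lambda>\<theta>. log_mod F x \<theta> * T \<theta>) has_integral 2 * pi * K x) {0..2*pi}"
      and N: "\<And>x. exp x < \<rho> \<Longrightarrow> exp x \<notin> cmod ` A \<Longrightarrow> ((\<lambda>\<theta>. log_mod F x \<theta> * T2 \<theta>) has_integral 2 * pi * N x) {0..2*pi}"
      and D: "((\<lambda>x. K x * \<psi>2 x + N x * \<psi> x) has_integral ?D) {\<alpha>..\<beta>}"
    proof (rule trig_weighted_jensen[OF fac F0 T], goal_cases)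
      case (1 K N)
      show ?case by (rule 1(1)[OF 1(2,3) 1(4)[OF d\<psi> ends]])
    qed
    \<comment> \<open>The first summand bounds the main term. The second bounds the derivatives of
      the cutoff: \<open>3 * Q / len\<close> comes from one \<open>cut2\<close> and twice
      \<open>cut1\<close>, with \<open>len \<ge> 1\<close> absorbing the square. Integration cancels
      \<open>len\<close>.\<close>
    define B where "B x = (1 + \<delta>) * (J + M1 * exp (- x)) + C1 * (3 * Q / len)" for x
    have Bi: "(B has_integral (1 + \<delta>) * (len * J + M1 * (exp (- \<alpha>) - exp (- \<beta>))) + len * (C1 * (3 * Q / len))) {\<alpha>..\<beta>}"
    proof -
      have "((\<lambda>x. exp (- x)) has_integral (- exp (- \<beta>) - (- exp (- \<alpha>)))) {\<alpha>..\<beta>}"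
        by (rule fundamental_theorem_of_calculus[OF ends(5)])
           (auto intro!: derivative_eq_intros simp flip: has_real_derivative_iff_has_vector_derivative)
      then have "((\<lambda>x. exp (- x)) has_integral (exp (- \<alpha>) - exp (- \<beta>))) {\<alpha>..\<beta>}" by simp
      from has_integral_add[OF has_integral_mult_right[OF has_integral_add[OF has_integral_const_real[of J \<alpha> \<beta>] has_integral_mult_right[OF this, of M1]], of "1 + \<delta>"]
          has_integral_const_real[of "C1 * (3 * Q / len)" \<alpha> \<beta>]]
      show ?thesis using len by (simp add: B_def[abs_def])
    qed
    have pt: "K x * \<psi>2 x + N x * \<psi> x \<le> B x" if x: "x \<in> {\<alpha>..\<beta>}" "exp x \<notin> cmod ` A" for x
    proof -
      have x0: "0 \<le> x" using x len by simp
      have "exp x \<le> exp \<beta>" using x by simp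
      then have xr: "exp x < \<rho>" using \<rho> unfolding \<beta>_def by (rule le_less_trans)
      have e1: "1 \<le> exp x" using x0 by simp
      note K' = K[OF xr x(2)] and N' = N[OF xr x(2)]
      have "2 * pi * (K x + N x) \<le> exp x * I + M0 * S"
      proof (rule has_integral_le)
        show "((\<lambda>\<theta>. log_mod F x \<theta> * (T \<theta> + T2 \<theta>)) has_integral 2 * pi * (K x + N x)) {0..2*pi}"
          unfolding distrib_left by (rule has_integral_add[OF K' N'])
        show "((\<lambda>\<theta>. exp x * (w \<theta> * (T \<theta> + T2 \<theta>)) + M0 * (T \<theta> + T2 \<theta>)) has_integral exp x * I + M0 * S) {0..2*pi}"
          by (intro has_integral_add has_integral_mult_right Ii Si)
        fix \<theta> :: real
        have "log_mod F x \<theta> * (T \<theta> + T2 \<theta>) \<le> (exp x * w \<theta> + M0) * (T \<theta> + T2 \<theta>)"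
          by (intro mult_right_mono log_mod_le(1)[OF fac xr x(2) x0] Tn(2))
        then show "log_mod F x \<theta> * (T \<theta> + T2 \<theta>) \<le> exp x * (w \<theta> * (T \<theta> + T2 \<theta>)) + M0 * (T \<theta> + T2 \<theta>)"
          by (simp only: distrib_right mult.assoc)
      qed
      also have "\<dots> \<le> exp x * (2 * pi * J) + M0 * S" using J(1) by (simp add: I_def)
      also have "\<dots> = 2 * pi * (exp x * J + M1)" by (simp add: M1_def field_simps)
      finally have 1: "K x + N x \<le> exp x * J + M1" by simp
      have 2: "\<bar>K x\<bar> \<le> exp x * C1"
      proof -
        define V where "V = C0 * exp x + M0"
        have V: "0 \<le> V" "log_mod F x \<theta> \<le> V" for \<theta>
          using nonneg log_mod_le(2)[OF fac xr x(2) x0] by (auto simp: V_def)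
        define jm where "jm = 2 * pi * (ln (cmod (F 0)) + (\<Sum>a\<in>A. real (m a) * max (x - ln (cmod a)) 0))"
        have jm: "(log_mod F x has_integral jm) {0..2*pi}"
          unfolding jm_def by (rule jensen_formula[OF fac F0 xr x(2)])
        have "0 \<le> (\<Sum>a\<in>A. real (m a) * max (x - ln (cmod a)) 0)" by (intro sum_nonneg) auto
        then have "- l0 \<le> ln (cmod (F 0)) + (\<Sum>a\<in>A. real (m a) * max (x - ln (cmod a)) 0)" by (simp add: l0_def)
        then have jl: "2 * pi * (- l0) \<le> jm" unfolding jm_def by (intro mult_left_mono) auto
        have bi: "((\<lambda>\<theta>. Tm * (2 * V - log_mod F x \<theta>)) has_integral Tm * (2 * pi * (2 * V) - jm)) {0..2*pi}"
          using has_integral_mult_right[OF has_integral_diff[OF has_integral_const_real[of "2 * V" 0 "2*pi"] jm], of Tm] by simp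
        \<comment> \<open>An upper bound \<open>V \<ge> 0\<close> for
          \<open>u = log_mod F x \<theta>\<close> gives
          \<open>\<bar>u\<bar> \<le> 2 * V - u\<close>. Thus the absolute mean is controlled by
          \<open>V\<close> and the lower bound for the mean of \<open>u\<close> that Jensen's
          formula provides.\<close>
        have ab: "\<bar>log_mod F x \<theta> * T \<theta>\<bar> \<le> Tm * (2 * V - log_mod F x \<theta>)" if \<theta>: "\<theta> \<in> {0..2*pi}" for \<theta>
        proof -
          have "\<bar>log_mod F x \<theta> * T \<theta>\<bar> = T \<theta> * \<bar>log_mod F x \<theta>\<bar>" using Tn(1)[of \<theta>] by (simp add: abs_mult)
          also have "\<dots> \<le> Tm * (2 * V - log_mod F x \<theta>)"
            using V(1) V(2)[of \<theta>] Tm[OF \<theta>] Tn(1)[of \<theta>] by (intro mult_mono) auto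
          finally show ?thesis .
        qed
        have "2 * pi * K x \<le> Tm * (2 * pi * (2 * V) - jm)"
          by (rule has_integral_le[OF K' bi]) (use ab in fastforce)
        moreover have "- (2 * pi * K x) \<le> Tm * (2 * pi * (2 * V) - jm)"
          by (rule has_integral_le[OF has_integral_neg[OF K'] bi]) (use ab in fastforce)
        ultimately have "\<bar>2 * pi * K x\<bar> \<le> Tm * (2 * pi * (2 * V) - jm)" by linarith
        also have "\<dots> \<le> Tm * (2 * pi * (2 * V) - 2 * pi * (- l0))" using jl Tm0 by (intro mult_left_mono) auto
        also have "\<dots> = 2 * pi * (Tm * (2 * V + l0))" by (simp add: algebra_simps)
        finally have "\<bar>K x\<bar> \<le> Tm * (2 * V + l0)" by (simp add: abs_mult)
        also have "\<dots> \<le> Tm * (exp x * (2 * C0 + 2 * M0 + l0))"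
        proof (rule mult_left_mono[OF _ Tm0])
          have "2 * M0 \<le> 2 * M0 * exp x" "l0 \<le> l0 * exp x"
            using mult_left_mono[OF e1, of "2 * M0"] mult_left_mono[OF e1, of l0] nonneg by (auto simp: l0_def)
          then show "2 * V + l0 \<le> exp x * (2 * C0 + 2 * M0 + l0)" by (simp add: V_def algebra_simps)
        qed
        finally show ?thesis by (simp add: C1_def mult_ac)
      qed
      note qy = qb[OF y01[OF x(1)]]
      have cut0: "0 \<le> cut x" "cut x \<le> 1 + \<delta>" using qy by (auto simp: cut_def)
      have cut3: "\<bar>cut2 x - 2 * cut1 x\<bar> \<le> 3 * Q / len"
      proof -
        have "\<bar>cut1 x\<bar> \<le> Q / len" using qy len by (simp add: cut1_def abs_divide divide_right_mono)
        moreover have "\<bar>cut2 x\<bar> \<le> Q / len"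
        proof -
          have "len \<le> len\<^sup>2" using len(2) by (simp add: power2_eq_square)
          then have "Q / len\<^sup>2 \<le> Q / len" using len(2) Q by (intro divide_left_mono) auto
          moreover have "\<bar>cut2 x\<bar> \<le> Q / len\<^sup>2" using qy len by (simp add: cut2_def abs_divide divide_right_mono)
          ultimately show ?thesis by linarith
        qed
        moreover have "3 * Q / len = Q / len + 2 * (Q / len)" by simp
        ultimately show ?thesis by linarith
      qed
      have "K x * \<psi>2 x + N x * \<psi> x = cut x * (exp (- x) * (K x + N x)) + (exp (- x) * K x) * (cut2 x - 2 * cut1 x)"
        by (simp add: \<psi>_def \<psi>2_def algebra_simps)
      moreover have "cut x * (exp (- x) * (K x + N x)) \<le> (1 + \<delta>) * (J + M1 * exp (- x))"
      proof -
        have "exp (- x) * (K x + N x) \<le> exp (- x) * (exp x * J + M1)" using 1 by simp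
        also have "\<dots> = J + M1 * exp (- x)" by (simp add: exp_minus field_simps)
        finally have "cut x * (exp (- x) * (K x + N x)) \<le> cut x * (J + M1 * exp (- x))"
          using cut0(1) by (rule mult_left_mono)
        also have "\<dots> \<le> (1 + \<delta>) * (J + M1 * exp (- x))" using cut0(2) J(2) M1 by (intro mult_right_mono) auto
        finally show ?thesis .
      qed
      moreover have "(exp (- x) * K x) * (cut2 x - 2 * cut1 x) \<le> C1 * (3 * Q / len)"
      proof -
        have "\<bar>exp (- x) * K x\<bar> \<le> C1" using 2 by (simp add: abs_mult exp_minus field_simps)
        then have "\<bar>exp (- x) * K x\<bar> * \<bar>cut2 x - 2 * cut1 x\<bar> \<le> C1 * (3 * Q / len)"
          using cut3 C1 by (intro mult_mono) auto
        then show ?thesis by (metis abs_ge_self abs_mult order_trans)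
      qed
      ultimately show ?thesis by (simp add: B_def)
    qed
    have "?D \<le> (1 + \<delta>) * (len * J + M1 * (exp (- \<alpha>) - exp (- \<beta>))) + len * (C1 * (3 * Q / len))"
    proof (rule has_integral_le[OF _ Bi])
      \<comment> \<open>Changing the integrand to \<open>B\<close> at the finitely many exceptional
        radii makes the pointwise inequality hold everywhere without affecting the integral.\<close>
      let ?f = "\<lambda>x. if exp x \<in> cmod ` A then B x else K x * \<psi>2 x + N x * \<psi> x"
      show "(?f has_integral ?D) {\<alpha>..\<beta>}"
      proof (rule has_integral_spike_finite[OF _ _ D])
        show "finite ((\<lambda>a. ln (cmod a)) ` A)" using A(1) by simp
        fix x assume "x \<in> {\<alpha>..\<beta>} - (\<lambda>a. ln (cmod a)) ` A"
        then have "exp x \<notin> cmod ` A" by (auto simp: image_iff) (metis ln_exp)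
        then show "?f x = K x * \<psi>2 x + N x * \<psi> x" by simp
      qed
      show "?f x \<le> B x" if "x \<in> {\<alpha>..\<beta>}" for x using pt[OF that] by simp
    qed
    also have "\<dots> \<le> (1 + \<delta>) * (1 + 2 * \<delta>) * L * J + ((1 + \<delta>) * M1 + 3 * Q * C1)"
    proof -
      have "exp (- \<alpha>) \<le> 1" using len(3) by simp
      moreover have "0 \<le> exp (- \<beta>)" by simp
      ultimately have "exp (- \<alpha>) - exp (- \<beta>) \<le> 1" by linarith
      then have "M1 * (exp (- \<alpha>) - exp (- \<beta>)) \<le> M1 * 1" using M1 by (intro mult_left_mono)
      then have "(1 + \<delta>) * (len * J + M1 * (exp (- \<alpha>) - exp (- \<beta>))) \<le> (1 + \<delta>) * (len * J + M1)"
        using \<delta> by (intro mult_left_mono) auto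
      moreover have "len * (C1 * (3 * Q / len)) = 3 * Q * C1" using len by simp
      moreover have "(1 + \<delta>) * (len * J + M1) = (1 + \<delta>) * (1 + 2 * \<delta>) * L * J + (1 + \<delta>) * M1"
        by (simp add: len_def algebra_simps)
      ultimately show ?thesis by linarith
    qed
    finally have main: "?D \<le> (1 + \<delta>) * (1 + 2 * \<delta>) * L * J + ((1 + \<delta>) * M1 + 3 * Q * C1)" .
    have \<psi>0: "0 \<le> \<psi> x" if "x \<in> {\<alpha>..\<beta>}" for x
      using qb[OF y01[OF that]] by (simp add: \<psi>_def cut_def)
    have "(\<Sum>a | a \<in> A \<and> ln (cmod a) \<in> {\<sigma>..\<sigma> + L}. real (m a) * T (Arg a) / cmod a) \<le>
        (\<Sum>a | a \<in> A \<and> ln (cmod a) \<in> {\<sigma>..\<sigma> + L}. real (m a) * T (Arg a) * (if ln (cmod a) \<in> {\<alpha>..\<beta>} then \<psi> (ln (cmod a)) else 0))"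
    proof (rule sum_mono)
      fix a assume a: "a \<in> {a. a \<in> A \<and> ln (cmod a) \<in> {\<sigma>..\<sigma> + L}}"
      then have na: "0 < cmod a" using A(2) by auto
      have dl: "0 \<le> \<delta> * L" using \<delta> L by simp
      have in1: "ln (cmod a) \<in> {\<alpha>..\<beta>}" using a dl by (auto simp: \<alpha>_def \<beta>_def distrib_right)
      have "y (ln (cmod a)) \<in> {\<eta>..1 - \<eta>}"
      proof -
        have "\<eta> * len = \<delta> * L" using \<delta> by (simp add: \<eta>_def len_def)
        moreover have "(1 - \<eta>) * len = len - \<eta> * len" by (simp add: algebra_simps)
        ultimately have "\<eta> * len \<le> ln (cmod a) - \<alpha>" "ln (cmod a) - \<alpha> \<le> (1 - \<eta>) * len"
          using a by (auto simp: \<alpha>_def len_def algebra_simps)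
        then show ?thesis using len(2) by (auto simp: y_def pos_le_divide_eq pos_divide_le_eq)
      qed
      then have "1 \<le> cut (ln (cmod a))" unfolding cut_def by (rule q1)
      then have "exp (- ln (cmod a)) * 1 \<le> \<psi> (ln (cmod a))" unfolding \<psi>_def by (intro mult_left_mono) auto
      then have "1 / cmod a \<le> \<psi> (ln (cmod a))" using na by (simp add: exp_minus inverse_eq_divide)
      then have "real (m a) * T (Arg a) * (1 / cmod a) \<le> real (m a) * T (Arg a) * \<psi> (ln (cmod a))"
        using Tn(1)[of "Arg a"] by (intro mult_left_mono) auto
      then show "real (m a) * T (Arg a) / cmod a \<le> real (m a) * T (Arg a) * (if ln (cmod a) \<in> {\<alpha>..\<beta>} then \<psi> (ln (cmod a)) else 0)"
        using in1 by simp
    qed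
    also have "\<dots> \<le> ?D"
      using A(1) \<psi>0 Tn(1) by (intro sum_mono2) auto
    finally show "(\<Sum>a | a \<in> A \<and> ln (cmod a) \<in> {\<sigma>..\<sigma> + L}. real (m a) * T (Arg a) / cmod a) \<le>
        (1 + \<delta>) * (1 + 2 * \<delta>) * L * J + ((1 + \<delta>) * M1 + 3 * Q * C1)"
      using main by linarith
  qed
qed

end

section \<open>Trigonometric approximation of support functions\<close>

lemma integral_periodic_shift:
  fixes f :: "real \<Rightarrow> real"
  assumes f: "continuous_on UNIV f" and per: "\<And>x. f (x + p) = f x" and p: "0 \<le> p"
  shows "integral {0..p} (\<lambda>x. f (x + d)) = integral {0..p} f"
proof -
  define R where "R = \<bar>d\<bar> + p + 1"
  have R: "0 < R" using p by (simp add: R_def)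
  have fc: "continuous_on S f" for S using f continuous_on_subset by blast
  define A where "A x = integral {-R..x} f" for x
  have A: "(A has_real_derivative f x) (at x)" if "x \<in> {-R<..<R}" for x
  proof -
    have "(A has_real_derivative f x) (at x within {-R..R})"
      unfolding A_def[abs_def] using that by (intro integral_has_real_derivative fc) auto
    then show ?thesis using that by (simp add: at_within_Icc_at)
  qed
  have "\<exists>c. \<forall>x\<in>{-\<bar>d\<bar>..\<bar>d\<bar>}. A (x + p) - A x = c"
  proof (rule has_field_derivative_zero_constant)
    fix x assume x: "x \<in> {-\<bar>d\<bar>..\<bar>d\<bar>}"
    have "((\<lambda>x. A (x + p) - A x) has_real_derivative f (x + p) * 1 - f x) (at x)"
      by (intro derivative_intros A DERIV_chain2[where f = A and g = "\<lambda>x. x + p"])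
         (use x p in \<open>auto simp: R_def intro!: derivative_eq_intros\<close>)
    then show "((\<lambda>x. A (x + p) - A x) has_real_derivative 0) (at x within {-\<bar>d\<bar>..\<bar>d\<bar>})"
      using per by (simp add: has_field_derivative_at_within)
  qed simp
  then obtain c where c: "\<And>x. x \<in> {-\<bar>d\<bar>..\<bar>d\<bar>} \<Longrightarrow> A (x + p) - A x = c" by blast
  have dd: "d \<in> {-\<bar>d\<bar>..\<bar>d\<bar>}" "0 \<in> {-\<bar>d\<bar>..\<bar>d\<bar>}"
    using abs_ge_self[of d] abs_ge_minus_self[of d] by auto
  have "A (d + p) - A d = A (0 + p) - A 0" using c[OF dd(1)] c[OF dd(2)] by simp
  moreover have Ai: "A (x + p) - A x = integral {x..x + p} f" if "x \<in> {-\<bar>d\<bar>..\<bar>d\<bar>}" for x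
    using Henstock_Kurzweil_Integration.integral_combine[of "-R" x "x + p" f] that p
    by (simp add: A_def R_def integrable_continuous_real fc)
  moreover have "integral {0..p} (\<lambda>x. f (x + d)) = integral {0 + d..p + d} f"
    using integral_shift_Icc_real[of 0 p f d] by (simp add: o_def add.commute)
  ultimately show ?thesis using Ai[OF dd(1)] Ai[OF dd(2)] by (simp add: add.commute)
qed

text \<open>Despite the name, this is the de la Vallee Poussin kernel
  \<open>cos (x / 2) ^ (2 * N)\<close>, not normalized: nonnegative, and a trigonometric
  polynomial.\<close>

definition fejer :: "nat \<Rightarrow> real \<Rightarrow> real" where "fejer N x = ((1 + cos x) / 2) ^ N"

lemma fejer_nonneg: "0 \<le> fejer N x"
proof -
  have "0 \<le> 1 + cos x" using cos_ge_minus_one[of x] by linarith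
  then show ?thesis by (simp add: fejer_def)
qed

lemma fejer_continuous: "continuous_on S (fejer N)"
  unfolding fejer_def[abs_def] by (intro continuous_intros) auto

text \<open>Binomial expansion, from \<open>2 + 2 * cos x = (1 + cis x)^2 * cis (- x)\<close>.
  Absolute values appear because \<open>trig_poly\<close> has frequencies in the natural
  numbers.\<close>

lemma fejer_expansion:
  "fejer N x = (\<Sum>j\<le>2 * N. real ((2 * N) choose j) / 4 ^ N * cos (real (nat \<bar>int j - int N\<bar>) * x))"
proof -
  have "(1 + cis x)\<^sup>2 * cis (- x) = of_real (2 + 2 * cos x)"
  proof -
    have "(1 + cis x)\<^sup>2 * cis (- x) = cis (- x) + 2 * (cis x * cis (- x)) + cis x * (cis x * cis (- x))"
      by (simp add: power2_eq_square algebra_simps)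
    also have "\<dots> = cis (- x) + 2 + cis x" by (simp add: cis_mult)
    finally show ?thesis by (simp add: complex_eq_iff)
  qed
  then have "((1 + cis x)\<^sup>2 * cis (- x)) ^ N = of_real ((2 + 2 * cos x) ^ N)" by simp
  also have "(2 + 2 * cos x) ^ N = 4 ^ N * fejer N x"
  proof -
    have "2 + 2 * cos x = 4 * ((1 + cos x) / 2)" by simp
    then show ?thesis by (simp only: fejer_def power_mult_distrib)
  qed
  finally have 1: "(1 + cis x) ^ (2 * N) * cis (- (real N * x)) = of_real (4 ^ N * fejer N x)"
    by (simp add: power_mult_distrib power_mult Complex.DeMoivre)
  have "(cis x + 1) ^ (2 * N) = (\<Sum>j\<le>2 * N. of_nat ((2 * N) choose j) * cis x ^ j * 1 ^ (2 * N - j))"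
    by (rule binomial_ring)
  then have "(1 + cis x) ^ (2 * N) * cis (- (real N * x)) =
      (\<Sum>j\<le>2 * N. of_nat ((2 * N) choose j) * (cis (real j * x) * cis (- (real N * x))))"
    by (simp add: add.commute Complex.DeMoivre sum_distrib_right mult.assoc)
  also have "\<dots> = (\<Sum>j\<le>2 * N. of_real (real ((2 * N) choose j)) * cis (real_of_int (int j - int N) * x))"
    by (simp add: cis_mult left_diff_distrib)
  finally have "4 ^ N * fejer N x = Re (\<Sum>j\<le>2 * N. of_real (real ((2 * N) choose j)) * cis (real_of_int (int j - int N) * x))"
    using 1 by (metis Re_complex_of_real)
  also have "\<dots> = (\<Sum>j\<le>2 * N. real ((2 * N) choose j) * cos (real_of_int (int j - int N) * x))"
    by (simp only: Re_sum Re_complex_of_real times_complex.sel Im_complex_of_real cis.sel mult_zero_left diff_zero)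
  also have "\<dots> = (\<Sum>j\<le>2 * N. real ((2 * N) choose j) * cos (real (nat \<bar>int j - int N\<bar>) * x))"
  proof (intro sum.cong refl arg_cong2[where f = "(*)"])
    fix j
    have ca: "cos (y * x) = cos (\<bar>y\<bar> * x)" for y :: real
      by (cases "0 \<le> y") auto
    have "real (nat \<bar>int j - int N\<bar>) = \<bar>real_of_int (int j - int N)\<bar>" by simp
    then show "cos (real_of_int (int j - int N) * x) = cos (real (nat \<bar>int j - int N\<bar>) * x)"
      using ca[of "real_of_int (int j - int N)"] by (simp only:)
  qed
  finally show ?thesis by (simp add: sum_divide_distrib[symmetric] field_simps)
qed

text \<open>Integrate the derivative of \<open>fejer N x * sin x\<close> over a period. In
  probabilistic terms, the mean of \<open>sin (x / 2) ^ 2\<close> under the normalized kernel is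
  \<open>1 / (2 * N + 2)\<close>, which is the concentration used for approximation.\<close>

lemma fejer_mean_recurrence:
  "real (2 * N + 2) * integral {0..2*pi} (fejer (Suc N)) = real (2 * N + 1) * integral {0..2*pi} (fejer N)"
proof -
  have d: "((\<lambda>x. fejer N x * sin x) has_real_derivative (real (2 * N + 2) * fejer (Suc N) x - real (2 * N + 1) * fejer N x)) (at x)" for x
  proof -
    define c where "c = (1 + cos x) / 2"
    have s: "sin x * sin x = 4 * c * (1 - c)"
    proof -
      have "4 * c * (1 - c) = 1 - (cos x)\<^sup>2" by (simp add: c_def power2_eq_square field_simps)
      then show ?thesis using sin_squared_eq[of x] by (simp add: power2_eq_square)
    qed
    have cc: "cos x = 2 * c - 1" by (simp add: c_def field_simps)
    have "((\<lambda>x. fejer N x * sin x) has_real_derivative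
        (real N * c ^ (N - 1) * (- sin x / 2)) * sin x + c ^ N * cos x) (at x)"
      unfolding fejer_def[abs_def] by (auto intro!: derivative_eq_intros simp: c_def)
    moreover have "(real N * c ^ (N - 1) * (- sin x / 2)) * sin x + c ^ N * cos x
        = - 2 * (real N * c ^ N) * (1 - c) + c ^ N * (2 * c - 1)"
    proof -
      have "(real N * c ^ (N - 1) * (- sin x / 2)) * sin x = - (real N * c ^ (N - 1) * (sin x * sin x) / 2)" by simp
      also have "\<dots> = - 2 * (real N * (c ^ (N - 1) * c)) * (1 - c)" unfolding s by simp
      also have "real N * (c ^ (N - 1) * c) = real N * c ^ N" by (cases N) auto
      finally show ?thesis unfolding cc by simp
    qed
    moreover have "- 2 * (real N * c ^ N) * (1 - c) + c ^ N * (2 * c - 1) = real (2 * N + 2) * (c * c ^ N) - real (2 * N + 1) * c ^ N"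
      by (simp add: algebra_simps)
    ultimately show ?thesis by (simp add: fejer_def c_def mult.assoc)
  qed
  have "((\<lambda>x. real (2 * N + 2) * fejer (Suc N) x - real (2 * N + 1) * fejer N x) has_integral
      fejer N (2*pi) * sin (2*pi) - fejer N 0 * sin 0) {0..2*pi}"
    by (rule fundamental_theorem_of_calculus)
       (use d in \<open>auto simp flip: has_real_derivative_iff_has_vector_derivative intro: has_field_derivative_at_within\<close>)
  then have z: "((\<lambda>x. real (2 * N + 2) * fejer (Suc N) x - real (2 * N + 1) * fejer N x) has_integral 0) {0..2*pi}"
    by simp
  have i: "(fejer k has_integral integral {0..2*pi} (fejer k)) {0..2*pi}" for k
    by (intro integrable_integral integrable_continuous_real fejer_continuous)
  from has_integral_unique[OF z has_integral_diff[OF has_integral_mult_right[OF i] has_integral_mult_right[OF i]]]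
  show ?thesis by simp
qed

lemma fejer_mean_pos: "0 < integral {0..2*pi} (fejer N)"
proof (induction N)
  case (Suc N)
  have "0 < real (2 * N + 2) * integral {0..2*pi} (fejer (Suc N))"
    unfolding fejer_mean_recurrence using Suc by (intro mult_pos_pos) auto
  then show ?case by (simp add: zero_less_mult_iff)
qed (simp add: fejer_def)

text \<open>The symmetric difference \<Phi> has value and slope 0 at \<open>d = 0\<close> and second
  derivative \<open>2 * (f \<theta> + f2 \<theta>)\<close> there. As continuity of \<open>f2\<close>
  is not assumed, the sign of \<open>\<Phi>1\<close> just to the right of 0 replaces Taylor's
  formula.\<close>

lemma second_difference_nonneg:
  fixes f f1 f2 :: "real \<Rightarrow> real"
  assumes f: "\<And>x. (f has_real_derivative f1 x) (at x)" "\<And>x. (f1 has_real_derivative f2 x) (at x)"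
    and e: "0 < e" "\<And>d. 0 < d \<Longrightarrow> d < e \<Longrightarrow> 2 * cos d * f \<theta> \<le> f (\<theta> + d) + f (\<theta> - d)"
  shows "0 \<le> f \<theta> + f2 \<theta>"
proof (rule ccontr)
  assume neg: "\<not> 0 \<le> f \<theta> + f2 \<theta>"
  define \<Phi> \<Phi>1 where "\<Phi> d = f (\<theta> + d) + f (\<theta> - d) - 2 * cos d * f \<theta>"
    and "\<Phi>1 d = f1 (\<theta> + d) - f1 (\<theta> - d) + 2 * sin d * f \<theta>" for d
  have sh: "((\<lambda>d. h (\<theta> + d)) has_real_derivative h' (\<theta> + d)) (at d)"
    "((\<lambda>d. h (\<theta> - d)) has_real_derivative - h' (\<theta> - d)) (at d)"
    if "\<And>x. (h has_real_derivative h' x) (at x)" for h h' :: "real \<Rightarrow> real" and d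
  proof -
    have "((\<lambda>d. \<theta> + d) has_real_derivative 1) (at d)" "((\<lambda>d. \<theta> - d) has_real_derivative - 1) (at d)"
      by (auto intro!: derivative_eq_intros)
    from DERIV_chain2[OF that this(1)] DERIV_chain2[OF that this(2)]
    show "((\<lambda>d. h (\<theta> + d)) has_real_derivative h' (\<theta> + d)) (at d)"
      "((\<lambda>d. h (\<theta> - d)) has_real_derivative - h' (\<theta> - d)) (at d)" by simp_all
  qed
  have d1: "(\<Phi> has_real_derivative \<Phi>1 d) (at d)" for d
    unfolding \<Phi>_def[abs_def] \<Phi>1_def by (rule derivative_eq_intros sh f refl)+ simp
  have d2: "(\<Phi>1 has_real_derivative (f2 (\<theta> + 0) - - f2 (\<theta> - 0)) + 2 * cos 0 * f \<theta>) (at 0)"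
    unfolding \<Phi>1_def[abs_def] by (rule derivative_eq_intros sh f refl)+ simp
  have "(f2 (\<theta> + 0) - - f2 (\<theta> - 0)) + 2 * cos 0 * f \<theta> < 0" using neg by simp
  from DERIV_neg_dec_right[OF d2 this] obtain e' where e': "0 < e'" "\<And>h. 0 < h \<Longrightarrow> h < e' \<Longrightarrow> \<Phi>1 h < 0"
    by (auto simp: \<Phi>1_def)
  define h where "h = min e e' / 2"
  have h: "0 < h" "h < e" "h < e'" using e e' by (auto simp: h_def)
  have "\<Phi> h < \<Phi> 0"
  proof (rule DERIV_neg_imp_decreasing_open[OF h(1)])
    fix x assume "0 < x" "x < h"
    then show "\<exists>y. (\<Phi> has_real_derivative y) (at x) \<and> y < 0" using d1 e'(2)[of x] h by force
  next
    show "continuous_on {0..h} \<Phi>" by (intro DERIV_continuous_on[OF has_field_derivative_at_within[OF d1]])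
  qed
  then show False using e(2)[OF h(1,2)] by (simp add: \<Phi>_def)
qed

text \<open>The inequality on \<open>g\<close> is the weak form of \<open>g + g'' \<ge> 0\<close>.
  Being linear and invariant under translations, it survives convolution with a nonnegative kernel,
  and convolution with this kernel yields a trigonometric polynomial.\<close>

lemma trig_convex_approx:
  fixes g :: "real \<Rightarrow> real"
  assumes per: "\<And>\<theta>. g (\<theta> + 2 * pi) = g \<theta>"
    and lip: "\<And>\<theta> \<phi>. \<bar>g \<theta> - g \<phi>\<bar> \<le> B * cmod (cis \<theta> - cis \<phi>)"
    and conv: "\<And>\<theta> d. 0 \<le> cos d \<Longrightarrow> 2 * cos d * g \<theta> \<le> g (\<theta> + d) + g (\<theta> - d)"
    and \<epsilon>: "0 < \<epsilon>"
  obtains G G1 G2 where "trig_poly G G1 G2" "\<And>\<theta>. g \<theta> < G \<theta>" "\<And>\<theta>. G \<theta> < g \<theta> + \<epsilon>" "\<And>\<theta>. 0 < G \<theta> + G2 \<theta>"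
proof -
  have gc: "continuous_on S g" for S
  proof (rule continuous_at_imp_continuous_on, rule ballI)
    fix x
    have "(\<lambda>y. B * cmod (cis y - cis x)) \<midarrow>x\<rightarrow> B * cmod (cis x - cis x)"
      by (intro tendsto_intros)
    then have "(\<lambda>y. B * cmod (cis y - cis x)) \<midarrow>x\<rightarrow> 0" by simp
    moreover have "\<forall>\<^sub>F y in at x. norm (g y - g x) \<le> B * cmod (cis y - cis x)"
      by (rule always_eventually) (simp only: real_norm_def lip simp_thms)
    ultimately have "(\<lambda>y. g y - g x) \<midarrow>x\<rightarrow> 0"
      by (rule Lim_null_comparison[rotated])
    then show "isCont g x" by (simp add: isCont_def LIM_zero_iff)
  qed
  define \<eta> where "\<eta> = \<epsilon> / 8"
  have \<eta>: "0 < \<eta>" using \<epsilon> by (simp add: \<eta>_def)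
  obtain N :: nat where N: "B\<^sup>2 / \<eta>\<^sup>2 < real N" using reals_Archimedean2 by blast
  define W where "W = integral {0..2*pi} (fejer N)"
  have W: "0 < W" unfolding W_def by (rule fejer_mean_pos)
  have kc: "continuous_on S (\<lambda>\<phi>. fejer k (\<theta> - \<phi>))" for S k \<theta>
    by (intro continuous_on_compose2[OF fejer_continuous[of UNIV]] continuous_intros) auto
  have kper: "fejer k (x + 2 * pi) = fejer k x" for k x by (simp add: fejer_def)
  have Wk: "integral {0..2*pi} (\<lambda>\<phi>. fejer k (\<theta> - \<phi>)) = integral {0..2*pi} (fejer k)" for k \<theta>
  proof -
    have "fejer k (\<theta> - \<phi>) = fejer k (\<phi> + (- \<theta>))" for \<phi>
      using cos_minus[of "\<theta> - \<phi>"] by (simp add: fejer_def)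
    then show ?thesis using integral_periodic_shift[OF fejer_continuous kper, where d = "- \<theta>"] by simp
  qed
  define H where "H \<theta> = integral {0..2*pi} (\<lambda>\<phi>. g \<phi> * fejer N (\<theta> - \<phi>))" for \<theta>
  have Hi: "((\<lambda>\<phi>. g \<phi> * fejer N (\<theta> - \<phi>)) has_integral H \<theta>) {0..2*pi}" for \<theta>
    unfolding H_def by (intro integrable_integral integrable_continuous_real continuous_intros gc kc)
  define nn where "nn j = nat \<bar>int j - int N\<bar>" for j
  define cc where "cc j = real ((2 * N) choose j) / 4 ^ N" for j
  define \<tau> where "\<tau> n = integral {0..2*pi} (\<lambda>\<phi>. of_real (g \<phi>) * cis (- (real n * \<phi>)))" for n
  have \<tau>: "((\<lambda>\<phi>. of_real (g \<phi>) * cis (- (real n * \<phi>))) has_integral \<tau> n) {0..2*pi}" for n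
    unfolding \<tau>_def by (intro integrable_integral integrable_continuous_real continuous_intros gc)
  have ci: "((\<lambda>\<phi>. g \<phi> * cos (real n * (\<theta> - \<phi>))) has_integral Re (\<tau> n * cis (real n * \<theta>))) {0..2*pi}" for n \<theta>
  proof -
    have "((\<lambda>\<phi>. Re (of_real (g \<phi>) * cis (- (real n * \<phi>)) * cis (real n * \<theta>))) has_integral Re (\<tau> n * cis (real n * \<theta>))) {0..2*pi}"
      by (intro has_integral_Re has_integral_mult_left \<tau>)
    moreover have "Re (of_real (g \<phi>) * cis (- (real n * \<phi>)) * cis (real n * \<theta>)) = g \<phi> * cos (real n * (\<theta> - \<phi>))" for \<phi>
      unfolding mult.assoc cis_mult by (simp add: algebra_simps)
    ultimately show ?thesis by (simp only:)
  qed
  have Hsum: "H \<theta> / W = (\<Sum>j\<le>2 * N. Re ((of_real (cc j / W) * \<tau> (nn j)) * cis (real (nn j) * \<theta>)))" for \<theta>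
  proof -
    have "((\<lambda>\<phi>. \<Sum>j\<le>2 * N. cc j * (g \<phi> * cos (real (nn j) * (\<theta> - \<phi>)))) has_integral
        (\<Sum>j\<le>2 * N. cc j * Re (\<tau> (nn j) * cis (real (nn j) * \<theta>)))) {0..2*pi}"
      by (intro has_integral_sum has_integral_mult_right ci) auto
    moreover have "(\<Sum>j\<le>2 * N. cc j * (g \<phi> * cos (real (nn j) * (\<theta> - \<phi>)))) = g \<phi> * fejer N (\<theta> - \<phi>)" for \<phi>
      by (simp add: fejer_expansion cc_def nn_def sum_distrib_left mult_ac)
    ultimately have "H \<theta> = (\<Sum>j\<le>2 * N. cc j * Re (\<tau> (nn j) * cis (real (nn j) * \<theta>)))"
      using has_integral_unique[OF Hi] by simp
    moreover have "Re ((of_real (cc j / W) * \<tau> (nn j)) * cis (real (nn j) * \<theta>)) = cc j * Re (\<tau> (nn j) * cis (real (nn j) * \<theta>)) / W" for j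
      unfolding mult.assoc by (simp del: of_real_divide)
    ultimately show ?thesis by (simp only: sum_divide_distrib)
  qed
  have "\<exists>H1 H2. trig_poly (\<lambda>\<theta>. H \<theta> / W) H1 H2"
    unfolding Hsum by (intro exI, rule trig_poly_sum, rule trig_poly.monomial)
  then obtain H1 H2 where tp: "trig_poly (\<lambda>\<theta>. H \<theta> / W) H1 H2" by blast
  have shift: "H (\<theta> + d) = integral {0..2*pi} (\<lambda>\<phi>. g (\<phi> + d) * fejer N (\<theta> - \<phi>))" for \<theta> d
  proof -
    have "continuous_on UNIV (\<lambda>\<phi>. g \<phi> * fejer N (\<theta> + d - \<phi>))" by (intro continuous_intros gc kc)
    moreover have "g (\<phi> + 2 * pi) * fejer N (\<theta> + d - (\<phi> + 2 * pi)) = g \<phi> * fejer N (\<theta> + d - \<phi>)" for \<phi>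
    proof -
      have "\<theta> + d - (\<phi> + 2 * pi) + 2 * pi = \<theta> + d - \<phi>" by simp
      then show ?thesis using kper[of N "\<theta> + d - (\<phi> + 2 * pi)"] by (simp only: per)
    qed
    ultimately show ?thesis
      unfolding H_def using integral_periodic_shift[of "\<lambda>\<phi>. g \<phi> * fejer N (\<theta> + d - \<phi>)" "2*pi" d] by simp
  qed
  have Hconv: "2 * cos d * (H \<theta> / W) \<le> H (\<theta> + d) / W + H (\<theta> - d) / W" if d: "0 \<le> cos d" for \<theta> d
  proof -
    have gs: "continuous_on S (\<lambda>\<phi>. g (\<phi> + c))" for S c
      by (intro continuous_on_compose2[OF gc[of UNIV]] continuous_intros) auto
    have "((\<lambda>\<phi>. g (\<phi> + c) * fejer N (\<theta> - \<phi>)) has_integral H (\<theta> + c)) {0..2*pi}" for c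
      unfolding shift by (intro integrable_integral integrable_continuous_real continuous_intros gs kc)
    from has_integral_add[OF this[of d] this[of "- d"]]
    have "((\<lambda>\<phi>. g (\<phi> + d) * fejer N (\<theta> - \<phi>) + g (\<phi> - d) * fejer N (\<theta> - \<phi>)) has_integral H (\<theta> + d) + H (\<theta> - d)) {0..2*pi}"
      by simp
    from has_integral_le[OF has_integral_mult_right[OF Hi, of "2 * cos d"] this]
    have "2 * cos d * H \<theta> \<le> H (\<theta> + d) + H (\<theta> - d)"
      using mult_right_mono[OF conv[OF d] fejer_nonneg[of N]] by (simp add: distrib_right mult.assoc)
    then show ?thesis using W by (simp add: field_simps)
  qed
  have H2: "0 \<le> H \<theta> / W + H2 \<theta>" for \<theta>
    by (rule second_difference_nonneg[OF trig_poly_deriv(1)[OF tp] trig_poly_deriv(2)[OF tp], where e = "pi / 2"])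
       (use Hconv cos_ge_zero in auto)
  have close: "\<bar>H \<theta> / W - g \<theta>\<bar> \<le> 2 * \<eta>" for \<theta>
  proof -
    let ?k = "\<lambda>k \<phi>. fejer k (\<theta> - \<phi>)"
    have ki: "(?k k has_integral integral {0..2*pi} (fejer k)) {0..2*pi}" for k
      unfolding Wk[of k \<theta>, symmetric] by (intro integrable_integral integrable_continuous_real kc)
    have rec: "integral {0..2*pi} (fejer (Suc N)) = W - W / real (2 * N + 2)"
    proof -
      define n where "n = real (2 * N + 2)"
      have n: "n \<noteq> 0" "real (2 * N + 1) = n - 1" by (simp_all add: n_def)
      have "n * integral {0..2*pi} (fejer (Suc N)) = (n - 1) * W"
        using fejer_mean_recurrence[of N] unfolding W_def[symmetric] n(2) n_def[symmetric] .
      then have "integral {0..2*pi} (fejer (Suc N)) = (n - 1) * W / n"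
        using n(1) by (metis nonzero_mult_div_cancel_left)
      then show ?thesis unfolding n_def[symmetric] using n(1) by (simp add: diff_divide_distrib left_diff_distrib)
    qed
    \<comment> \<open>Chebyshev's argument: the Lipschitz bound \<open>B * D\<close> is at most
      \<open>\<eta> + B^2 * D^2 / (4 * \<eta>)\<close>, and \<open>D^2 / 4\<close> times the kernel
      is the difference of two consecutive kernels, whose integral the recurrence gives
      exactly.\<close>
    have bound: "\<bar>(g \<phi> - g \<theta>) * ?k N \<phi>\<bar> \<le> \<eta> * ?k N \<phi> + B\<^sup>2 / \<eta> * (?k N \<phi> - ?k (Suc N) \<phi>)" for \<phi>
    proof -
      define D where "D = cmod (cis \<phi> - cis \<theta>)"
      have D2: "D\<^sup>2 = 4 * (1 - (1 + cos (\<theta> - \<phi>)) / 2)"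
      proof -
        have "D\<^sup>2 = (cos \<phi> - cos \<theta>)\<^sup>2 + (sin \<phi> - sin \<theta>)\<^sup>2" by (simp add: D_def cmod_power2)
        also have "\<dots> = (cos \<phi>)\<^sup>2 + (sin \<phi>)\<^sup>2 + ((cos \<theta>)\<^sup>2 + (sin \<theta>)\<^sup>2) - 2 * (cos \<theta> * cos \<phi> + sin \<theta> * sin \<phi>)"
          by (simp add: power2_eq_square algebra_simps)
        finally have "D\<^sup>2 = 2 - 2 * cos (\<theta> - \<phi>)" by (simp add: cos_diff)
        then show ?thesis by (simp add: field_simps)
      qed
      have "\<bar>g \<phi> - g \<theta>\<bar> \<le> B * D" using lip by (simp add: D_def)
      also have "\<dots> \<le> \<eta> + B\<^sup>2 / \<eta> * (D\<^sup>2 / 4)"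
      proof -
        have "0 \<le> (2 * \<eta> - B * D)\<^sup>2" by simp
        then have "4 * \<eta> * (B * D) \<le> 4 * \<eta>\<^sup>2 + (B * D)\<^sup>2" by (simp add: power2_eq_square algebra_simps)
        then have "4 * \<eta> * (B * D) / (4 * \<eta>) \<le> (4 * \<eta>\<^sup>2 + (B * D)\<^sup>2) / (4 * \<eta>)" using \<eta> by (intro divide_right_mono) auto
        then show ?thesis using \<eta> by (simp add: power2_eq_square add_divide_distrib mult_ac)
      qed
      finally have "\<bar>g \<phi> - g \<theta>\<bar> * ?k N \<phi> \<le> (\<eta> + B\<^sup>2 / \<eta> * (D\<^sup>2 / 4)) * ?k N \<phi>"
        by (intro mult_right_mono fejer_nonneg)
      moreover have "D\<^sup>2 / 4 * ?k N \<phi> = ?k N \<phi> - ?k (Suc N) \<phi>"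
      proof -
        have "D\<^sup>2 / 4 = 1 - (1 + cos (\<theta> - \<phi>)) / 2" unfolding D2 by simp
        moreover have "?k (Suc N) \<phi> = (1 + cos (\<theta> - \<phi>)) / 2 * ?k N \<phi>" by (simp add: fejer_def)
        ultimately show ?thesis by (simp only: left_diff_distrib mult_1)
      qed
      then have "(\<eta> + B\<^sup>2 / \<eta> * (D\<^sup>2 / 4)) * ?k N \<phi> = \<eta> * ?k N \<phi> + B\<^sup>2 / \<eta> * (?k N \<phi> - ?k (Suc N) \<phi>)"
        by (metis distrib_right mult.assoc)
      ultimately show ?thesis using fejer_nonneg[of N "\<theta> - \<phi>"] by (simp add: abs_mult)
    qed
    have Bi: "((\<lambda>\<phi>. \<eta> * ?k N \<phi> + B\<^sup>2 / \<eta> * (?k N \<phi> - ?k (Suc N) \<phi>)) has_integral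
        \<eta> * W + B\<^sup>2 / \<eta> * (W - (W - W / real (2 * N + 2)))) {0..2*pi}"
      using ki[of N] ki[of "Suc N"] unfolding rec W_def[symmetric]
      by (intro has_integral_add has_integral_mult_right has_integral_diff)
    have Ai: "((\<lambda>\<phi>. (g \<phi> - g \<theta>) * ?k N \<phi>) has_integral H \<theta> - g \<theta> * W) {0..2*pi}"
      unfolding left_diff_distrib W_def by (intro has_integral_diff has_integral_mult_right Hi ki)
    have "H \<theta> - g \<theta> * W \<le> \<eta> * W + B\<^sup>2 / \<eta> * (W - (W - W / real (2 * N + 2)))"
      by (rule has_integral_le[OF Ai Bi]) (use bound abs_le_D1 in blast)
    moreover have "- (H \<theta> - g \<theta> * W) \<le> \<eta> * W + B\<^sup>2 / \<eta> * (W - (W - W / real (2 * N + 2)))"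
      by (rule has_integral_le[OF has_integral_neg[OF Ai] Bi]) (use bound abs_le_D2 in blast)
    ultimately have "\<bar>H \<theta> - g \<theta> * W\<bar> \<le> \<eta> * W + B\<^sup>2 / \<eta> * (W / real (2 * N + 2))" by simp
    also have "\<dots> \<le> \<eta> * W + \<eta> * W"
    proof -
      have "B\<^sup>2 / \<eta>\<^sup>2 \<le> real (2 * N + 2)" using N by simp
      then have "B\<^sup>2 \<le> \<eta> * (\<eta> * real (2 * N + 2))" using \<eta> by (simp add: power2_eq_square pos_divide_le_eq mult_ac)
      then have "B\<^sup>2 / \<eta> \<le> \<eta> * real (2 * N + 2)" using \<eta> by (simp add: pos_divide_le_eq mult_ac)
      then have "B\<^sup>2 / \<eta> * (W / real (2 * N + 2)) \<le> \<eta> * real (2 * N + 2) * (W / real (2 * N + 2))"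
        using W by (intro mult_right_mono) auto
      also have "\<dots> = \<eta> * W" by simp
      finally show ?thesis by (rule add_left_mono)
    qed
    finally have "\<bar>H \<theta> - g \<theta> * W\<bar> / W \<le> (\<eta> * W + \<eta> * W) / W" using W by (intro divide_right_mono) auto
    moreover have "\<bar>H \<theta> - g \<theta> * W\<bar> / W = \<bar>H \<theta> / W - g \<theta>\<bar>"
    proof -
      have "H \<theta> / W - g \<theta> = (H \<theta> - g \<theta> * W) / W" using W by (simp add: diff_divide_distrib)
      then show ?thesis using W by (simp only: abs_divide abs_of_pos)
    qed
    ultimately show ?thesis using W by simp
  qed
  show thesis
  proof (rule that)
    \<comment> \<open>With an error of at most \<open>2 * \<eta>\<close>, the shift by
      \<open>4 * \<eta>\<close> places the result above \<open>g\<close> and at most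
      \<open>6 * \<eta> < \<epsilon>\<close> away; it also makes \<open>G + G2\<close> strictly
      positive.\<close>
    have c: "trig_poly (\<lambda>\<theta>. 4 * \<eta>) (\<lambda>\<theta>. 0) (\<lambda>\<theta>. 0)"
      using trig_poly.monomial[of "of_real (4 * \<eta>)" 0] by simp
    show "trig_poly (\<lambda>\<theta>. H \<theta> / W + 4 * \<eta>) (\<lambda>\<theta>. H1 \<theta> + 0) (\<lambda>\<theta>. H2 \<theta> + 0)"
      by (rule trig_poly.add[OF tp c])
    show "g \<theta> < H \<theta> / W + 4 * \<eta>" "H \<theta> / W + 4 * \<eta> < g \<theta> + \<epsilon>" "0 < H \<theta> / W + 4 * \<eta> + (H2 \<theta> + 0)" for \<theta>
      using abs_le_D1[OF close[of \<theta>]] abs_le_D2[OF close[of \<theta>]] H2[of \<theta>] \<eta> \<eta>_def by linarith+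
  qed
qed

section \<open>Area of a convex set and its support function\<close>

lemma emeasure_lborel_complex:
  assumes "W \<in> sets (borel :: complex measure)"
  shows "emeasure lborel W = (\<integral>\<^sup>+ x. emeasure lborel {y. Complex x y \<in> W} \<partial>lborel)"
proof -
  let ?f = "\<lambda>p. Complex (fst p) (snd p)"
  have m: "?f \<in> (lborel \<Otimes>\<^sub>M lborel) \<rightarrow>\<^sub>M borel"
  proof -
    have "?f \<in> borel_measurable borel"
      unfolding Complex_eq by (intro borel_measurable_continuous_onI continuous_intros)
    then show ?thesis by (simp add: lborel_prod)
  qed
  have eq: "lborel = distr (lborel \<Otimes>\<^sub>M lborel) borel ?f"
  proof (rule lborel_eqI)
    fix l u :: complex assume le: "\<And>b. b \<in> Basis \<Longrightarrow> l \<bullet> b \<le> u \<bullet> b"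
    have lu: "Re l \<le> Re u" "Im l \<le> Im u" using le[of 1] le[of \<i>] by (auto simp: Basis_complex_def)
    have "?f -` box l u \<inter> space (lborel \<Otimes>\<^sub>M lborel) = {Re l<..<Re u} \<times> {Im l<..<Im u}"
      by (auto simp: box_def Basis_complex_def space_pair_measure)
    then show "emeasure (distr (lborel \<Otimes>\<^sub>M lborel) borel ?f) (box l u) = ennreal (\<Prod>b\<in>Basis. (u - l) \<bullet> b)"
      using lu by (simp add: emeasure_distr[OF m] lborel.emeasure_pair_measure_Times Basis_complex_def ennreal_mult)
  qed simp
  have "emeasure lborel W = emeasure (lborel \<Otimes>\<^sub>M lborel) (?f -` W \<inter> space (lborel \<Otimes>\<^sub>M lborel))"
    by (subst eq) (rule emeasure_distr[OF m assms])
  also have "\<dots> = (\<integral>\<^sup>+ x. emeasure lborel (Pair x -` (?f -` W \<inter> space (lborel \<Otimes>\<^sub>M lborel))) \<partial>lborel)"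
    by (rule lborel.emeasure_pair_measure_alt) (rule measurable_sets[OF m assms])
  also have "\<dots> = (\<integral>\<^sup>+ x. emeasure lborel {y. Complex x y \<in> W} \<partial>lborel)"
    by (intro nn_integral_cong arg_cong2[where f = emeasure] refl) (auto simp: space_pair_measure)
  finally show ?thesis .
qed

text \<open>With \<open>X\<close> strictly decreasing, \<open>f\<close> is \<open>Y\<close> composed
  with the inverse of \<open>X\<close>, and the integral is a substitution. The sign of
  \<open>X1\<close> is required only inside the interval, as in the application it vanishes at both
  ends.\<close>

lemma decreasing_curve_graph:
  fixes X Y X1 :: "real \<Rightarrow> real"
  assumes pq: "p \<le> q" and X: "\<And>t. t \<in> {p..q} \<Longrightarrow> (X has_real_derivative X1 t) (at t)"
    and Y: "continuous_on {p..q} Y" and neg: "\<And>t. t \<in> {p<..<q} \<Longrightarrow> X1 t < 0"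
  obtains f where "continuous_on {X q..X p} f" "\<And>x. x \<in> {X q..X p} \<Longrightarrow> \<exists>t\<in>{p..q}. x = X t \<and> f x = Y t"
    "((\<lambda>t. Y t * (- X1 t)) has_integral integral {X q..X p} f) {p..q}" "X q \<le> X p"
proof -
  have Xc: "continuous_on {p..q} X"
    using X by (meson DERIV_isCont continuous_at_imp_continuous_on)
  have dec: "X t < X s" if "s < t" "s \<in> {p..q}" "t \<in> {p..q}" for s t
  proof (rule DERIV_neg_imp_decreasing_open[OF that(1)])
    show "\<exists>y. (X has_real_derivative y) (at x) \<and> y < 0" if "s < x" "x < t" for x
      using X[of x] neg[of x] that \<open>s \<in> {p..q}\<close> \<open>t \<in> {p..q}\<close> by force
    show "continuous_on {s..t} X" using that by (intro continuous_on_subset[OF Xc]) auto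
  qed
  have inj: "inj_on X {p..q}" by (intro inj_onI) (metis dec linorder_neqE_linordered_idom order_less_irrefl)
  have le: "X t \<le> X s" if "s \<le> t" "s \<in> {p..q}" "t \<in> {p..q}" for s t
    using dec[of s t] that by (cases "s = t") auto
  have im: "X ` {p..q} = {X q..X p}"
  proof
    show "X ` {p..q} \<subseteq> {X q..X p}" using le pq by auto
    show "{X q..X p} \<subseteq> X ` {p..q}"
    proof
      fix y assume "y \<in> {X q..X p}"
      then show "y \<in> X ` {p..q}" using IVT2'[of X q y p] pq Xc by auto
    qed
  qed
  define h where "h = inv_into {p..q} X"
  have hX: "h (X t) = t" if "t \<in> {p..q}" for t unfolding h_def using inj that by (rule inv_into_f_f)
  have hc: "continuous_on (X ` {p..q}) h"
    by (rule continuous_on_inv[OF Xc]) (use hX in auto)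
  have fc: "continuous_on {X q..X p} (\<lambda>x. Y (h x))"
    using hX unfolding im[symmetric] by (intro continuous_on_compose2[OF Y hc]) auto
  show thesis
  proof (rule that[of "\<lambda>x. Y (h x)"])
    show "\<exists>t\<in>{p..q}. x = X t \<and> Y (h x) = Y t" if "x \<in> {X q..X p}" for x
      using that hX unfolding im[symmetric] by auto
    show Xle: "X q \<le> X p" using le pq by auto
    have sub: "((\<lambda>t. X1 t *\<^sub>R Y (h (X t))) has_integral (integral {X p..X q} (\<lambda>x. Y (h x)) - integral {X q..X p} (\<lambda>x. Y (h x)))) {p..q}"
      by (rule has_integral_substitution_general[of "{}" p q X "X q" "X p"])
         (use pq Xle im fc Xc X in \<open>auto intro: has_field_derivative_at_within\<close>)
    have z: "integral {X p..X q} (\<lambda>x. Y (h x)) = 0"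
      using Xle by (cases "X p = X q") auto
    have "((\<lambda>t. - (X1 t *\<^sub>R Y (h (X t)))) has_integral integral {X q..X p} (\<lambda>x. Y (h x))) {p..q}"
      using has_integral_neg[OF sub] unfolding z by simp
    then show "((\<lambda>t. Y t * (- X1 t)) has_integral integral {X q..X p} (\<lambda>x. Y (h x))) {p..q}"
      by (rule has_integral_eq[rotated]) (simp add: hX)
  qed (rule fc)
qed

lemma trig_poly_cis_eq:
  assumes "trig_poly T T1 T2" "cis \<phi> = cis \<psi>"
  shows "T \<phi> = T \<psi>"
proof -
  have "cis (real n * \<phi>) = cis (real n * \<psi>)" for n using assms(2) by (metis Complex.DeMoivre)
  with assms(1) show ?thesis by induction (simp_all only:)
qed

text \<open>Says that the point of contact with the support line in direction \<theta> obeys the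
  support inequalities in all directions, i.e. lies in the body with support function
  \<open>G\<close>.\<close>

lemma trig_poly_tangent_le:
  assumes G: "trig_poly G G1 G2" and pos: "\<And>\<theta>. 0 \<le> G \<theta> + G2 \<theta>"
  shows "G \<theta> * cos (\<phi> - \<theta>) + G1 \<theta> * sin (\<phi> - \<theta>) \<le> G \<phi>"
proof -
  \<comment> \<open>The representative of \<phi> within \<pi> of \<theta>; between them
    \<open>sin (\<psi> - s)\<close> does not change sign.\<close>
  define \<psi> where "\<psi> = \<theta> + Arg (cis (\<phi> - \<theta>))"
  have cA: "cis (Arg (cis (\<phi> - \<theta>))) = cis (\<phi> - \<theta>)" using cis_Arg[of "cis (\<phi> - \<theta>)"] by (simp add: sgn_eq)
  have "cis \<psi> = cis \<theta> * cis (\<phi> - \<theta>)" by (simp add: \<psi>_def cis_mult[symmetric] cA)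
  then have "cis \<phi> = cis \<psi>" by (simp add: cis_mult)
  then have G\<phi>: "G \<phi> = G \<psi>" by (rule trig_poly_cis_eq[OF G])
  have "cis (\<psi> - \<theta>) = cis (\<phi> - \<theta>)" using cA by (simp add: \<psi>_def)
  then have cs: "cos (\<psi> - \<theta>) = cos (\<phi> - \<theta>)" "sin (\<psi> - \<theta>) = sin (\<phi> - \<theta>)" by (simp_all add: complex_eq_iff)
  have bd: "- pi < \<psi> - \<theta>" "\<psi> - \<theta> \<le> pi" using Arg_bounded[of "cis (\<phi> - \<theta>)"] by (auto simp: \<psi>_def)
  (* k solves k'' + k \<ge> 0 with zero initial data at \<theta>, and mm is its Sturm comparison with sin (\<psi> - s) *)
  define k k1 where "k s = G s - (G \<theta> * cos (s - \<theta>) + G1 \<theta> * sin (s - \<theta>))"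
    and "k1 s = G1 s - (- G \<theta> * sin (s - \<theta>) + G1 \<theta> * cos (s - \<theta>))" for s
  define mm where "mm s = k1 s * sin (\<psi> - s) + k s * cos (\<psi> - s)" for s
  have d: "(mm has_real_derivative (G s + G2 s) * sin (\<psi> - s)) (at s)" for s
    unfolding mm_def[abs_def] k_def k1_def
    by (rule derivative_eq_intros trig_poly_deriv[OF G] refl)+ (simp add: algebra_simps)
  have m0: "mm \<theta> = 0" and m1: "mm \<psi> = k \<psi>" by (simp_all add: mm_def k_def k1_def)
  have "0 \<le> k \<psi>"
  proof (cases "\<theta> \<le> \<psi>")
    case True
    have "mm \<theta> \<le> mm \<psi>"
      by (rule DERIV_nonneg_imp_nondecreasing[OF True])
         (use d pos bd in \<open>auto intro!: exI mult_nonneg_nonneg sin_ge_zero\<close>)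
    then show ?thesis by (simp add: m0 m1)
  next
    case False
    have "mm \<theta> \<le> mm \<psi>"
    proof (rule DERIV_nonpos_imp_nonincreasing[of \<psi> \<theta> mm])
      fix x assume x: "\<psi> \<le> x" "x \<le> \<theta>"
      have "0 \<le> sin (x - \<psi>)" using x bd by (intro sin_ge_zero) auto
      then have "sin (\<psi> - x) \<le> 0" using sin_minus[of "x - \<psi>"] by simp
      then show "\<exists>y. (mm has_real_derivative y) (at x) \<and> y \<le> 0"
        using d pos mult_nonneg_nonpos by blast
    qed (use False in simp)
    then show ?thesis by (simp add: m0 m1)
  qed
  then show ?thesis by (simp add: k_def cs G\<phi>)
qed

text \<open>One half of the classical formula: the area is half the integral of
  \<open>G * (G + G'')\<close>. The arcs \<theta> in [0, \<pi>] and [-\<pi>, 0] are graphs over the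
  same interval, and by convexity each vertical slice of \<open>W\<close> contains the segment
  between them.\<close>

lemma support_area_le:
  assumes G: "trig_poly G G1 G2" and pos: "\<And>\<theta>. 0 < G \<theta> + G2 \<theta>"
    and W: "W \<in> sets borel" "\<And>z. (\<And>\<phi>. Re (z * cis \<phi>) \<le> G \<phi>) \<Longrightarrow> z \<in> W"
  shows "ennreal (integral {- pi..pi} (\<lambda>\<theta>. G \<theta> * (G \<theta> + G2 \<theta>))) \<le> 2 * emeasure lborel W"
proof -
  define R where "R \<theta> = G \<theta> + G2 \<theta>" for \<theta>
  (* X - i Y is the boundary point at which Re (z cis \<theta>) is maximal; the area is computed from vertical slices *)
  define X Y where "X \<theta> = G \<theta> * cos \<theta> - G1 \<theta> * sin \<theta>" and "Y \<theta> = G \<theta> * sin \<theta> + G1 \<theta> * cos \<theta>" for \<theta>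
  have dX: "(X has_real_derivative - R \<theta> * sin \<theta>) (at \<theta>)" for \<theta>
    unfolding X_def[abs_def] R_def by (rule derivative_eq_intros trig_poly_deriv[OF G] refl)+ (simp add: algebra_simps)
  have dY: "(Y has_real_derivative R \<theta> * cos \<theta>) (at \<theta>)" for \<theta>
    unfolding Y_def[abs_def] R_def by (rule derivative_eq_intros trig_poly_deriv[OF G] refl)+ (simp add: algebra_simps)
  have Rpos: "0 < R \<theta>" for \<theta> using pos by (simp add: R_def)
  have Yc: "continuous_on S Y" for S
    unfolding Y_def[abs_def] by (intro continuous_intros trig_poly_continuous[OF G])
  have in_D: "X \<theta> * cos \<phi> + Y \<theta> * sin \<phi> \<le> G \<phi>" for \<theta> \<phi>
    using trig_poly_tangent_le[OF G less_imp_le[OF pos], of \<theta> \<phi>] by (simp add: X_def Y_def cos_diff sin_diff algebra_simps)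
  obtain f1 where f1: "continuous_on {X pi..X 0} f1"
    "\<And>x. x \<in> {X pi..X 0} \<Longrightarrow> \<exists>t\<in>{0..pi}. x = X t \<and> f1 x = Y t"
    "((\<lambda>t. Y t * (- (- R t * sin t))) has_integral integral {X pi..X 0} f1) {0..pi}" "X pi \<le> X 0"
  proof (rule decreasing_curve_graph[of 0 pi X "\<lambda>t. - R t * sin t" Y])
    show "- R t * sin t < 0" if "t \<in> {0<..<pi}" for t
      using mult_pos_pos[OF Rpos sin_gt_zero, of t t] that by simp
  qed (use dX Yc that in auto)
  have Xpi: "X (- pi) = X pi"
    using trig_poly_periodic[OF G, of "- pi"] by (simp add: X_def)
  have dXm: "((\<lambda>t. X (- t)) has_real_derivative - R (- t) * sin t) (at t)" for t
    using DERIV_chain2[OF dX DERIV_minus[OF DERIV_ident], of t] by simp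
  obtain f2 where f2: "continuous_on {X pi..X 0} f2"
    "\<And>x. x \<in> {X pi..X 0} \<Longrightarrow> \<exists>t\<in>{0..pi}. x = X (- t) \<and> f2 x = Y (- t)"
    "((\<lambda>t. Y (- t) * (- (- R (- t) * sin t))) has_integral integral {X pi..X 0} f2) {0..pi}"
  proof (rule decreasing_curve_graph[of 0 pi "\<lambda>t. X (- t)" "\<lambda>t. - R (- t) * sin t" "\<lambda>t. Y (- t)"])
    show "- R (- t) * sin t < 0" if "t \<in> {0<..<pi}" for t
      using mult_pos_pos[OF Rpos sin_gt_zero, of t "- t"] that by simp
    show "continuous_on {0..pi} (\<lambda>t. Y (- t))"
      by (intro continuous_on_compose2[OF Yc[of UNIV]] continuous_intros) auto
  qed (use dXm that Xpi in auto)
  have YR: "((\<lambda>t. Y t * (R t * sin t)) has_integral integral {X pi..X 0} f1) {0..pi}" using f1(3) by simp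
  have "((\<lambda>t. Y (- t) * (R (- t) * sin (- t))) has_integral - integral {X pi..X 0} f2) {0..pi}"
    using has_integral_neg[OF f2(3)] by simp
  then have YR': "((\<lambda>t. Y t * (R t * sin t)) has_integral - integral {X pi..X 0} f2) {- pi..0}"
    by (subst has_integral_reflect_real[symmetric]) simp
  have Q: "((\<lambda>t. Y t * (R t * sin t)) has_integral - integral {X pi..X 0} f2 + integral {X pi..X 0} f1) {- pi..pi}"
    by (rule has_integral_combine[OF _ _ YR' YR]) auto
  \<comment> \<open>Over a full period the derivative of \<open>X * Y\<close> integrates to 0.
    Adding this trades \<open>X dY\<close> for \<open>- Y dX\<close>, so that twice the area under
    the arcs becomes the integral of \<open>G * R\<close>.\<close>
  have "((\<lambda>\<theta>. X \<theta> * (R \<theta> * cos \<theta>) + (- R \<theta> * sin \<theta>) * Y \<theta>) has_integral X pi * Y pi - X (- pi) * Y (- pi)) {- pi..pi}"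
  proof (rule fundamental_theorem_of_calculus)
    fix x
    have "((\<lambda>\<theta>. X \<theta> * Y \<theta>) has_real_derivative X x * (R x * cos x) + (- R x * sin x) * Y x) (at x)"
      by (rule derivative_eq_intros dX dY refl)+ (simp add: algebra_simps)
    then show "((\<lambda>\<theta>. X \<theta> * Y \<theta>) has_vector_derivative X x * (R x * cos x) + (- R x * sin x) * Y x) (at x within {- pi..pi})"
      by (simp add: has_real_derivative_iff_has_vector_derivative has_vector_derivative_at_within)
  qed simp
  moreover have "Y (- pi) = Y pi" using trig_poly_periodic[OF G, of "- pi"] by (simp add: Y_def)
  ultimately have "((\<lambda>\<theta>. X \<theta> * (R \<theta> * cos \<theta>) + (- R \<theta> * sin \<theta>) * Y \<theta>) has_integral 0) {- pi..pi}" by (simp add: Xpi)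
  from has_integral_add[OF this has_integral_mult_right[OF Q, of 2]]
  have "((\<lambda>\<theta>. G \<theta> * R \<theta>) has_integral 2 * (integral {X pi..X 0} f1 - integral {X pi..X 0} f2)) {- pi..pi}"
  proof (rule has_integral_eq_rhs[OF has_integral_eq[rotated]])
    fix \<theta>
    have "X \<theta> * cos \<theta> + Y \<theta> * sin \<theta> = G \<theta> * (cos \<theta> * cos \<theta> + sin \<theta> * sin \<theta>)"
      unfolding X_def Y_def by algebra
    then have "X \<theta> * cos \<theta> + Y \<theta> * sin \<theta> = G \<theta>" by (simp only: sin_cos_squared_add3 mult_1_right)
    then have "R \<theta> * (X \<theta> * cos \<theta> + Y \<theta> * sin \<theta>) = G \<theta> * R \<theta>" by simp
    then show "X \<theta> * (R \<theta> * cos \<theta>) + (- R \<theta> * sin \<theta>) * Y \<theta> + 2 * (Y \<theta> * (R \<theta> * sin \<theta>)) = G \<theta> * R \<theta>"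
      by (simp add: algebra_simps)
  qed simp
  then have total: "integral {- pi..pi} (\<lambda>\<theta>. G \<theta> * (G \<theta> + G2 \<theta>)) = 2 * integral {X pi..X 0} (\<lambda>x. f1 x - f2 x)"
    using integral_diff[OF integrable_continuous_real[OF f1(1)] integrable_continuous_real[OF f2(1)]]
    by (simp add: R_def integral_unique)
  have slice: "ennreal (max 0 (f1 x - f2 x)) \<le> emeasure lborel {y. Complex x y \<in> W}" if x: "x \<in> {X pi..X 0}" for x
  proof (cases "f2 x \<le> f1 x")
    case True
    obtain t where t: "x = X t" "f1 x = Y t" using f1(2)[OF x] by blast
    obtain s where s: "x = X (- s)" "f2 x = Y (- s)" using f2(2)[OF x] by blast
    have "{- f1 x..- f2 x} \<subseteq> {y. Complex x y \<in> W}"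
    proof
      fix y assume y: "y \<in> {- f1 x..- f2 x}"
      have "Complex x y \<in> W"
      proof (rule W(2))
        fix \<phi>
        \<comment> \<open>A linear function on a segment is at most the larger of its end
          values.\<close>
        have "- y * sin \<phi> \<le> max (f1 x * sin \<phi>) (f2 x * sin \<phi>)"
        proof (cases "0 \<le> sin \<phi>")
          case True
          then have "- y * sin \<phi> \<le> f1 x * sin \<phi>" using y by (intro mult_right_mono) auto
          then show ?thesis by simp
        next
          case False
          then have "- y * sin \<phi> \<le> f2 x * sin \<phi>" using y by (intro mult_right_mono_neg) auto
          then show ?thesis by simp
        qed
        moreover have "x * cos \<phi> + f1 x * sin \<phi> \<le> G \<phi>" "x * cos \<phi> + f2 x * sin \<phi> \<le> G \<phi>"
          using in_D[of t \<phi>] in_D[of "- s" \<phi>] t s by simp_all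
        ultimately show "Re (Complex x y * cis \<phi>) \<le> G \<phi>" by simp
      qed
      then show "y \<in> {y. Complex x y \<in> W}" by simp
    qed
    moreover have "{y. Complex x y \<in> W} \<in> sets lborel"
    proof -
      have "(\<lambda>y. Complex x y) \<in> borel_measurable borel"
        unfolding Complex_eq by (intro borel_measurable_continuous_onI continuous_intros)
      from measurable_sets[OF this W(1)] show ?thesis by (simp add: vimage_def)
    qed
    ultimately have "emeasure lborel {- f1 x..- f2 x} \<le> emeasure lborel {y. Complex x y \<in> W}"
      by (rule emeasure_mono)
    then show ?thesis using True by simp
  qed simp
  \<comment> \<open>The order of the two arcs is not established; truncation at 0 only increases the
    integral to be estimated.\<close>
  have fc: "continuous_on {X pi..X 0} (\<lambda>x. max 0 (f1 x - f2 x))"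
    by (intro continuous_intros f1 f2)
  have "ennreal (integral {X pi..X 0} (\<lambda>x. f1 x - f2 x)) \<le> ennreal (integral {X pi..X 0} (\<lambda>x. max 0 (f1 x - f2 x)))"
    by (intro ennreal_leI integral_le integrable_continuous_real continuous_intros f1 f2) auto
  also have "\<dots> = (\<integral>\<^sup>+ x. ennreal (max 0 (f1 x - f2 x)) * indicator {X pi..X 0} x \<partial>lborel)"
  proof -
    have "((\<lambda>x. max 0 (f1 x - f2 x)) has_integral integral {X pi..X 0} (\<lambda>x. max 0 (f1 x - f2 x))) {X pi..X 0}"
      by (intro integrable_integral integrable_continuous_real fc)
    from nn_integral_has_integral_lebesgue'[OF _ this] show ?thesis by simp
  qed
  also have "\<dots> \<le> (\<integral>\<^sup>+ x. emeasure lborel {y. Complex x y \<in> W} \<partial>lborel)"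
    using slice by (intro nn_integral_mono) (simp add: indicator_def)
  also have "\<dots> = emeasure lborel W" by (rule emeasure_lborel_complex[OF W(1), symmetric])
  finally have "2 * ennreal (integral {X pi..X 0} (\<lambda>x. f1 x - f2 x)) \<le> 2 * emeasure lborel W" by (rule mult_left_mono) simp
  moreover have "ennreal (2 * z) \<le> 2 * ennreal z" for z
    by (cases "0 \<le> z") (auto simp: ennreal_mult ennreal_neg)
  ultimately show ?thesis unfolding total by (meson order_trans)
qed

section \<open>The support function of the conjugate domain\<close>

lemma spf_cnj: "spf (cnj ` S) \<theta> = (SUP s\<in>S. Re (s * cis \<theta>))"
proof -
  have "Re (cnj s * exp (- (\<i> * of_real \<theta>))) = Re (s * cis \<theta>)" for s
  proof -
    have "cnj s * exp (- (\<i> * of_real \<theta>)) = cnj (s * cis \<theta>)"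
      using exp_cnj[of "\<i> * of_real \<theta>"] by (simp add: cis_conv_exp)
    then show ?thesis by (simp only: cnj.simps)
  qed
  then show ?thesis by (simp only: spf_def image_image)
qed

context
  fixes S :: "complex set" and h :: "real \<Rightarrow> real"
  assumes S: "S \<noteq> {}" "bounded S" and h: "h = spf (cnj ` S)"
begin

lemma spf_cnj_least: "(\<And>s. s \<in> S \<Longrightarrow> Re (s * cis \<theta>) \<le> c) \<Longrightarrow> h \<theta> \<le> c"
  unfolding h spf_cnj using S by (intro cSUP_least) auto

lemma spf_cnj_upper: "s \<in> S \<Longrightarrow> Re (s * cis \<theta>) \<le> h \<theta>"
  unfolding h by (rule Re_le_spf[OF S(2)])

lemma spf_cnj_periodic: "h (\<theta> + 2 * pi) = h \<theta>"
  unfolding h spf_cnj by (simp add: cis_mult[symmetric])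

text \<open>Follows from \<open>cis (\<theta> + d) + cis (\<theta> - d) = 2 * cos d * cis
  \<theta>\<close> by taking the supremum; the division by \<open>cos d\<close> is the reason for
  the case split.\<close>

lemma spf_cnj_convex:
  assumes "0 \<le> cos d"
  shows "2 * cos d * h \<theta> \<le> h (\<theta> + d) + h (\<theta> - d)"
proof (cases "cos d = 0")
  case True
  obtain s where s: "s \<in> S" using S by blast
  have "cis (\<theta> - d) = - cis (\<theta> + d)"
    using True by (simp add: complex_eq_iff cos_add cos_diff sin_add sin_diff)
  then have "Re (s * cis (\<theta> - d)) = - Re (s * cis (\<theta> + d))" by simp
  then show ?thesis using spf_cnj_upper[OF s, of "\<theta> + d"] spf_cnj_upper[OF s, of "\<theta> - d"] True by simp
next
  case False
  then have c: "0 < cos d" using assms by simp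
  have "h \<theta> \<le> (h (\<theta> + d) + h (\<theta> - d)) / (2 * cos d)"
  proof (rule spf_cnj_least)
    fix s assume s: "s \<in> S"
    have "cis (\<theta> + d) + cis (\<theta> - d) = of_real (2 * cos d) * cis \<theta>"
      by (simp add: complex_eq_iff cos_add cos_diff sin_add sin_diff)
    then have "s * cis (\<theta> + d) + s * cis (\<theta> - d) = of_real (2 * cos d) * (s * cis \<theta>)"
      by (simp add: distrib_left[symmetric] mult.left_commute)
    then have "Re (s * cis (\<theta> + d)) + Re (s * cis (\<theta> - d)) = 2 * cos d * Re (s * cis \<theta>)"
      by (metis Re_complex_of_real Im_complex_of_real diff_zero mult_zero_left plus_complex.sel(1) times_complex.sel(1))
    then have "2 * cos d * Re (s * cis \<theta>) \<le> h (\<theta> + d) + h (\<theta> - d)"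
      using spf_cnj_upper[OF s, of "\<theta> + d"] spf_cnj_upper[OF s, of "\<theta> - d"] by linarith
    then show "Re (s * cis \<theta>) \<le> (h (\<theta> + d) + h (\<theta> - d)) / (2 * cos d)"
      using c by (simp add: pos_le_divide_eq mult.commute)
  qed
  then show ?thesis using c by (simp add: pos_le_divide_eq mult.commute)
qed

lemma spf_cnj_lipschitz:
  assumes B: "\<And>s. s \<in> S \<Longrightarrow> cmod s \<le> B"
  shows "\<bar>h \<theta> - h \<phi>\<bar> \<le> B * cmod (cis \<theta> - cis \<phi>)"
proof -
  have "h a \<le> h b + B * cmod (cis a - cis b)" for a b
  proof (rule spf_cnj_least)
    fix s assume s: "s \<in> S"
    have "Re (s * cis a) = Re (s * cis b) + Re (s * (cis a - cis b))" by (simp add: algebra_simps)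
    also have "Re (s * (cis a - cis b)) \<le> cmod s * cmod (cis a - cis b)"
      using complex_Re_le_cmod[of "s * (cis a - cis b)"] by (simp only: norm_mult)
    also have "\<dots> \<le> B * cmod (cis a - cis b)" by (intro mult_right_mono B s) simp
    finally show "Re (s * cis a) \<le> h b + B * cmod (cis a - cis b)"
      using spf_cnj_upper[OF s, of b] by linarith
  qed
  from this[of \<theta> \<phi>] this[of \<phi> \<theta>] show ?thesis by (simp add: norm_minus_commute abs_le_iff)
qed

lemma spf_cnj_continuous: "continuous_on X h"
proof (rule continuous_at_imp_continuous_on, rule ballI)
  fix x
  obtain B where B: "\<And>s. s \<in> S \<Longrightarrow> cmod s \<le> B" using S(2) by (auto simp: bounded_iff)
  have lip: "\<bar>h \<theta> - h \<phi>\<bar> \<le> B * cmod (cis \<theta> - cis \<phi>)" for \<theta> \<phi>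
    using B by (rule spf_cnj_lipschitz)
  have "(\<lambda>y. B * cmod (cis y - cis x)) \<midarrow>x\<rightarrow> B * cmod (cis x - cis x)" by (intro tendsto_intros)
  then have "(\<lambda>y. B * cmod (cis y - cis x)) \<midarrow>x\<rightarrow> 0" by simp
  moreover have "\<forall>\<^sub>F y in at x. norm (h y - h x) \<le> B * cmod (cis y - cis x)"
    by (rule always_eventually) (simp only: real_norm_def lip simp_thms)
  ultimately have "(\<lambda>y. h y - h x) \<midarrow>x\<rightarrow> 0" by (rule Lim_null_comparison[rotated])
  then show "isCont h x" by (simp add: isCont_def LIM_zero_iff)
qed

text \<open>A separating line would give a direction in which \<open>y\<close> reaches the support
  function. The strict inequality compensates for the hull not being closed.\<close>

lemma spf_cnj_separation:
  assumes y: "\<And>\<theta>. Re (y * cis \<theta>) < h \<theta>"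
  shows "y \<in> convex hull S"
proof (rule ccontr)
  assume "y \<notin> convex hull S"
  then obtain a b where ab: "a \<noteq> 0" "\<forall>x\<in>{y}. a \<bullet> x \<le> b" "\<forall>x\<in>convex hull S. b \<le> a \<bullet> x"
    using separating_hyperplane_sets[of "{y}" "convex hull S"] S(1) by auto
  define \<theta> where "\<theta> = Arg (- cnj a)"
  have ca: "- cnj a = of_real (cmod a) * cis \<theta>"
    using cis_Arg[of "- cnj a"] ab(1) by (simp add: \<theta>_def sgn_eq)
  have ip: "cmod a * Re (x * cis \<theta>) = - (a \<bullet> x)" for x
  proof -
    have "cmod a * Re (x * cis \<theta>) = Re (x * (of_real (cmod a) * cis \<theta>))" by (simp add: algebra_simps)
    also have "\<dots> = - (a \<bullet> x)" unfolding ca[symmetric] by (simp add: inner_complex_def algebra_simps)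
    finally show ?thesis .
  qed
  have "h \<theta> \<le> Re (y * cis \<theta>)"
  proof (rule spf_cnj_least)
    fix s assume "s \<in> S"
    then have "a \<bullet> y \<le> a \<bullet> s" using ab(2,3) hull_subset[of S convex] by force
    then have "cmod a * Re (s * cis \<theta>) \<le> cmod a * Re (y * cis \<theta>)" by (simp only: ip neg_le_iff_le)
    then show "Re (s * cis \<theta>) \<le> Re (y * cis \<theta>)" using ab(1) by simp
  qed
  then show False using y[of \<theta>] by simp
qed

text \<open>Approximating the support function from above enlarges the area by a factor
  \<open>(1 + \<eta>)^2\<close>, while subtracting \<epsilon> saves \<epsilon> times the integral of
  \<open>G + G''\<close>, at least \<open>2 * pi * \<epsilon> * \<rho>\<close>. For small \<eta> the
  saving wins. Taking \<open>p\<close> as origin makes the support function at least \<rho>, so that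
  additive errors become relative ones.\<close>

lemma weighted_mixed_area:
  assumes op: "open S" and \<epsilon>: "0 < \<epsilon>"
  obtains T T1 T2 J where "trig_poly T T1 T2" "\<And>\<theta>. h \<theta> \<le> T \<theta>" "\<And>\<theta>. 0 \<le> T \<theta> + T2 \<theta>"
    "integral {0..2*pi} (\<lambda>\<theta>. (h \<theta> - \<epsilon>) * (T \<theta> + T2 \<theta>)) \<le> 2 * pi * J" "0 \<le> J"
    "pi * J < measure lborel (convex hull S)"
proof -
  let ?A = "measure lborel (convex hull S)"
  have oH: "open (convex hull S)" by (rule open_convex_hull[OF op])
  have bH: "bounded (convex hull S)" by (rule bounded_convex_hull[OF S(2)])
  have fin: "emeasure lborel (convex hull S) < \<infinity>" using bH emeasure_bounded_finite by blast
  have em: "emeasure lborel (convex hull S) = ennreal ?A" using fin by (intro emeasure_eq_ennreal_measure) auto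
  obtain p where p: "p \<in> S" using S by blast
  obtain \<rho> where \<rho>: "0 < \<rho>" "cball p \<rho> \<subseteq> S" using op p open_contains_cball by blast
  have A: "0 < ?A"
  proof -
    have "ball p \<rho> \<subseteq> convex hull S" using \<rho> hull_subset[of S convex] by fastforce
    then have "measure lborel (ball p \<rho>) \<le> ?A"
      using oH fin by (intro measure_mono_fmeasurable) (auto simp: fmeasurable_def)
    moreover have "0 < measure lborel (ball p \<rho>)" using \<rho>(1) content_ball_pos[of \<rho> p] by simp
    ultimately show ?thesis by linarith
  qed
  obtain B where B: "\<And>s. s \<in> S \<Longrightarrow> cmod s \<le> B" using S(2) by (auto simp: bounded_iff)
  have lipB: "\<bar>h \<theta> - h \<phi>\<bar> \<le> B * cmod (cis \<theta> - cis \<phi>)" for \<theta> \<phi>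
    using B by (rule spf_cnj_lipschitz)
  define g where "g \<theta> = h \<theta> - Re (p * cis \<theta>)" for \<theta>
  have g\<rho>: "\<rho> \<le> g \<theta>" for \<theta>
  proof -
    have "p + of_real \<rho> * cis (- \<theta>) \<in> S" using \<rho> by (intro subsetD[OF \<rho>(2)]) (simp add: dist_norm norm_mult)
    from spf_cnj_upper[OF this, of \<theta>] have "Re ((p + of_real \<rho> * cis (- \<theta>)) * cis \<theta>) \<le> h \<theta>" .
    moreover have "(p + of_real \<rho> * cis (- \<theta>)) * cis \<theta> = p * cis \<theta> + of_real \<rho>" by (simp add: algebra_simps cis_mult)
    ultimately show ?thesis by (simp add: g_def)
  qed
  \<comment> \<open>The area grows by at most \<open>3 * \<eta>\<close> times itself, since
    \<open>\<eta> \<le> 1\<close>; a bound with \<open>4\<close> in place of \<open>3\<close> leaves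
    a strict inequality against \<open>pi * \<epsilon> * \<rho>\<close>.\<close>
  define \<eta> where "\<eta> = min 1 (pi * \<epsilon> * \<rho> / (4 * ?A))"
  have \<eta>: "0 < \<eta>" "\<eta> \<le> 1" "\<eta> * (4 * ?A) \<le> pi * \<epsilon> * \<rho>"
  proof -
    show "0 < \<eta>" "\<eta> \<le> 1" using \<epsilon> \<rho> A by (auto simp: \<eta>_def)
    have "\<eta> \<le> pi * \<epsilon> * \<rho> / (4 * ?A)" by (simp add: \<eta>_def)
    then show "\<eta> * (4 * ?A) \<le> pi * \<epsilon> * \<rho>" using A by (subst pos_le_divide_eq[symmetric]) auto
  qed
  obtain G G1 G2 where G: "trig_poly G G1 G2" "\<And>\<theta>. g \<theta> < G \<theta>" "\<And>\<theta>. G \<theta> < g \<theta> + \<eta> * \<rho>" "\<And>\<theta>. 0 < G \<theta> + G2 \<theta>"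
  proof (rule trig_convex_approx[of g "B + cmod p" "\<eta> * \<rho>"])
    show "g (\<theta> + 2 * pi) = g \<theta>" for \<theta> using spf_cnj_periodic[of \<theta>] by (simp add: g_def cis_mult[symmetric])
    show "\<bar>g \<theta> - g \<phi>\<bar> \<le> (B + cmod p) * cmod (cis \<theta> - cis \<phi>)" for \<theta> \<phi>
    proof -
      have "\<bar>Re (p * (cis \<theta> - cis \<phi>))\<bar> \<le> cmod p * cmod (cis \<theta> - cis \<phi>)"
        using abs_Re_le_cmod[of "p * (cis \<theta> - cis \<phi>)"] by (simp only: norm_mult)
      moreover have "g \<theta> - g \<phi> = (h \<theta> - h \<phi>) - Re (p * (cis \<theta> - cis \<phi>))" by (simp add: g_def algebra_simps)
      ultimately show ?thesis
        using lipB[of \<theta> \<phi>] abs_triangle_ineq4[of "h \<theta> - h \<phi>" "Re (p * (cis \<theta> - cis \<phi>))"]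
        unfolding distrib_right by linarith
    qed
    show "2 * cos d * g \<theta> \<le> g (\<theta> + d) + g (\<theta> - d)" if "0 \<le> cos d" for \<theta> d
    proof -
      have "Re (p * cis (\<theta> + d)) + Re (p * cis (\<theta> - d)) = 2 * cos d * Re (p * cis \<theta>)"
        by (simp add: cos_add cos_diff sin_add sin_diff algebra_simps)
      then show ?thesis using spf_cnj_convex[OF that, of \<theta>] unfolding g_def right_diff_distrib by linarith
    qed
  qed (use \<eta> \<rho> that in auto)
  \<comment> \<open>The hull, moved so that \<open>p\<close> becomes the origin and dilated by
    \<open>1 + \<eta>\<close>; it contains the body with support function \<open>G\<close> because
    \<open>G < (1 + \<eta>) * g\<close>.\<close>
  define W where "W = (\<lambda>z. p + (1 / (1 + \<eta>)) *\<^sub>R z) -` (convex hull S)"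
  have Wm: "W \<in> sets borel"
    unfolding W_def by (intro borel_open open_vimage oH continuous_intros)
  have inW: "z \<in> W" if z: "\<And>\<phi>. Re (z * cis \<phi>) \<le> G \<phi>" for z
    unfolding W_def vimage_def mem_Collect_eq
  proof (rule spf_cnj_separation)
    fix \<theta>
    have "G \<theta> < (1 + \<eta>) * g \<theta>"
      using G(3)[of \<theta>] mult_left_mono[OF g\<rho>[of \<theta>] less_imp_le[OF \<eta>(1)]] by (simp add: distrib_right)
    then have "Re (z * cis \<theta>) < (1 + \<eta>) * g \<theta>" using z[of \<theta>] by simp
    then have "Re (z * cis \<theta>) / (1 + \<eta>) < g \<theta>" using \<eta> by (simp add: pos_divide_less_eq mult.commute)
    moreover have "(p + (1 / (1 + \<eta>)) *\<^sub>R z) * cis \<theta> = p * cis \<theta> + (1 / (1 + \<eta>)) *\<^sub>R (z * cis \<theta>)"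
      by (simp add: distrib_right)
    ultimately show "Re ((p + (1 / (1 + \<eta>)) *\<^sub>R z) * cis \<theta>) < h \<theta>" by (simp add: g_def del: times_complex.sel)
  qed
  have eW: "emeasure lborel W = ennreal ((1 + \<eta>)\<^sup>2 * ?A)"
  proof -
    define c where "c = 1 / (1 + \<eta>)"
    have c: "0 < c" using \<eta> by (simp add: c_def)
    have m: "(\<lambda>x. p + c *\<^sub>R x) \<in> lborel \<rightarrow>\<^sub>M borel" by simp
    have "emeasure lborel (convex hull S) = emeasure (density (distr lborel borel (\<lambda>x. p + c *\<^sub>R x)) (\<lambda>_. ennreal (\<bar>c\<bar> ^ DIM(complex)))) (convex hull S)"
      using lborel_affine[of c p] c by simp
    also have "\<dots> = ennreal (c\<^sup>2) * emeasure (distr lborel borel (\<lambda>x. p + c *\<^sub>R x)) (convex hull S)"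
      using oH c by (subst emeasure_density_const) auto
    also have "emeasure (distr lborel borel (\<lambda>x. p + c *\<^sub>R x)) (convex hull S) = emeasure lborel W"
      using oH by (subst emeasure_distr[OF m]) (auto simp: W_def c_def)
    finally have e: "ennreal ?A = ennreal (c\<^sup>2) * emeasure lborel W" unfolding em .
    have "ennreal ((1 + \<eta>)\<^sup>2 * ?A) = ennreal ((1 + \<eta>)\<^sup>2) * ennreal ?A" by (rule ennreal_mult) auto
    also have "\<dots> = ennreal ((1 + \<eta>)\<^sup>2 * c\<^sup>2) * emeasure lborel W"
      unfolding e using c by (simp add: ennreal_mult mult.assoc)
    also have "(1 + \<eta>)\<^sup>2 * c\<^sup>2 = 1" using \<eta> by (simp add: c_def power_divide)
    finally show ?thesis by simp
  qed
  have Gc: "continuous_on X G" "continuous_on X G1" "continuous_on X G2" for X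
    using trig_poly_continuous[OF G(1)] by auto
  define I where "I = integral {0..2*pi} (\<lambda>\<theta>. G \<theta> * (G \<theta> + G2 \<theta>))"
  have Ii: "((\<lambda>\<theta>. G \<theta> * (G \<theta> + G2 \<theta>)) has_integral I) {0..2*pi}"
    unfolding I_def by (intro integrable_integral integrable_continuous_real continuous_intros Gc)
  have I_le: "I \<le> 2 * ((1 + \<eta>)\<^sup>2 * ?A)"
  proof -
    let ?f = "\<lambda>\<theta>. G \<theta> * (G \<theta> + G2 \<theta>)"
    have "integral {0..2*pi} (\<lambda>x. ?f (x + (- pi))) = I"
      unfolding I_def by (rule integral_periodic_shift) (auto intro!: continuous_intros Gc simp: trig_poly_periodic[OF G(1)])
    moreover have "integral {0..2*pi} (\<lambda>x. ?f (x + (- pi))) = integral {- pi..pi} ?f"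
      using integral_shift_Icc_real[of 0 "2*pi" ?f "- pi"] by (simp add: o_def add.commute)
    ultimately have "ennreal I \<le> 2 * emeasure lborel W" using support_area_le[OF G(1,4) Wm inW] by simp
    also have "\<dots> = ennreal (2 * ((1 + \<eta>)\<^sup>2 * ?A))" unfolding eW using A by (simp add: ennreal_mult)
    finally show ?thesis using A by (subst (asm) ennreal_le_iff) auto
  qed
  have i0: "(G2 has_integral 0) {0..2*pi}"
  proof -
    have "(G2 has_integral G1 (2*pi) - G1 0) {0..2*pi}"
      by (rule fundamental_theorem_of_calculus)
         (auto simp flip: has_real_derivative_iff_has_vector_derivative intro!: has_field_derivative_at_within trig_poly_deriv[OF G(1)])
    then show ?thesis using trig_poly_periodic(2)[OF G(1), of 0] by simp
  qed
  \<comment> \<open>\<open>c1\<close> is the support function of the single point \<open>p\<close>.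
    As \<open>c1 + c1'' = 0\<close>, moving the origin back changes neither \<open>T + T2\<close>
    nor its pairing.\<close>
  define c1 c2 where "c1 \<theta> = Re (p * cis \<theta>)" and "c2 \<theta> = Re (\<i> * p * cis \<theta>)" for \<theta>
  have dc: "(c1 has_real_derivative c2 \<theta>) (at \<theta>)" "(c2 has_real_derivative - c1 \<theta>) (at \<theta>)" for \<theta>
    unfolding c1_def[abs_def] c2_def[abs_def] by (auto intro!: derivative_eq_intros)
  have ip: "((\<lambda>\<theta>. c1 \<theta> * (G \<theta> + G2 \<theta>)) has_integral 0) {0..2*pi}"
  proof -
    have "((\<lambda>\<theta>. c1 \<theta> * (G \<theta> + G2 \<theta>)) has_integral (c1 (2*pi) * G1 (2*pi) - c2 (2*pi) * G (2*pi)) - (c1 0 * G1 0 - c2 0 * G 0)) {0..2*pi}"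
    proof (rule fundamental_theorem_of_calculus)
      fix x
      have "((\<lambda>\<theta>. c1 \<theta> * G1 \<theta> - c2 \<theta> * G \<theta>) has_real_derivative c1 x * (G x + G2 x)) (at x)"
        by (rule derivative_eq_intros dc trig_poly_deriv[OF G(1)] refl)+ (simp add: algebra_simps)
      then show "((\<lambda>\<theta>. c1 \<theta> * G1 \<theta> - c2 \<theta> * G \<theta>) has_vector_derivative c1 x * (G x + G2 x)) (at x within {0..2*pi})"
        by (simp add: has_real_derivative_iff_has_vector_derivative has_vector_derivative_at_within)
    qed simp
    then show ?thesis using trig_poly_periodic[OF G(1), of 0] by (simp add: c1_def c2_def)
  qed
  \<comment> \<open>The integral of \<open>G\<close> is the perimeter of the body with support
    function \<open>G\<close>, since \<open>G2\<close> integrates to 0.\<close>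
  have G_int: "2 * pi * \<rho> \<le> integral {0..2*pi} G"
  proof -
    have "integral {0..2*pi} (\<lambda>\<theta>. \<rho>) \<le> integral {0..2*pi} G"
      by (intro integral_le integrable_continuous_real Gc continuous_intros)
         (use g\<rho> G(2) in \<open>meson order_trans less_imp_le\<close>)
    then show ?thesis by simp
  qed
  have Gi: "(G has_integral integral {0..2*pi} G) {0..2*pi}"
    by (intro integrable_integral integrable_continuous_real Gc)
  define T T1 T2 where "T \<theta> = G \<theta> + c1 \<theta>" and "T1 \<theta> = G1 \<theta> + c2 \<theta>" and "T2 \<theta> = G2 \<theta> + - c1 \<theta>" for \<theta>
  have tT: "trig_poly T T1 T2"
    using trig_poly.add[OF G(1) trig_poly.monomial[of p 1]] unfolding T_def[abs_def] T1_def[abs_def] T2_def[abs_def] c1_def c2_def by simp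
  have TT: "T \<theta> + T2 \<theta> = G \<theta> + G2 \<theta>" for \<theta> by (simp add: T_def T2_def)
  have hc: "continuous_on {0..2*pi} h" by (rule spf_cnj_continuous)
  have main: "integral {0..2*pi} (\<lambda>\<theta>. (h \<theta> - \<epsilon>) * (T \<theta> + T2 \<theta>)) \<le> 2 * ((1 + \<eta>)\<^sup>2 * ?A) - 2 * pi * \<epsilon> * \<rho>"
  proof -
    have L: "((\<lambda>\<theta>. (h \<theta> - \<epsilon>) * (T \<theta> + T2 \<theta>)) has_integral integral {0..2*pi} (\<lambda>\<theta>. (h \<theta> - \<epsilon>) * (T \<theta> + T2 \<theta>))) {0..2*pi}"
      by (intro integrable_integral integrable_continuous_real continuous_intros hc trig_poly_continuous[OF tT])
    have Rr: "((\<lambda>\<theta>. (G \<theta> * (G \<theta> + G2 \<theta>) - \<epsilon> * (G \<theta> + G2 \<theta>)) + c1 \<theta> * (G \<theta> + G2 \<theta>)) has_integral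
        (I - \<epsilon> * (integral {0..2*pi} G + 0)) + 0) {0..2*pi}"
      by (intro has_integral_add has_integral_diff has_integral_mult_right Ii Gi i0 ip)
    have "integral {0..2*pi} (\<lambda>\<theta>. (h \<theta> - \<epsilon>) * (T \<theta> + T2 \<theta>)) \<le> (I - \<epsilon> * (integral {0..2*pi} G + 0)) + 0"
    proof (rule has_integral_le[OF L Rr])
      fix \<theta>
      have "h \<theta> - \<epsilon> \<le> (G \<theta> - \<epsilon>) + c1 \<theta>" using G(2)[of \<theta>] by (simp add: g_def c1_def)
      then have "(h \<theta> - \<epsilon>) * (G \<theta> + G2 \<theta>) \<le> ((G \<theta> - \<epsilon>) + c1 \<theta>) * (G \<theta> + G2 \<theta>)"
        using G(4)[of \<theta>] by (intro mult_right_mono) auto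
      then show "(h \<theta> - \<epsilon>) * (T \<theta> + T2 \<theta>) \<le> (G \<theta> * (G \<theta> + G2 \<theta>) - \<epsilon> * (G \<theta> + G2 \<theta>)) + c1 \<theta> * (G \<theta> + G2 \<theta>)"
        unfolding TT by (simp only: distrib_right left_diff_distrib)
    qed
    moreover have "\<epsilon> * (2 * pi * \<rho>) \<le> \<epsilon> * integral {0..2*pi} G" using G_int \<epsilon> by (intro mult_left_mono) auto
    moreover have "\<epsilon> * (2 * pi * \<rho>) = 2 * pi * \<epsilon> * \<rho>" by simp
    ultimately show ?thesis using I_le unfolding add_0_right by linarith
  qed
  define J where "J = max 0 (((1 + \<eta>)\<^sup>2 * ?A - pi * \<epsilon> * \<rho>) / pi)"
  show thesis
  proof (rule that[OF tT])
    show "h \<theta> \<le> T \<theta>" for \<theta> using G(2)[of \<theta>] by (simp add: T_def g_def c1_def)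
    show "0 \<le> T \<theta> + T2 \<theta>" for \<theta> using G(4)[of \<theta>] by (simp add: TT)
    show "0 \<le> J" by (simp add: J_def)
    have "2 * ((1 + \<eta>)\<^sup>2 * ?A) - 2 * pi * \<epsilon> * \<rho> = 2 * pi * (((1 + \<eta>)\<^sup>2 * ?A - pi * \<epsilon> * \<rho>) / pi)" by simp
    also have "\<dots> \<le> 2 * pi * J" unfolding J_def by (intro mult_left_mono) auto
    finally show "integral {0..2*pi} (\<lambda>\<theta>. (h \<theta> - \<epsilon>) * (T \<theta> + T2 \<theta>)) \<le> 2 * pi * J" using main by linarith
    have "(1 + \<eta>)\<^sup>2 * ?A - pi * \<epsilon> * \<rho> < ?A"
    proof -
      have "\<eta> * \<eta> \<le> \<eta> * 1" using \<eta> by (intro mult_left_mono) auto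
      then have "\<eta> * \<eta> * ?A \<le> \<eta> * ?A" using A by (simp add: mult_right_mono)
      moreover have "(1 + \<eta>)\<^sup>2 * ?A = ?A + 2 * (\<eta> * ?A) + \<eta> * \<eta> * ?A" by (simp add: power2_eq_square algebra_simps)
      moreover have "0 < \<eta> * ?A" using \<eta> A by simp
      ultimately show ?thesis using \<eta>(3) by linarith
    qed
    then show "pi * J < ?A" using A by (simp add: J_def max_def)
  qed
qed

end

section \<open>From zeros to the radial counting function and the density condition\<close>

lemma nn_integral_inverse_square_le:
  fixes c d :: real
  assumes c: "0 < c"
  shows "(\<integral>\<^sup>+ t. ennreal (1 / t\<^sup>2) * indicator {c..d} t \<partial>lborel) \<le> ennreal (1 / c)"
proof (cases "c \<le> d")
  case True
  have "((\<lambda>t. 1 / t\<^sup>2) has_integral (- (1 / d) - - (1 / c))) {c..d}"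
    by (rule fundamental_theorem_of_calculus[OF True])
       (use c in \<open>auto intro!: derivative_eq_intros simp: power2_eq_square simp flip: has_real_derivative_iff_has_vector_derivative\<close>)
  then have "(\<integral>\<^sup>+ t. ennreal (1 / t\<^sup>2) * indicator {c..d} t \<partial>lborel) = ennreal (- (1 / d) - - (1 / c))"
    by (intro nn_integral_has_integral_lebesgue') auto
  also have "\<dots> \<le> ennreal (1 / c)" using c True by (intro ennreal_leI) auto
  finally show ?thesis .
qed simp

lemma radial_count_le:
  assumes A: "finite A" "0 \<notin> A" and t: "t < \<rho>"
    and Z0: "Z 0 \<le> enat k" and Z: "\<And>a. a \<noteq> 0 \<Longrightarrow> cmod a < \<rho> \<Longrightarrow> Z a \<le> (if a \<in> A then enat (m a) else 0)"
    and B: "\<And>\<theta>. \<bar>spf S' \<theta>\<bar> \<le> B" and T: "\<And>\<theta>. spf S' \<theta> \<le> T \<theta>" "\<And>\<theta>. 0 \<le> T \<theta>"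
  shows "radial_count Z S' t \<le> ennreal (real k * B) + (\<Sum>a | a \<in> A \<and> cmod a \<le> t. ennreal (real (m a) * T (Arg a)))"
proof -
  have B0: "0 \<le> B" using B[of 0] by linarith
  have en: "ennreal_of_enat x \<le> ennreal (real n)" if "x \<le> enat n" for x n
    using that by (cases x) (auto simp: ennreal_of_nat_eq_real_of_nat ennreal_leI)
  have "(SUP \<theta>. ennreal \<bar>spf S' \<theta>\<bar>) \<le> ennreal B" using B by (intro SUP_least ennreal_leI)
  then have "ennreal_of_enat (Z 0) * (SUP \<theta>. ennreal \<bar>spf S' \<theta>\<bar>) \<le> ennreal (real k) * ennreal B"
    using en[OF Z0] by (intro mult_mono) auto
  also have "\<dots> = ennreal (real k * B)" using B0 by (simp add: ennreal_mult)
  finally have 1: "ennreal_of_enat (Z 0) * (SUP \<theta>. ennreal \<bar>spf S' \<theta>\<bar>) \<le> ennreal (real k * B)" .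
  have "(\<integral>\<^sup>+ z. ennreal_of_enat (Z z) * ennreal (spf S' (Arg z)) \<partial>count_space {z. 0 < cmod z \<and> cmod z \<le> t}) =
      (\<Sum>z | z \<in> A \<and> cmod z \<le> t. ennreal_of_enat (Z z) * ennreal (spf S' (Arg z)))"
  proof (rule nn_integral_count_space')
    show "finite {z \<in> A. cmod z \<le> t}" using A by simp
    show "{z \<in> A. cmod z \<le> t} \<subseteq> {z. 0 < cmod z \<and> cmod z \<le> t}" using A by auto
    fix z assume z: "z \<in> {z. 0 < cmod z \<and> cmod z \<le> t}" "z \<notin> {z \<in> A. cmod z \<le> t}"
    then have "Z z \<le> 0" using Z[of z] t by auto
    then have "Z z = 0" by simp
    then show "ennreal_of_enat (Z z) * ennreal (spf S' (Arg z)) = 0" by simp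
  qed
  also have "\<dots> \<le> (\<Sum>a | a \<in> A \<and> cmod a \<le> t. ennreal (real (m a) * T (Arg a)))"
  proof (rule sum_mono)
    fix a assume a: "a \<in> {a. a \<in> A \<and> cmod a \<le> t}"
    then have "Z a \<le> enat (m a)" using Z[of a] A(2) t by auto
    then have "ennreal_of_enat (Z a) * ennreal (spf S' (Arg a)) \<le> ennreal (real (m a)) * ennreal (T (Arg a))"
      using T by (intro mult_mono en ennreal_leI) auto
    also have "\<dots> = ennreal (real (m a) * T (Arg a))" using T by (simp add: ennreal_mult)
    finally show "ennreal_of_enat (Z a) * ennreal (spf S' (Arg a)) \<le> ennreal (real (m a) * T (Arg a))" .
  qed
  finally show ?thesis unfolding radial_count_def using 1 by (intro add_mono)
qed

text \<open>After exchanging sum and integral, a zero \<open>a\<close> enters at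
  \<open>t = max r (cmod a)\<close> and contributes at most its weight divided by that radius. For
  \<open>cmod a \<le> r\<close> the linear count makes the total O(1); the others give the sum over
  the annulus. Points at the origin add at most \<open>k * B / r\<close>.\<close>

lemma radial_integral_le:
  assumes A: "finite A" "0 \<notin> A" and r: "1 \<le> r" "r \<le> R" "R < \<rho>"
    and Z0: "Z 0 \<le> enat k" and Z: "\<And>a. a \<noteq> 0 \<Longrightarrow> cmod a < \<rho> \<Longrightarrow> Z a \<le> (if a \<in> A then enat (m a) else 0)"
    and B: "\<And>\<theta>. \<bar>spf S' \<theta>\<bar> \<le> B" and T: "\<And>\<theta>. spf S' \<theta> \<le> T \<theta>" "\<And>\<theta>. 0 \<le> T \<theta>"
    and Tm: "\<And>\<theta>. \<theta> \<in> {-pi..pi} \<Longrightarrow> T \<theta> \<le> Tm"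
    and inner: "(\<Sum>a | a \<in> A \<and> cmod a \<le> r. real (m a)) \<le> C * r" "0 \<le> C"
    and outer: "(\<Sum>a | a \<in> A \<and> ln (cmod a) \<in> {ln r..ln R}. real (m a) * T (Arg a) / cmod a) \<le> D"
  shows "(\<integral>\<^sup>+ t. radial_count Z S' t / ennreal (t\<^sup>2) * indicator {r..R} t \<partial>lborel) \<le> ennreal (real k * B + Tm * C + D)"
proof -
  have B0: "0 \<le> B" using B[of 0] by linarith
  define AR where "AR = {a \<in> A. cmod a \<le> R}"
  have fAR: "finite AR" using A by (simp add: AR_def)
  define w where "w a = real (m a) * T (Arg a)" for a
  have w0: "0 \<le> w a" for a using T by (simp add: w_def)
  let ?q = "\<lambda>c t. ennreal (1 / t\<^sup>2) * indicator {c..R} t"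
  have pt: "radial_count Z S' t / ennreal (t\<^sup>2) * indicator {r..R} t \<le>
      ennreal (real k * B) * ?q r t + (\<Sum>a\<in>AR. ennreal (w a) * ?q (max r (cmod a)) t)" for t
  proof (cases "t \<in> {r..R}")
    case True
    then have t: "0 < t" "t < \<rho>" using r by auto
    have "radial_count Z S' t \<le> ennreal (real k * B) + (\<Sum>a | a \<in> A \<and> cmod a \<le> t. ennreal (w a))"
      unfolding w_def by (rule radial_count_le[where Z = Z and \<rho> = \<rho>]) (use A t Z0 Z B T in auto)
    also have "(\<Sum>a | a \<in> A \<and> cmod a \<le> t. ennreal (w a)) = (\<Sum>a\<in>AR. ennreal (w a) * indicator {max r (cmod a)..R} t)"
    proof -
      have "(\<Sum>a\<in>AR. ennreal (w a) * indicator {max r (cmod a)..R} t) = (\<Sum>a | a \<in> A \<and> cmod a \<le> t. ennreal (w a) * indicator {max r (cmod a)..R} t)"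
        using True fAR by (intro sum.mono_neutral_right) (auto simp: AR_def)
      also have "\<dots> = (\<Sum>a | a \<in> A \<and> cmod a \<le> t. ennreal (w a))" using True by (intro sum.cong) auto
      finally show ?thesis by simp
    qed
    finally have "radial_count Z S' t / ennreal (t\<^sup>2) \<le>
        (ennreal (real k * B) + (\<Sum>a\<in>AR. ennreal (w a) * indicator {max r (cmod a)..R} t)) / ennreal (t\<^sup>2)"
      by (rule divide_right_mono_ennreal)
    also have "\<dots> = (ennreal (real k * B) + (\<Sum>a\<in>AR. ennreal (w a) * indicator {max r (cmod a)..R} t)) * ennreal (1 / t\<^sup>2)"
      using t by (simp add: divide_ennreal_def inverse_ennreal inverse_eq_divide)
    also have "\<dots> = ennreal (real k * B) * ?q r t + (\<Sum>a\<in>AR. ennreal (w a) * ?q (max r (cmod a)) t)"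
    proof -
      have "ennreal (real k * B) * ennreal (1 / t\<^sup>2) = ennreal (real k * B) * ?q r t" using True by simp
      moreover have "ennreal (w a) * indicator {max r (cmod a)..R} t * ennreal (1 / t\<^sup>2) = ennreal (w a) * ?q (max r (cmod a)) t" for a
        by (simp only: mult.assoc mult.commute[of "indicator _ _"])
      ultimately show ?thesis by (simp only: distrib_right sum_distrib_right)
    qed
    finally show ?thesis using True by simp
  qed simp
  have "(\<integral>\<^sup>+ t. radial_count Z S' t / ennreal (t\<^sup>2) * indicator {r..R} t \<partial>lborel) \<le>
      (\<integral>\<^sup>+ t. ennreal (real k * B) * ?q r t + (\<Sum>a\<in>AR. ennreal (w a) * ?q (max r (cmod a)) t) \<partial>lborel)"
    by (intro nn_integral_mono pt)
  also have "\<dots> = ennreal (real k * B) * (\<integral>\<^sup>+ t. ?q r t \<partial>lborel) +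
      (\<Sum>a\<in>AR. ennreal (w a) * (\<integral>\<^sup>+ t. ?q (max r (cmod a)) t \<partial>lborel))"
    by (simp add: nn_integral_add nn_integral_sum nn_integral_cmult)
  also have "\<dots> \<le> ennreal (real k * B) * ennreal (1 / r) + (\<Sum>a\<in>AR. ennreal (w a) * ennreal (1 / max r (cmod a)))"
    using r by (intro add_mono mult_left_mono sum_mono nn_integral_inverse_square_le) auto
  also have "\<dots> = ennreal (real k * B * (1 / r) + (\<Sum>a\<in>AR. w a * (1 / max r (cmod a))))"
  proof -
    have "(\<Sum>a\<in>AR. ennreal (w a) * ennreal (1 / max r (cmod a))) = (\<Sum>a\<in>AR. ennreal (w a * (1 / max r (cmod a))))"
      using w0 r by (intro sum.cong refl ennreal_mult[symmetric]) auto
    also have "\<dots> = ennreal (\<Sum>a\<in>AR. w a * (1 / max r (cmod a)))"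
      using w0 r by (intro sum_ennreal mult_nonneg_nonneg) auto
    moreover have "ennreal (real k * B) * ennreal (1 / r) = ennreal (real k * B * (1 / r))"
      using B0 r by (intro ennreal_mult[symmetric]) auto
    moreover have "0 \<le> real k * B * (1 / r)" "0 \<le> (\<Sum>a\<in>AR. w a * (1 / max r (cmod a)))"
      using B0 r w0 by (auto intro!: sum_nonneg mult_nonneg_nonneg divide_nonneg_nonneg)
    ultimately show ?thesis by (simp only: ennreal_plus)
  qed
  also have "\<dots> \<le> ennreal (real k * B + Tm * C + D)"
  proof (rule ennreal_leI)
    have kB: "real k * B * (1 / r) \<le> real k * B" using B0 r mult_left_mono[of "1 / r" 1 "real k * B"] by simp
    let ?A1 = "{a \<in> A. cmod a \<le> r}" and ?A2 = "{a \<in> A. ln (cmod a) \<in> {ln r..ln R}}"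
    have Tm': "T (Arg a) \<le> Tm" for a using Arg_bounded[of a] by (intro Tm) auto
    have Tm0: "0 \<le> Tm" using Tm'[of 0] T(2)[of "Arg 0"] by linarith
    have "AR \<subseteq> ?A1 \<union> ?A2"
    proof
      fix a assume a: "a \<in> AR"
      then have na: "0 < cmod a" using A by (auto simp: AR_def)
      show "a \<in> ?A1 \<union> ?A2"
      proof (cases "cmod a \<le> r")
        case False
        then have "ln r \<le> ln (cmod a)" "ln (cmod a) \<le> ln R" using a na r by (auto simp: AR_def)
        then show ?thesis using a by (auto simp: AR_def)
      qed (use a in \<open>auto simp: AR_def\<close>)
    qed
    then have "(\<Sum>a\<in>AR. w a * (1 / max r (cmod a))) \<le> (\<Sum>a\<in>?A1 \<union> ?A2. w a * (1 / max r (cmod a)))"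
      using A w0 r by (intro sum_mono2) auto
    also have "\<dots> \<le> (\<Sum>a\<in>?A1. w a * (1 / max r (cmod a))) + (\<Sum>a\<in>?A2. w a * (1 / max r (cmod a)))"
    proof -
      have "0 \<le> (\<Sum>a\<in>?A1 \<inter> ?A2. w a * (1 / max r (cmod a)))"
        using w0 r by (intro sum_nonneg mult_nonneg_nonneg) auto
      then show ?thesis using sum.union_inter[of ?A1 ?A2 "\<lambda>a. w a * (1 / max r (cmod a))"] A by simp
    qed
    also have "(\<Sum>a\<in>?A1. w a * (1 / max r (cmod a))) \<le> (\<Sum>a\<in>?A1. (Tm / r) * real (m a))"
    proof (rule sum_mono)
      fix a assume a: "a \<in> ?A1"
      have "w a * (1 / max r (cmod a)) = real (m a) * T (Arg a) / r" using a by (simp add: w_def max_def)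
      also have "\<dots> \<le> real (m a) * Tm / r" using Tm' r by (intro divide_right_mono mult_left_mono) auto
      finally show "w a * (1 / max r (cmod a)) \<le> (Tm / r) * real (m a)" by (simp add: mult.commute)
    qed
    also have "(\<Sum>a\<in>?A1. (Tm / r) * real (m a)) = (Tm / r) * (\<Sum>a\<in>?A1. real (m a))" by (simp add: sum_distrib_left)
    also have "\<dots> \<le> (Tm / r) * (C * r)" using inner Tm0 r by (intro mult_left_mono) auto
    also have "\<dots> = Tm * C" using r by simp
    also have "(\<Sum>a\<in>?A2. w a * (1 / max r (cmod a))) \<le> (\<Sum>a\<in>?A2. real (m a) * T (Arg a) / cmod a)"
    proof (rule sum_mono)
      fix a assume a: "a \<in> ?A2"
      then have "0 < cmod a" using A by auto
      then have "1 / max r (cmod a) \<le> 1 / cmod a" using r by (intro divide_left_mono) auto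
      then have "w a * (1 / max r (cmod a)) \<le> w a * (1 / cmod a)" using w0 by (rule mult_left_mono)
      then show "w a * (1 / max r (cmod a)) \<le> real (m a) * T (Arg a) / cmod a" by (simp add: w_def)
    qed
    also have "\<dots> \<le> D" by (rule outer)
    finally show "real k * B * (1 / r) + (\<Sum>a\<in>AR. w a * (1 / max r (cmod a))) \<le> real k * B + Tm * C + D"
      using kB by simp
  qed
  finally show ?thesis .
qed

text \<open>Half of the gap between \<open>c\<close> and \<open>d\<close> absorbs
  \<open>C / ln a\<close> for large \<open>a\<close>; the other half keeps the inequality strict
  after passing to the upper limit.\<close>

lemma Limsup_log_mean_less:
  fixes \<Phi> :: "real \<Rightarrow> real \<Rightarrow> ennreal"
  assumes bound: "\<And>a. exp 1 \<le> a \<Longrightarrow> \<forall>\<^sub>F r in at_top. \<Phi> a r \<le> ennreal (c * ln a + C)"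
    and c: "0 \<le> c" "c < d" and C: "0 \<le> C"
  shows "Limsup at_top (\<lambda>a. ennreal (1 / ln a) * Limsup at_top (\<Phi> a)) < ennreal d"
proof -
  define \<kappa> where "\<kappa> = (d - c) / 2"
  have \<kappa>: "0 < \<kappa>" using c by (simp add: \<kappa>_def)
  \<comment> \<open>Chosen so that \<open>a \<ge> a0\<close> yields both \<open>ln a \<ge> 1\<close>
    and \<open>C \<le> \<kappa> * ln a\<close>.\<close>
  define a0 where "a0 = exp (1 + C / \<kappa>)"
  have "Limsup at_top (\<lambda>a. ennreal (1 / ln a) * Limsup at_top (\<Phi> a)) \<le> ennreal (c + \<kappa>)"
  proof (rule Limsup_bounded)
    show "\<forall>\<^sub>F a in at_top. ennreal (1 / ln a) * Limsup at_top (\<Phi> a) \<le> ennreal (c + \<kappa>)"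
    proof (rule eventually_at_top_linorderI)
      fix a assume a: "a0 \<le> a"
      have a0: "exp 1 \<le> a0" using C \<kappa> by (simp add: a0_def)
      have la: "1 + C / \<kappa> \<le> ln a"
      proof -
        have "ln a0 \<le> ln a" using a by (subst ln_le_cancel_iff) (auto simp: a0_def intro: less_le_trans[OF exp_gt_zero])
        then show ?thesis by (simp add: a0_def)
      qed
      then have l1: "1 \<le> ln a" using C \<kappa> by (smt (verit) divide_nonneg_pos)
      have "Limsup at_top (\<Phi> a) \<le> ennreal (c * ln a + C)"
        using a a0 by (intro Limsup_bounded bound) simp
      then have "ennreal (1 / ln a) * Limsup at_top (\<Phi> a) \<le> ennreal (1 / ln a) * ennreal (c * ln a + C)"
        by (rule mult_left_mono) simp
      also have "\<dots> = ennreal (1 / ln a * (c * ln a + C))" using l1 c C by (intro ennreal_mult[symmetric]) auto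
      also have "\<dots> \<le> ennreal (c + \<kappa>)"
      proof (rule ennreal_leI)
        have "C / \<kappa> \<le> ln a" using la by simp
        then have "C \<le> \<kappa> * ln a" using \<kappa> by (simp add: pos_divide_le_eq mult.commute)
        then have "C / ln a \<le> \<kappa>" using l1 by (simp add: pos_divide_le_eq)
        moreover have "1 / ln a * (c * ln a + C) = c + C / ln a" using l1 by (simp add: field_simps)
        ultimately show "1 / ln a * (c * ln a + C) \<le> c + \<kappa>" by simp
      qed
      finally show "ennreal (1 / ln a) * Limsup at_top (\<Phi> a) \<le> ennreal (c + \<kappa>)" .
    qed
  qed
  also have "\<dots> < ennreal d" using c \<kappa> by (subst ennreal_less_iff) (auto simp: \<kappa>_def field_simps)
  finally show ?thesis .
qed

theorem mainTheorem2:
  fixes Z :: "complex \<Rightarrow> enat" and S :: "complex set"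
  assumes "open S" and "connected S" and "S \<noteq> {}"
    and "bounded S" and "simply_connected S"
    and "0 \<in> closure (convex hull S)"
    and "Limsup at_top (\<lambda>a::real. ennreal (1 / ln a) *
           Limsup at_top (\<lambda>r::real.
             \<integral>\<^sup>+ t. radial_count Z (cnj ` S) t / ennreal (t\<^sup>2) * indicator {r..a * r} t \<partial>lborel))
         \<ge> ennreal (1 / pi) * emeasure lborel (convex hull S)"
  shows "complete_system (Hol_topology S) (exp_system S Z)"
proof (rule ccontr)
  assume inc: "\<not> complete_system (Hol_topology S) (exp_system S Z)"
  let ?S' = "cnj ` S" and ?A = "measure lborel (convex hull S)"
  define h where "h = spf ?S'"
  obtain F M \<epsilon> where F: "F holomorphic_on UNIV" "\<exists>z. F z \<noteq> 0" and M: "0 < M" and \<epsilon>: "0 < \<epsilon>"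
    and growth: "\<And>t \<theta>. 0 \<le> t \<Longrightarrow> cmod (F (of_real t * cis \<theta>)) \<le> M * exp (t * (h \<theta> - \<epsilon>))"
    and zeros: "\<And>a k. enat k \<le> Z a \<Longrightarrow> \<exists>H. isCont H a \<and> (\<forall>z. F z = (z - a) ^ k * H z)"
    unfolding h_def using incomplete_imp_annihilator[OF assms(1-5) inc] by metis
  \<comment> \<open>Jensen's formula needs a function that does not vanish at 0. The order
    \<open>k\<close> removed here will bound \<open>Z 0\<close>, which \<open>radial_count\<close>
    weights separately.\<close>
  obtain k F1 where F1: "F1 holomorphic_on UNIV" "F1 0 \<noteq> 0" "\<And>z. F z = (z - 0) ^ k * F1 z"
    using entire_factor_out[OF F, of 0] by metis
  have F1c: "isCont F1 a" for a
    using holomorphic_on_imp_continuous_on[OF F1(1)] by (simp add: continuous_on_eq_continuous_at)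
  obtain B where B: "\<And>s. s \<in> S \<Longrightarrow> cmod s \<le> B" using assms(4) by (auto simp: bounded_iff)
  have h_abs: "0 \<le> h \<theta>" "h \<theta> \<le> B" "\<bar>spf ?S' \<theta>\<bar> \<le> B" for \<theta>
  proof -
    have "closure (convex hull ?S') = cnj ` closure (convex hull S)"
      using closure_injective_linear_image[of cnj "convex hull S"] convex_hull_linear_image[of cnj S]
      by (simp add: bounded_linear_cnj bounded_linear.linear inj_def)
    then have "0 \<in> closure (convex hull ?S')" using assms(6) by force
    moreover have "bounded ?S'" using assms(4) by (auto simp: bounded_iff)
    ultimately show "0 \<le> h \<theta>" unfolding h_def by (intro spf_nonneg)
    moreover show "h \<theta> \<le> B"
    proof (rule spf_cnj_least[OF assms(3,4) h_def])
      fix s assume "s \<in> S"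
      then show "Re (s * cis \<theta>) \<le> B"
        using complex_Re_le_cmod[of "s * cis \<theta>"] B[of s] by (simp add: norm_mult del: times_complex.sel)
    qed
    ultimately show "\<bar>spf ?S' \<theta>\<bar> \<le> B" by (simp add: h_def)
  qed
  have B0: "0 \<le> B" using h_abs(1,2)[of 0] by linarith
  obtain T T1 T2 J where T: "trig_poly T T1 T2" and hT: "\<And>\<theta>. h \<theta> \<le> T \<theta>" and TT: "\<And>\<theta>. 0 \<le> T \<theta> + T2 \<theta>"
    and J: "integral {0..2*pi} (\<lambda>\<theta>. (h \<theta> - \<epsilon>) * (T \<theta> + T2 \<theta>)) \<le> 2 * pi * J" "0 \<le> J" "pi * J < ?A"
    by (rule weighted_mixed_area[OF assms(3,4) h_def assms(1) \<epsilon>]) (rule that)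
  have T0: "0 \<le> T \<theta>" for \<theta> using hT[of \<theta>] h_abs(1)[of \<theta>] by linarith
  have hc: "continuous_on {0..2*pi} h"
    by (rule spf_cnj_continuous[OF assms(3,4) h_def])
  interpret exponential_growth F1 "\<lambda>\<theta>. h \<theta> - \<epsilon>" "max 0 (ln M)" B
  proof
    show "F1 0 \<noteq> 0" by (rule F1)
    show "continuous_on {0..2*pi} (\<lambda>\<theta>. h \<theta> - \<epsilon>)" by (intro continuous_intros hc)
    show "h \<theta> - \<epsilon> \<le> B" for \<theta> using h_abs(2)[of \<theta>] \<epsilon> by linarith
    fix t \<theta> :: real assume t: "1 \<le> t"
    \<comment> \<open>Since \<open>t \<ge> 1\<close>, the growth bound passes from \<open>F\<close>
      to the quotient by \<open>z ^ k\<close>.\<close>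
    have "1 * cmod (F1 (of_real t * cis \<theta>)) \<le> t ^ k * cmod (F1 (of_real t * cis \<theta>))"
      using t by (intro mult_right_mono one_le_power) auto
    also have "\<dots> = cmod (F (of_real t * cis \<theta>))"
      using t by (simp add: F1(3) norm_mult norm_power)
    also have "\<dots> \<le> M * exp (t * (h \<theta> - \<epsilon>))" using t by (intro growth) simp
    also have "\<dots> = exp (t * (h \<theta> - \<epsilon>) + ln M)" using M by (simp add: exp_add)
    also have "\<dots> \<le> exp (t * (h \<theta> - \<epsilon>) + max 0 (ln M))" by simp
    finally show "cmod (F1 (of_real t * cis \<theta>)) \<le> exp (t * (h \<theta> - \<epsilon>) + max 0 (ln M))" by simp
  qed (use B0 in auto)
  have Z0: "Z 0 \<le> enat k"
  proof (rule ccontr)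
    assume "\<not> Z 0 \<le> enat k"
    then have "enat (Suc k) \<le> Z 0" by (simp add: Suc_ile_eq)
    from zeros[OF this] obtain H where H: "isCont H 0" "\<And>z. F z = (z - 0) ^ Suc k * H z" by blast
    have eq: "F1 z = z * H z" if "z \<noteq> 0" for z
    proof -
      have "z ^ k * F1 z = F z" using F1(3)[of z] by (simp only: diff_zero)
      also have "\<dots> = z ^ k * (z * H z)" unfolding H(2) by (simp only: diff_zero power_Suc mult_ac)
      finally show ?thesis using that by (simp only: mult_cancel_left power_eq_0_iff) simp
    qed
    have "((\<lambda>z. z * H z) \<longlongrightarrow> 0 * H 0) (at 0)" using H(1) by (intro tendsto_intros) (simp add: isCont_def)
    then have "(F1 \<longlongrightarrow> 0 * H 0) (at 0)"
      by (rule Lim_transform_eventually) (auto simp: eventually_at eq intro!: exI[of _ 1])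
    moreover have "(F1 \<longlongrightarrow> F1 0) (at 0)" using F1c[of 0] by (simp add: isCont_def)
    ultimately have "F1 0 = 0 * H 0" by (rule tendsto_unique[rotated 2, OF _ at_neq_bot])
    then show False using F1(2) by simp
  qed
  have Zm: "Z a \<le> (if a \<in> A then enat (m a) else 0)"
    if fac: "factored F1 \<rho> A m" and a: "a \<noteq> 0" "cmod a < \<rho>" for \<rho> A m a
  proof -
    have mult: "a \<in> A \<and> n \<le> m a" if n: "enat n \<le> Z a" "0 < n" for n
    proof -
      obtain H where H: "isCont H a" "\<And>z. F z = (z - a) ^ n * H z" using zeros[OF n(1)] by blast
      \<comment> \<open>Cofactor of \<open>F1\<close>: away from 0 divide by \<open>z ^ k\<close>;
        the value at 0 is the one that makes the factorization an identity there too, where division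
        is meaningless.\<close>
      define H1 where "H1 z = (if z = 0 then F1 0 / (- a) ^ n else H z / z ^ k)" for z
      show ?thesis
      proof (rule factored_multiplicity[OF fac F1(2) _ _ _ n(2)])
        show "a \<in> ball 0 \<rho>" using a by simp
        have "isCont (\<lambda>z. H z / z ^ k) a" using a by (intro continuous_intros H) auto
        moreover have "\<forall>\<^sub>F z in nhds a. H1 z = H z / z ^ k"
          using t1_space_nhds[OF a(1)] by eventually_elim (simp add: H1_def)
        ultimately show "isCont H1 a" by (simp add: isCont_cong)
        show "F1 z = (z - a) ^ n * H1 z" for z
        proof (cases "z = 0")
          case True then show ?thesis using a by (simp add: H1_def)
        next
          case False
          then have "F1 z = F z / z ^ k" using F1(3)[of z] by simp
          then show ?thesis using H(2)[of z] False by (simp add: H1_def)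
        qed
      qed
    qed
    show ?thesis
    proof (cases "a \<in> A")
      case True
      have "Z a \<le> enat (m a)"
      proof (rule ccontr)
        assume "\<not> Z a \<le> enat (m a)"
        then have "enat (Suc (m a)) \<le> Z a" by (simp add: Suc_ile_eq)
        from mult[OF this] show False by simp
      qed
      with True show ?thesis by simp
    next
      case False
      have "Z a = 0"
      proof (rule ccontr)
        assume "Z a \<noteq> 0"
        then have "enat 1 \<le> Z a" by (cases "Z a") (auto simp: zero_enat_def)
        from mult[OF this] show False using False by simp
      qed
      with False show ?thesis by simp
    qed
  qed
  \<comment> \<open>The cutoff loses a factor
    \<open>(1 + \<delta>) * (1 + 2 * \<delta>) \<le> 1 + 5 * \<delta>\<close>; the constant 10 keeps
    this loss below the gap between \<open>J\<close> and area over \<pi>. Adding 1 to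
    \<open>J\<close> avoids a zero denominator.\<close>
  define \<delta> where "\<delta> = min 1 ((?A / pi - J) / (10 * (J + 1)))"
  have AJ: "0 < ?A / pi - J" using J(3) by (simp add: field_simps)
  have \<delta>: "0 < \<delta>" "\<delta> \<le> 1" "\<delta> * (10 * (J + 1)) \<le> ?A / pi - J"
  proof -
    show "0 < \<delta>" "\<delta> \<le> 1" using AJ J(2) by (auto simp: \<delta>_def)
    have "\<delta> \<le> (?A / pi - J) / (10 * (J + 1))" by (simp add: \<delta>_def)
    then show "\<delta> * (10 * (J + 1)) \<le> ?A / pi - J" using J(2) by (subst pos_le_divide_eq[symmetric]) auto
  qed
  define c where "c = (1 + \<delta>) * (1 + 2 * \<delta>) * J"
  have c0: "0 \<le> c" using \<delta> J(2) by (simp add: c_def)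
  have c1: "c < ?A / pi"
  proof -
    have "\<delta> * \<delta> \<le> \<delta> * 1" using \<delta> by (intro mult_left_mono) auto
    then have "(1 + \<delta>) * (1 + 2 * \<delta>) \<le> 1 + 5 * \<delta>" by (simp add: algebra_simps)
    then have "c \<le> (1 + 5 * \<delta>) * J" unfolding c_def using J(2) by (rule mult_right_mono)
    also have "\<dots> = J + 5 * (\<delta> * J)" by (simp add: algebra_simps)
    finally have "c \<le> J + 5 * (\<delta> * J)" .
    moreover have "0 \<le> \<delta> * J" using \<delta> J(2) by simp
    moreover have "10 * (\<delta> * J) + 10 * \<delta> \<le> ?A / pi - J" using \<delta>(3) by (simp add: algebra_simps)
    ultimately show ?thesis using \<delta>(1) by linarith
  qed
  obtain C where C: "\<And>r \<rho> A m. 1 \<le> r \<Longrightarrow> factored F1 \<rho> A m \<Longrightarrow> exp 2 * r < \<rho> \<Longrightarrow>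
    (\<Sum>a | a \<in> A \<and> cmod a \<le> r. real (m a)) \<le> C * r" and C0: "0 \<le> C"
    using zero_count_bound by metis
  obtain D where D: "\<And>\<sigma> L \<rho> A m. 1 \<le> L \<Longrightarrow> \<delta> * L \<le> \<sigma> \<Longrightarrow> factored F1 \<rho> A m \<Longrightarrow> exp (\<sigma> + (1 + \<delta>) * L) < \<rho> \<Longrightarrow>
    (\<Sum>a | a \<in> A \<and> ln (cmod a) \<in> {\<sigma>..\<sigma> + L}. real (m a) * T (Arg a) / cmod a) \<le> (1 + \<delta>) * (1 + 2 * \<delta>) * L * J + D"
  proof (rule annulus_bound[OF T T0 TT J(1,2) \<delta>(1)], goal_cases)
    case (1 D)
    show ?case by (rule 1(1)[OF 1(2)])
  qed
  obtain Tm where Tm: "\<And>\<theta>. \<theta> \<in> {-pi..pi} \<Longrightarrow> T \<theta> \<le> Tm"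
  proof -
    have "bounded (T ` {-pi..pi})"
      by (intro compact_imp_bounded compact_continuous_image trig_poly_continuous[OF T]) auto
    then show ?thesis using that unfolding bounded_iff by (metis abs_le_D1 imageI real_norm_def)
  qed
  have Tm0: "0 \<le> Tm" using Tm[of 0] T0[of 0] by simp
  let ?\<Phi> = "\<lambda>a r. \<integral>\<^sup>+ t. radial_count Z ?S' t / ennreal (t\<^sup>2) * indicator {r..a * r} t \<partial>lborel"
  let ?C = "real k * B + Tm * C + max 0 D"
  have "Limsup at_top (\<lambda>a. ennreal (1 / ln a) * Limsup at_top (?\<Phi> a)) < ennreal (?A / pi)"
  proof (rule Limsup_log_mean_less[OF _ c0 c1])
    show "0 \<le> ?C" using B0 Tm0 C0 by simp
    fix a :: real assume a: "exp 1 \<le> a"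
    have a0: "0 < a" using a by (rule less_le_trans[OF exp_gt_zero])
    have la: "1 \<le> ln a" using a a0 by (simp add: ln_ge_iff)
    have a1: "1 \<le> a" using a one_le_exp_iff[of 1] by linarith
    show "\<forall>\<^sub>F r in at_top. ?\<Phi> a r \<le> ennreal (c * ln a + ?C)"
    proof (rule eventually_at_top_linorderI)
      \<comment> \<open>\<open>r\<close> is taken at least \<open>a\<close> to the power \<delta>,
        so that the annulus widened by the cutoff stays outside the unit disc.\<close>
      fix r :: real assume r: "exp (\<delta> * ln a) \<le> r"
      have r1: "1 \<le> r"
      proof -
        have "1 \<le> exp (\<delta> * ln a)" using \<delta> la by simp
        then show ?thesis using r by linarith
      qed
      have \<sigma>: "\<delta> * ln a \<le> ln r" using r r1 by (simp add: ln_ge_iff)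
      \<comment> \<open>Large enough for the widened annulus, for the circle of the zero count and
        for all \<open>t\<close> in the integral. The factorization depends on \<open>a\<close> and
        \<open>r\<close>, but the constants \<open>C\<close> and \<open>D\<close> were fixed
        before.\<close>
      define \<rho> where "\<rho> = exp (ln r + (1 + \<delta>) * ln a) + exp 2 * r + a * r + 1"
      have \<rho>: "exp (ln r + (1 + \<delta>) * ln a) < \<rho>" "exp 2 * r < \<rho>" "a * r < \<rho>" "0 < \<rho>"
      proof -
        have "0 < a * r" "0 < exp 2 * r" using a0 r1 by auto
        moreover have "0 < exp (ln r + (1 + \<delta>) * ln a)" by simp
        ultimately show "exp (ln r + (1 + \<delta>) * ln a) < \<rho>" "exp 2 * r < \<rho>" "a * r < \<rho>" "0 < \<rho>"
          unfolding \<rho>_def by linarith+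
      qed
      obtain A m where fac: "factored F1 \<rho> A m" using factored_exists[OF F1(1,2) \<rho>(4)] by blast
      have A: "finite A" "0 \<notin> A" using fac by (auto simp: factored_def)
      have lnR: "ln (a * r) = ln r + ln a" using a0 r1 by (simp add: ln_mult)
      have "?\<Phi> a r \<le> ennreal (real k * B + Tm * C + (c * ln a + max 0 D))"
      proof (rule radial_integral_le[where A = A and m = m and \<rho> = \<rho> and T = T])
        show "r \<le> a * r" using a1 r1 mult_right_mono[of 1 a r] by simp
        show "(\<Sum>z | z \<in> A \<and> ln (cmod z) \<in> {ln r..ln (a * r)}. real (m z) * T (Arg z) / cmod z) \<le> c * ln a + max 0 D"
          using D[OF la \<sigma> fac \<rho>(1)] unfolding lnR by (simp add: c_def mult_ac)
        show "(\<Sum>z | z \<in> A \<and> cmod z \<le> r. real (m z)) \<le> C * r" by (rule C[OF r1 fac \<rho>(2)])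
        show "spf ?S' \<theta> \<le> T \<theta>" for \<theta> using hT[of \<theta>] by (simp add: h_def)
      qed (use A r1 \<rho> Z0 Zm[OF fac] h_abs(3) T0 Tm C0 in auto)
      then show "?\<Phi> a r \<le> ennreal (c * ln a + ?C)" by (simp add: add_ac)
    qed
  qed
  moreover have "ennreal (1 / pi) * emeasure lborel (convex hull S) = ennreal (?A / pi)"
  proof -
    have "emeasure lborel (convex hull S) < \<infinity>"
      using emeasure_bounded_finite[OF bounded_convex_hull[OF assms(4)]] .
    then have "emeasure lborel (convex hull S) = ennreal ?A" by (intro emeasure_eq_ennreal_measure) auto
    then show ?thesis by (simp add: ennreal_mult[symmetric])
  qed
  ultimately show False using assms(7) by (simp add: not_le[symmetric])
qed

end
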